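(* Let $k\ge 2$ be an integer and $(A,E,\varphi)$ a unital $C^*$-correspondence. Then the gauge action of $\mathbb{Z}/k$ on the Cuntz-Pimsner algebra $\mathcal{O}_E$ is free if and only if $$\overline{J_E+I_{k-1}}=A.$$
   Context: A $C^*$-correspondence $(A,E,\varphi)$ over a $C^*$-algebra $A$ is a right Hilbert $A$-module $E$ (inner product $\langle\cdot|\cdot\rangle$, linear in the second variable) with a $*$-homomorphism $\varphi:A\to B(E)$ into the adjointable operators on $E$, giving a left action of $A$ on $E$. It is unital if $A$ and $\varphi$ are unital. $K(E)\subseteq B(E)$ denotes the ideal of compact operators, i.e. the closed span of the operators $|e\rangle\langle f|: x\mapsto e\langle f|x\rangle$. Ideals of $A$: $J_E=\{a\in A : \varphi(a)\in K(E),\ a\ker(\varphi)=\ker(\varphi)a=0\}$. The ideals $I_n$ are defined by $I_0=A$, $I_1=\overline{\mathrm{span}}\{\langle e|f\rangle : e,f\in E\}$, and $I_{n+1}=\overline{\mathrm{span}}\{\langle e|\varphi(x)f\rangle : e,f\in E,\ x\in I_n\}$. Cuntz-Pimsner algebra (Katsura): let $\mathcal{F}(E)=A\oplus E\oplus E^{\otimes 2}\oplus\cdots$ be the Fock space (Hilbert module direct sum; $E^{\otimes n}$ is the $n$-fold internal tensor product over $A$ via $\varphi$). The Pimsner-Toeplitz algebra $\mathcal{T}_E\subseteq B(\mathcal{F}(E))$ is the $C^*$-algebra generated by $A$ (acting on the left on each summand, via $\varphi$ on the first tensor factor) and the creation operators $T_e$, $e\in E$, with $T_e(a)=ea$ for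 $a\in A$ and $T_e(e_1\otimes\cdots\otimes e_n)=e\otimes e_1\otimes\cdots\otimes e_n$. There is a $*$-homomorphism $\psi_1:K(E)\to\mathcal{T}_E$ with $\psi_1(|e\rangle\langle f|)=T_eT_f^*$. Then $\mathcal{O}_E$ is the quotient of $\mathcal{T}_E$ by the closed two-sided ideal generated by $a-\psi_1(\varphi(a))$, $a\in J_E$. Gauge action: $z\in\mathbb{S}^1\subset\mathbb{C}$ acts by the automorphism fixing the image of $A$ and sending (the image of) $T_e$ to $zT_e$, $e\in E$. The gauge action of $\mathbb{Z}/k$ is its restriction to the subgroup $\mathbb{Z}/k\subset\mathbb{S}^1$ of $k$-th roots of unity. Freeness: an action of a compact group $G$ on a unital $C^*$-algebra $B$, regarded as a coaction $\rho:B\to B\otimes C(G)$, is free if the span of $\{(a\otimes 1)\rho(b): a,b\in B\}$ is norm-dense in $B\otimes C(G)$. For $G$ compact abelian this is equivalent to saturation: for every character $\tau\in\widehat{G}$, with $B_\tau=\{b : g\cdot b=\tau(g)b\ \forall g\in G\}$, the linear span of $B_\tau^*B_\tau$ is dense in the fixed-point algebra $B^G$. *)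

theory Defs
  imports "HOL-Analysis.Analysis"
begin

section \<open>Complex Banach spaces and unital \<open>C\<^sup>*\<close>-algebras\<close>

class scaleC =
  fixes scaleC :: "complex \<Rightarrow> 'a \<Rightarrow> 'a"  (infixr "*\<^sub>C" 75)

class complex_vector = scaleC + ab_group_add +
  assumes scaleC_add_right: "c *\<^sub>C (x + y) = c *\<^sub>C x + c *\<^sub>C y"
    and scaleC_add_left: "(c + d) *\<^sub>C x = c *\<^sub>C x + d *\<^sub>C x"
    and scaleC_scaleC: "c *\<^sub>C d *\<^sub>C x = (c * d) *\<^sub>C x"
    and scaleC_one: "1 *\<^sub>C x = x"

global_interpretation complex_vector: vector_space "scaleC :: complex \<Rightarrow> 'a \<Rightarrow> 'a::complex_vector"
  defines csubspace = "module.subspace (scaleC :: complex \<Rightarrow> 'a \<Rightarrow> 'a)"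
    and cspan = "module.span (scaleC :: complex \<Rightarrow> 'a \<Rightarrow> 'a)"
  by standard (simp_all add: scaleC_add_right scaleC_add_left scaleC_scaleC scaleC_one)

class complex_banach = complex_vector + banach +
  assumes scaleR_scaleC: "r *\<^sub>R x = complex_of_real r *\<^sub>C x"
    and norm_scaleC: "norm (c *\<^sub>C x) = cmod c * norm x"

class star =
  fixes star :: "'a \<Rightarrow> 'a"

(* The unit comes from monoid_mult and not from ring_1, so that the zero algebra is included. *)
class unital_cstar_algebra = real_normed_algebra + monoid_mult + complex_banach + star +
  assumes scaleC_mult_left: "(c *\<^sub>C x) * y = c *\<^sub>C (x * y)"
    and scaleC_mult_right: "x * (c *\<^sub>C y) = c *\<^sub>C (x * y)"
    and star_star: "star (star x) = x"
    and star_add: "star (x + y) = star x + star y"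
    and star_scaleC: "star (c *\<^sub>C x) = cnj c *\<^sub>C star x"
    and star_mult: "star (x * y) = star y * star x"
    and cstar_identity: "norm (star x * x) = (norm x)\<^sup>2"

text \<open>Bounded operators into a complex Banach space, with the pointwise complex structure.\<close>

lemma bounded_linear_scaleC: "bounded_linear (\<lambda>x::'a::complex_banach. c *\<^sub>C x)"
proof (rule bounded_linear_intro[where K="cmod c"])
  fix x y :: 'a and r :: real
  show "c *\<^sub>C (x + y) = c *\<^sub>C x + c *\<^sub>C y" by (rule scaleC_add_right)
  show "c *\<^sub>C r *\<^sub>R x = r *\<^sub>R c *\<^sub>C x"
    by (simp add: scaleR_scaleC scaleC_scaleC mult.commute)
  show "norm (c *\<^sub>C x) \<le> norm x * cmod c" by (simp add: norm_scaleC mult.commute)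
qed

instantiation blinfun :: (real_normed_vector, complex_banach) complex_banach
begin

lift_definition scaleC_blinfun :: "complex \<Rightarrow> 'a \<Rightarrow>\<^sub>L 'b \<Rightarrow> 'a \<Rightarrow>\<^sub>L 'b" is "\<lambda>c T x. c *\<^sub>C T x"
  by (rule bounded_linear_compose[OF bounded_linear_scaleC])

instance
proof
  fix c d :: complex and r :: real and S T :: "'a \<Rightarrow>\<^sub>L 'b"
  show "c *\<^sub>C (S + T) = c *\<^sub>C S + c *\<^sub>C T"
    by transfer (simp add: scaleC_add_right)
  show "(c + d) *\<^sub>C S = c *\<^sub>C S + d *\<^sub>C S"
    by transfer (simp add: scaleC_add_left)
  show "c *\<^sub>C d *\<^sub>C S = (c * d) *\<^sub>C S"
    by transfer (simp add: scaleC_scaleC)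
  show "1 *\<^sub>C S = S"
    by transfer (simp add: scaleC_one)
  show "r *\<^sub>R S = complex_of_real r *\<^sub>C S"
    by transfer (simp add: scaleR_scaleC)
  have *: "norm (c *\<^sub>C T) \<le> cmod c * norm T" for c and T :: "'a \<Rightarrow>\<^sub>L 'b"
  proof (rule norm_blinfun_bound)
    fix x
    have "norm (blinfun_apply (c *\<^sub>C T) x) = cmod c * norm (blinfun_apply T x)"
      by (simp add: scaleC_blinfun.rep_eq norm_scaleC)
    also have "\<dots> \<le> cmod c * (norm T * norm x)"
      by (intro mult_left_mono norm_blinfun) simp
    finally show "norm (blinfun_apply (c *\<^sub>C T) x) \<le> cmod c * norm T * norm x"
      by (simp add: mult.assoc)
  qed simp
  show "norm (c *\<^sub>C S) = cmod c * norm S"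
  proof (cases "c = 0")
    case True
    then show ?thesis using *[of c S] by simp
  next
    case False
    have "S = inverse c *\<^sub>C c *\<^sub>C S"
      using False by transfer (simp add: scaleC_scaleC scaleC_one)
    then have "norm S \<le> cmod (inverse c) * norm (c *\<^sub>C S)"
      using *[of "inverse c" "c *\<^sub>C S"] by simp
    then have "cmod c * norm S \<le> norm (c *\<^sub>C S)"
      using False by (simp add: norm_divide field_simps)
    then show ?thesis using *[of c S] by simp
  qed
qed

end

text \<open>
  \<open>*\<close>-homomorphisms on a set \<open>S\<close> closed under the operations; the two products and involutions are
  arguments because both abstract algebras and algebras of operators occur.
\<close>

definition star_hom_on ::
  "'x::complex_vector set \<Rightarrow> ('x \<Rightarrow> 'x \<Rightarrow> 'x) \<Rightarrow> ('x \<Rightarrow> 'x) \<Rightarrow>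
    ('y::complex_vector \<Rightarrow> 'y \<Rightarrow> 'y) \<Rightarrow> ('y \<Rightarrow> 'y) \<Rightarrow> ('x \<Rightarrow> 'y) \<Rightarrow> bool" where
  "star_hom_on S mul st mul' st' h \<longleftrightarrow>
     (\<forall>x\<in>S. \<forall>y\<in>S. h (x + y) = h x + h y \<and> h (mul x y) = mul' (h x) (h y)) \<and>
     (\<forall>x\<in>S. (\<forall>c. h (c *\<^sub>C x) = c *\<^sub>C h x) \<and> h (st x) = st' (h x))"


section \<open>Hilbert modules and their operators\<close>

locale hilbert_module =
  fixes act :: "'e::complex_banach \<Rightarrow> 'a::unital_cstar_algebra \<Rightarrow> 'e"
    and ip :: "'e \<Rightarrow> 'e \<Rightarrow> 'a"
  assumes act_add_left: "act (x + y) a = act x a + act y a"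
    and act_add_right: "act x (a + b) = act x a + act x b"
    and act_mult: "act x (a * b) = act (act x a) b"
    and act_one: "act x 1 = x"
    and act_scaleC_left: "act (c *\<^sub>C x) a = c *\<^sub>C act x a"
    and act_scaleC_right: "act x (c *\<^sub>C a) = c *\<^sub>C act x a"
    and ip_add_right: "ip x (y + z) = ip x y + ip x z"
    and ip_scaleC_right: "ip x (c *\<^sub>C y) = c *\<^sub>C ip x y"
    and ip_act_right: "ip x (act y a) = ip x y * a"
    and ip_star: "star (ip x y) = ip y x"
    and ip_positive: "\<exists>b. ip x x = star b * b"
    and norm_eq_ip: "norm x = sqrt (norm (ip x x))"

definition adjointable :: "('e::complex_banach \<Rightarrow> 'e \<Rightarrow> 'a) \<Rightarrow> ('e \<Rightarrow>\<^sub>L 'e) \<Rightarrow> bool" where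
  "adjointable ip T \<longleftrightarrow> (\<exists>S::'e \<Rightarrow>\<^sub>L 'e. \<forall>x y. ip (S x) y = ip x (T y))"

definition adj :: "('e::complex_banach \<Rightarrow> 'e \<Rightarrow> 'a) \<Rightarrow> ('e \<Rightarrow>\<^sub>L 'e) \<Rightarrow> ('e \<Rightarrow>\<^sub>L 'e)" where
  "adj ip T = (THE S::'e \<Rightarrow>\<^sub>L 'e. \<forall>x y. ip (S x) y = ip x (T y))"

text \<open>\<open>|e\<rangle>\<langle>f|\<close> and the compact operators \<open>K(E)\<close>\<close>

definition ketbra ::
  "('e::complex_banach \<Rightarrow> 'a \<Rightarrow> 'e) \<Rightarrow> ('e \<Rightarrow> 'e \<Rightarrow> 'a) \<Rightarrow> 'e \<Rightarrow> 'e \<Rightarrow> ('e \<Rightarrow>\<^sub>L 'e)" where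
  "ketbra act ip e f = Blinfun (\<lambda>x. act e (ip f x))"

definition compact_ops ::
  "('e::complex_banach \<Rightarrow> 'a \<Rightarrow> 'e) \<Rightarrow> ('e \<Rightarrow> 'e \<Rightarrow> 'a) \<Rightarrow> ('e \<Rightarrow>\<^sub>L 'e) set" where
  "compact_ops act ip = closure (cspan {ketbra act ip e f |e f. True})"

definition cstar_subalgebra ::
  "('e::complex_banach \<Rightarrow> 'e \<Rightarrow> 'a) \<Rightarrow> ('e \<Rightarrow>\<^sub>L 'e) set \<Rightarrow> bool" where
  "cstar_subalgebra ip S \<longleftrightarrow> S \<subseteq> Collect (adjointable ip) \<and> csubspace S \<and> closed S \<and>
     (\<forall>X\<in>S. adj ip X \<in> S \<and> (\<forall>Y\<in>S. X o\<^sub>L Y \<in> S))"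

definition closed_two_sided_ideal ::
  "('e::complex_banach \<Rightarrow>\<^sub>L 'e) set \<Rightarrow> ('e \<Rightarrow>\<^sub>L 'e) set \<Rightarrow> bool" where
  "closed_two_sided_ideal S I \<longleftrightarrow> I \<subseteq> S \<and> csubspace I \<and> closed I \<and>
     (\<forall>X\<in>I. \<forall>Y\<in>S. X o\<^sub>L Y \<in> I \<and> Y o\<^sub>L X \<in> I)"


section \<open>Unital \<open>C\<^sup>*\<close>-correspondences\<close>

locale unital_correspondence = hilbert_module act ip
  for act :: "'e::complex_banach \<Rightarrow> 'a::unital_cstar_algebra \<Rightarrow> 'e" and ip :: "'e \<Rightarrow> 'e \<Rightarrow> 'a" +
  fixes \<phi> :: "'a \<Rightarrow> ('e \<Rightarrow>\<^sub>L 'e)"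
  assumes phi_adjointable: "adjointable ip (\<phi> a)"
    and phi_star_hom: "star_hom_on UNIV (*) star (o\<^sub>L) (adj ip) \<phi>"
    and phi_one: "\<phi> 1 = id_blinfun"
begin

definition J_ideal :: "'a set" where
  "J_ideal = {a. \<phi> a \<in> compact_ops act ip \<and> (\<forall>b. \<phi> b = 0 \<longrightarrow> a * b = 0 \<and> b * a = 0)}"

fun I_ideal :: "nat \<Rightarrow> 'a set" where
  "I_ideal 0 = UNIV"
| "I_ideal (Suc 0) = closure (cspan {ip e f |e f. True})"
| "I_ideal (Suc (Suc n)) = closure (cspan {ip e (\<phi> x f) |e f x. x \<in> I_ideal (Suc n)})"

text \<open>
  The inner product of elementary tensors in \<open>E\<^sup>\<otimes>\<^sup>n\<close>, \<open>n \<ge> 1\<close>, by iterating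
  \<open>\<langle>e \<otimes> x | f \<otimes> y\<rangle> = \<langle>x | \<phi>(\<langle>e|f\<rangle>) y\<rangle>\<close>; for words of different lengths it is \<open>0\<close>.
\<close>

fun tensor_ip :: "'e list \<Rightarrow> 'e list \<Rightarrow> 'a" where
  "tensor_ip [e] [f] = ip e f"
| "tensor_ip (e # e' # es) (f # f' # fs) = tensor_ip (e' # es) (\<phi> (ip e f) f' # fs)"
| "tensor_ip _ _ = 0"

end


section \<open>Fock space and Toeplitz algebra\<close>

text \<open>
  A Hilbert module \<open>F\<close> is the Fock space \<open>A \<oplus> E \<oplus> E\<^sup>\<otimes>\<^sup>2 \<oplus> \<dots>\<close> by means of the inclusion \<open>vac\<close> of
  the summand \<open>A\<close> and of the elementary tensors \<open>tens [e\<^sub>1, \<dots>, e\<^sub>n] = e\<^sub>1 \<otimes> \<dots> \<otimes> e\<^sub>n\<close>, \<open>n \<ge> 1\<close>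
  (\<open>tens []\<close> is not used).  The inner products and the density of the span say that \<open>F\<close> is the
  separated completion of the algebraic direct sum of the algebraic tensor powers; in particular
  linearity of \<open>vac\<close>, multilinearity and \<open>A\<close>-balancedness of \<open>tens\<close> and the formulas for the right
  action follow, and \<open>F\<close> is determined up to a unique unitary.
\<close>

locale fock_module = unital_correspondence act ip \<phi> + F: hilbert_module actF ipF
  for act :: "'e::complex_banach \<Rightarrow> 'a::unital_cstar_algebra \<Rightarrow> 'e" and ip :: "'e \<Rightarrow> 'e \<Rightarrow> 'a"
    and \<phi> :: "'a \<Rightarrow> ('e \<Rightarrow>\<^sub>L 'e)"
    and actF :: "'f::complex_banach \<Rightarrow> 'a \<Rightarrow> 'f" and ipF :: "'f \<Rightarrow> 'f \<Rightarrow> 'a" +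
  fixes vac :: "'a \<Rightarrow> 'f" and tens :: "'e list \<Rightarrow> 'f"
  assumes ip_vac_vac: "ipF (vac a) (vac b) = star a * b"
    and ip_vac_tens: "es \<noteq> [] \<Longrightarrow> ipF (vac a) (tens es) = 0"
    and ip_tens_tens: "es \<noteq> [] \<Longrightarrow> fs \<noteq> [] \<Longrightarrow> ipF (tens es) (tens fs) = tensor_ip es fs"
    and fock_dense: "closure (cspan (range vac \<union> tens ` {es. es \<noteq> []})) = UNIV"
begin

definition left_op :: "'a \<Rightarrow> ('f \<Rightarrow>\<^sub>L 'f)" where
  "left_op a = (THE L::'f \<Rightarrow>\<^sub>L 'f. adjointable ipF L \<and> (\<forall>b. L (vac b) = vac (a * b)) \<and>
     (\<forall>e es. L (tens (e # es)) = tens (\<phi> a e # es)))"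

definition creation :: "'e \<Rightarrow> ('f \<Rightarrow>\<^sub>L 'f)" where
  "creation e = (THE T::'f \<Rightarrow>\<^sub>L 'f. adjointable ipF T \<and> (\<forall>a. T (vac a) = tens [act e a]) \<and>
     (\<forall>es. es \<noteq> [] \<longrightarrow> T (tens es) = tens (e # es)))"

definition toeplitz_algebra :: "('f \<Rightarrow>\<^sub>L 'f) set" where
  "toeplitz_algebra = cstar_subalgebra ipF hull (range left_op \<union> range creation)"

text \<open>\<open>\<psi>\<^sub>1\<close> is unique on \<open>K(E)\<close>; its values elsewhere are irrelevant.\<close>

definition psi1 :: "('e \<Rightarrow>\<^sub>L 'e) \<Rightarrow> ('f \<Rightarrow>\<^sub>L 'f)" where
  "psi1 = (SOME h. star_hom_on (compact_ops act ip) (o\<^sub>L) (adj ip) (o\<^sub>L) (adj ipF) h \<and>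
     h ` compact_ops act ip \<subseteq> toeplitz_algebra \<and>
     (\<forall>e f. h (ketbra act ip e f) = creation e o\<^sub>L adj ipF (creation f)))"

definition covariance_ideal :: "('f \<Rightarrow>\<^sub>L 'f) set" where
  "covariance_ideal = closed_two_sided_ideal toeplitz_algebra hull
     {left_op a - psi1 (\<phi> a) |a. a \<in> J_ideal}"

end


section \<open>Cuntz-Pimsner algebra, gauge action, freeness\<close>

text \<open>
  The \<open>C\<^sup>*\<close>-algebra \<open>'b\<close> is the quotient of the Toeplitz algebra by the covariance ideal, with
  quotient map \<open>q\<close>; its norm is the quotient norm, so the kernel of \<open>q\<close> is exactly the closed ideal.
\<close>

locale cuntz_pimsner_algebra = fock_module act ip \<phi> actF ipF vac tens
  for act :: "'e::complex_banach \<Rightarrow> 'a::unital_cstar_algebra \<Rightarrow> 'e" and ip :: "'e \<Rightarrow> 'e \<Rightarrow> 'a"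
    and \<phi> :: "'a \<Rightarrow> ('e \<Rightarrow>\<^sub>L 'e)"
    and actF :: "'f::complex_banach \<Rightarrow> 'a \<Rightarrow> 'f" and ipF :: "'f \<Rightarrow> 'f \<Rightarrow> 'a"
    and vac :: "'a \<Rightarrow> 'f" and tens :: "'e list \<Rightarrow> 'f" +
  fixes q :: "('f \<Rightarrow>\<^sub>L 'f) \<Rightarrow> 'b::unital_cstar_algebra"
  assumes quotient_star_hom: "star_hom_on toeplitz_algebra (o\<^sub>L) (adj ipF) (*) star q"
    and quotient_surj: "q ` toeplitz_algebra = UNIV"
    and quotient_norm: "X \<in> toeplitz_algebra \<Longrightarrow> norm (q X) = infdist X covariance_ideal"
begin

definition gauge :: "complex \<Rightarrow> 'b \<Rightarrow> 'b" where
  "gauge z = (THE h. star_hom_on UNIV (*) star (*) star h \<and> bij h \<and>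
     (\<forall>a. h (q (left_op a)) = q (left_op a)) \<and>
     (\<forall>e. h (q (creation e)) = z *\<^sub>C q (creation e)))"

end

text \<open>
  Freeness of an action \<open>\<alpha>\<close> of a compact group \<open>G\<close> on a unital \<open>C\<^sup>*\<close>-algebra \<open>B\<close>: under the
  identification of \<open>B \<otimes> C(G)\<close> with \<open>C(G, B)\<close> in the supremum norm, \<open>(a \<otimes> 1) \<rho>(b)\<close> is the
  function \<open>g \<mapsto> a * \<alpha> g b\<close>, and the elements of the span are the finite sums of these (scalars
  are absorbed in \<open>a\<close>).
\<close>

definition free_action ::
  "'g::topological_space set \<Rightarrow> ('g \<Rightarrow> 'b \<Rightarrow> 'b::unital_cstar_algebra) \<Rightarrow> bool" where
  "free_action G \<alpha> \<longleftrightarrow>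
     (\<forall>f. continuous_on G f \<longrightarrow> (\<forall>\<epsilon>>0. \<exists>ps :: ('b \<times> 'b) list. \<forall>g\<in>G.
        norm (f g - (\<Sum>(a, b)\<leftarrow>ps. a * \<alpha> g b)) < \<epsilon>))"

end

theory Submission
  imports Defs
begin

text \<open>
  Write \<open>G\<close> for the group of \<open>k\<close>-th roots of unity, and note that the Fock space has degrees
  \<open>0, 1, 2, \<dots>\<close> on which the gauge unitaries act by \<open>z\<^sup>n\<close>.

  If the action is free, then the function \<open>z \<mapsto> z\<^sup>-\<^sup>1\<close> on \<open>G\<close> is approximated by sums of
  \<open>a \<cdot> \<alpha>\<^sub>z(b)\<close>.  Lifting to the Toeplitz algebra, multiplying by \<open>z\<close>, averaging over \<open>G\<close> and
  compressing to the vacuum, \<open>1\<close> is approximated by a sum of two terms.  The covariance ideal is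
  generated by the operators that are \<open>a \<in> J\<^sub>E\<close> on the vacuum summand and \<open>0\<close> on the others, so
  it contributes an element of the closure of \<open>J\<^sub>E\<close>.  The rest consists of inner products with vectors whose
  degree is \<open>-1\<close> modulo \<open>k\<close>, hence at least \<open>k - 1\<close>, and these lie in \<open>I\<^sub>k\<^sub>-\<^sub>1\<close>.

  Conversely, \<open>z\<^sup>-\<^sup>1 x\<close> is in the closed span of the functions \<open>a \<cdot> \<alpha>\<^sub>z(b)\<close> for \<open>x \<in> J\<^sub>E\<close>, because \<open>x\<close> is then a
  limit of sums of \<open>T\<^sub>e T\<^sub>f\<^sup>*\<close> in the quotient, and for \<open>x \<in> I\<^sub>k\<^sub>-\<^sub>1\<close>, because \<open>x\<close> is a limit of sums
  of \<open>u\<^sup>* v\<close> with \<open>v\<close> of degree \<open>k - 1\<close>.  If \<open>J\<^sub>E + I\<^sub>k\<^sub>-\<^sub>1\<close> is dense, then \<open>z\<^sup>-\<^sup>1\<close>, all its powers and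
  by Fourier expansion all functions on \<open>G\<close> are in the closed span.

  No spectral theory is needed: a self-adjoint element of norm less than 1 is the real part
  of a unitary by a fixed point argument, which makes every \<open>*\<close>-homomorphism bounded, and bounds up to
  a constant factor suffice throughout.
\<close>

section \<open>Complex subspaces and their closures\<close>

text \<open>The objects \<open>left_op\<close>, \<open>creation\<close>, \<open>psi1\<close> and
  \<open>gauge\<close> are given by descriptions, so each has to be constructed and, where it
  matters, shown to be unique before anything is known of it. The obstacle is an operator
  \<open>K\<close> on the first tensor factor: its bound on sums of elementary tensors usually comes
  from positivity of norm squared minus \<open>K\<close> adjoint times \<open>K\<close>. Unitaries
  take the place of positivity. They preserve all inner products of generators, and the fixed point
  argument that bounds homomorphisms also shows that they span the adjointable operators. Creation
  operators come next, because their Gram matrix is given by the left action of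
  \<open>ip e e\<close>.

  That the function z^-1 suffices in the converse direction rests on one identity: c * (a *
  \<alpha>(b)) * \<alpha>(d) = (c * a) * \<alpha>(b * d) for every automorphism \<alpha>. So the
  closed span is stable under constants on the left and orbits on the right, and placing an
  approximation of z^-1 around z^-m produces z^-(m+1).\<close>

lemma tendsto_scaleC [tendsto_intros]:
  fixes f :: "'x \<Rightarrow> 'a::complex_banach"
  shows "(f \<longlongrightarrow> l) F \<Longrightarrow> ((\<lambda>x. c *\<^sub>C f x) \<longlongrightarrow> c *\<^sub>C l) F"
  by (rule bounded_linear.tendsto[OF bounded_linear_scaleC])

lemma continuous_on_scaleC [continuous_intros]:
  fixes f :: "'x::topological_space \<Rightarrow> 'a::complex_banach"
  shows "continuous_on S f \<Longrightarrow> continuous_on S (\<lambda>x. c *\<^sub>C f x)"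
  by (rule bounded_linear.continuous_on[OF bounded_linear_scaleC])

lemma scaleC_simps [simp]:
  fixes x :: "'a::complex_banach"
  shows "1 *\<^sub>C x = x" "c *\<^sub>C d *\<^sub>C x = (c * d) *\<^sub>C x"
    "(- c) *\<^sub>C x = - (c *\<^sub>C x)" "c *\<^sub>C (- x) = - (c *\<^sub>C x)"
  by (simp_all add: scaleC_one scaleC_scaleC complex_vector.scale_minus_left)

lemma scaleC_diff_right: "c *\<^sub>C (x - y) = c *\<^sub>C x - c *\<^sub>C (y::'a::complex_vector)"
  by (rule complex_vector.scale_right_diff_distrib)

lemma scaleC_sum_right: "c *\<^sub>C (\<Sum>i\<in>I. f i) = (\<Sum>i\<in>I. c *\<^sub>C (f i::'a::complex_vector))"
  by (rule complex_vector.scale_sum_right)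

lemma scaleC_sum_left: "(\<Sum>i\<in>I. f i) *\<^sub>C (x::'a::complex_vector) = (\<Sum>i\<in>I. f i *\<^sub>C x)"
  by (rule complex_vector.scale_sum_left)

lemma closure_csubspace:
  fixes S :: "'a::complex_banach set"
  assumes "csubspace S"
  shows "csubspace (closure S)"
proof (rule complex_vector.subspaceI)
  show "0 \<in> closure S"
    using closure_subset complex_vector.subspace_0[OF assms] by blast
next
  fix x y assume "x \<in> closure S" "y \<in> closure S"
  then obtain f g where "\<And>n. f n \<in> S" "f \<longlonglongrightarrow> x" "\<And>n. g n \<in> S" "g \<longlonglongrightarrow> y"
    unfolding closure_sequential by blast
  then have "\<And>n. f n + g n \<in> S" "(\<lambda>n. f n + g n) \<longlonglongrightarrow> x + y"
    using complex_vector.subspace_add[OF assms] by (auto intro: tendsto_add)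
  then show "x + y \<in> closure S" unfolding closure_sequential
    by (intro exI[of _ "\<lambda>n. f n + g n"]) auto
next
  fix c x assume "x \<in> closure S"
  then obtain f where "\<And>n. f n \<in> S" "f \<longlonglongrightarrow> x"
    unfolding closure_sequential by blast
  then have "\<And>n. c *\<^sub>C f n \<in> S" "(\<lambda>n. c *\<^sub>C f n) \<longlonglongrightarrow> c *\<^sub>C x"
    using complex_vector.subspace_scale[OF assms] by (auto intro: tendsto_scaleC)
  then show "c *\<^sub>C x \<in> closure S" unfolding closure_sequential
    by (intro exI[of _ "\<lambda>n. c *\<^sub>C f n"]) auto
qed

lemma csubspace_closure_cspan: "csubspace (closure (cspan (B :: 'a::complex_banach set)))"
  by (rule closure_csubspace[OF complex_vector.subspace_span])

lemma closure_cspan_minimal: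
  fixes B :: "'a::complex_banach set"
  assumes "B \<subseteq> S" "csubspace S" "closed S"
  shows "closure (cspan B) \<subseteq> S"
  by (intro closure_minimal complex_vector.span_minimal assms)

lemma closure_cspan_base: "x \<in> B \<Longrightarrow> x \<in> closure (cspan (B :: 'a::complex_banach set))"
  using closure_subset complex_vector.span_superset by blast

lemma closure_cspan_mono:
  "A \<subseteq> B \<Longrightarrow> closure (cspan A) \<subseteq> closure (cspan (B :: 'a::complex_banach set))"
  by (intro closure_mono complex_vector.span_mono)


text \<open>Bounded operators of this type are only real linear: a scalar always leaves the left
  factor, but it leaves the right factor only if the left one is complex linear.\<close>

lemma blinfun_compose_scaleC_left:
  "(c *\<^sub>C S) o\<^sub>L T = c *\<^sub>C (S o\<^sub>L T)" for S :: "'b::real_normed_vector \<Rightarrow>\<^sub>L 'c::complex_banach"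
  by (rule blinfun_eqI) (simp add: scaleC_blinfun.rep_eq)

section \<open>Roots of unity\<close>

lemma root_of_unity_cmod:
  assumes "z ^ k = (1::complex)" "k \<ge> 1"
  shows "cmod z = 1"
proof -
  have "cmod z ^ k = 1 ^ k" using assms(1) by (metis norm_one norm_power power_one)
  then show ?thesis using assms(2) power_eq_imp_eq_base[of "cmod z" k 1] by simp
qed

lemma cnj_mult_self: "cmod z = 1 \<Longrightarrow> cnj z * z = 1" "cmod z = 1 \<Longrightarrow> z * cnj z = 1"
  by (metis complex_norm_square mult.commute of_real_1 power_one)+

text \<open>Degree \<open>k - 1\<close> carries the character z^-1; this is how
  \<open>I_ideal (k - 1)\<close> enters.\<close>

lemma root_of_unity_power_pred:
  assumes "z ^ k = (1::complex)" "k \<ge> 1"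
  shows "z ^ (k - 1) = cnj z"
proof -
  have "cnj z = cnj z * (z * z ^ (k - 1))"
    using assms power_Suc[of z "k - 1"] by simp
  then show ?thesis
    using cnj_mult_self[OF root_of_unity_cmod[OF assms]] by (simp flip: mult.assoc)
qed

text \<open>Multiplication by a root \<open>w\<close> with \<open>w ^ m \<noteq> 1\<close> permutes
  the roots and multiplies the sum by \<open>w ^ m\<close>. Such a \<open>w\<close> exists, since
  otherwise all \<open>k\<close> roots would solve an equation of the smaller degree
  \<open>m mod k\<close>.\<close>

lemma sum_roots_unity_power:
  assumes "k \<ge> 1" "\<not> k dvd m"
  shows "(\<Sum>z | z ^ k = (1::complex). z ^ m) = 0"
proof -
  let ?G = "{z::complex. z ^ k = 1}"
  define r where "r = m mod k"
  have r: "0 < r" "r < k" using assms by (auto simp: r_def mod_greater_zero_iff_not_dvd)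
  have "\<exists>w\<in>?G. w ^ m \<noteq> 1"
  proof (rule ccontr)
    assume "\<not> ?thesis"
    moreover have "w ^ m = w ^ r" if "w \<in> ?G" for w
    proof -
      have "w ^ m = w ^ (k * (m div k) + r)" by (simp add: r_def)
      then show ?thesis using that by (simp add: power_add power_mult)
    qed
    ultimately have "?G \<subseteq> {w. w ^ r = 1}" by auto
    then have "k \<le> r"
      using card_mono[of "{w::complex. w ^ r = 1}" ?G] r finite_roots_unity[of r]
      by (simp add: card_roots_unity_eq)
    then show False using r by simp
  qed
  then obtain w :: complex where w: "w ^ k = 1" "w ^ m \<noteq> 1" by blast
  have w0: "w \<noteq> 0" using w(1) assms(1) by (auto simp: power_0_left)
  have "bij_betw ((*) w) ?G ?G"
    by (rule bij_betwI[of _ _ _ "(*) (inverse w)"])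
      (use w w0 in \<open>auto simp: power_mult_distrib power_inverse\<close>)
  then have "(\<Sum>z\<in>?G. z ^ m) = (\<Sum>z\<in>?G. (w * z) ^ m)"
    using sum.reindex_bij_betw[of "(*) w" ?G ?G "\<lambda>z. z ^ m"] by simp
  also have "\<dots> = w ^ m * (\<Sum>z\<in>?G. z ^ m)"
    by (simp add: power_mult_distrib sum_distrib_left)
  finally show ?thesis using w(2) by auto
qed

lemma sum_powers_root_unity:
  assumes "u ^ k = (1::complex)"
  shows "(\<Sum>m<k. u ^ m) = (if u = 1 then of_nat k else 0)"
  using assms by (simp add: geometric_sum)


section \<open>Automatic continuity of \<open>*\<close>-homomorphisms\<close>

text \<open>The algebra lives on a subset of a Banach space and has no unit and no C*-identity among
  its axioms; the involution is merely bounded. This covers abstract algebras, the adjointable and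
  the compact operators and the Toeplitz algebra, where adjoints are only estimated up to a
  factor.\<close>

locale star_algebra_on =
  fixes S :: "'x::complex_banach set" and mul :: "'x \<Rightarrow> 'x \<Rightarrow> 'x" and st :: "'x \<Rightarrow> 'x"
  assumes subspace: "csubspace S"
    and closed: "closed S"
    and mul_closed: "x \<in> S \<Longrightarrow> y \<in> S \<Longrightarrow> mul x y \<in> S"
    and st_closed: "x \<in> S \<Longrightarrow> st x \<in> S"
    and mul_add_left: "x \<in> S \<Longrightarrow> y \<in> S \<Longrightarrow> z \<in> S \<Longrightarrow> mul (x + y) z = mul x z + mul y z"
    and mul_add_right: "x \<in> S \<Longrightarrow> y \<in> S \<Longrightarrow> z \<in> S \<Longrightarrow> mul x (y + z) = mul x y + mul x z"
    and mul_scaleC_left: "x \<in> S \<Longrightarrow> y \<in> S \<Longrightarrow> mul (c *\<^sub>C x) y = c *\<^sub>C mul x y"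
    and mul_scaleC_right: "x \<in> S \<Longrightarrow> y \<in> S \<Longrightarrow> mul x (c *\<^sub>C y) = c *\<^sub>C mul x y"
    and mul_assoc: "x \<in> S \<Longrightarrow> y \<in> S \<Longrightarrow> z \<in> S \<Longrightarrow> mul (mul x y) z = mul x (mul y z)"
    and norm_mul: "x \<in> S \<Longrightarrow> y \<in> S \<Longrightarrow> norm (mul x y) \<le> norm x * norm y"
    and st_add: "x \<in> S \<Longrightarrow> y \<in> S \<Longrightarrow> st (x + y) = st x + st y"
    and st_scaleC: "x \<in> S \<Longrightarrow> st (c *\<^sub>C x) = cnj c *\<^sub>C st x"
    and st_mul: "x \<in> S \<Longrightarrow> y \<in> S \<Longrightarrow> st (mul x y) = mul (st y) (st x)"
    and st_st: "x \<in> S \<Longrightarrow> st (st x) = x"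
    and st_bounded: "\<exists>C. \<forall>x\<in>S. norm (st x) \<le> C * norm x"
begin

lemma add_closed: "x \<in> S \<Longrightarrow> y \<in> S \<Longrightarrow> x + y \<in> S"
  and scaleC_closed: "x \<in> S \<Longrightarrow> c *\<^sub>C x \<in> S"
  and zero_closed: "0 \<in> S"
  and minus_closed: "x \<in> S \<Longrightarrow> - x \<in> S"
  and diff_closed: "x \<in> S \<Longrightarrow> y \<in> S \<Longrightarrow> x - y \<in> S"
  using subspace by (auto intro: complex_vector.subspace_add complex_vector.subspace_scale
      complex_vector.subspace_0 complex_vector.subspace_neg complex_vector.subspace_diff)

lemma mul_minus_left: "x \<in> S \<Longrightarrow> y \<in> S \<Longrightarrow> mul (- x) y = - mul x y"
  using mul_scaleC_left[of x y "-1"] by simp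

lemma mul_minus_right: "x \<in> S \<Longrightarrow> y \<in> S \<Longrightarrow> mul x (- y) = - mul x y"
  using mul_scaleC_right[of x y "-1"] by simp

lemma st_minus: "x \<in> S \<Longrightarrow> st (- x) = - st x"
  using st_scaleC[of x "-1"] by simp

lemma mul_diff_left: "x \<in> S \<Longrightarrow> y \<in> S \<Longrightarrow> z \<in> S \<Longrightarrow> mul (x - y) z = mul x z - mul y z"
  using mul_add_left[of x "-y" z] by (simp add: mul_minus_left minus_closed)

lemma mul_diff_right: "x \<in> S \<Longrightarrow> y \<in> S \<Longrightarrow> z \<in> S \<Longrightarrow> mul x (y - z) = mul x y - mul x z"
  using mul_add_right[of x y "-z"] by (simp add: mul_minus_right minus_closed)

lemma st_diff: "x \<in> S \<Longrightarrow> y \<in> S \<Longrightarrow> st (x - y) = st x - st y"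
  using st_add[of x "-y"] by (simp add: st_minus minus_closed)

lemma st_zero: "st 0 = 0"
  using st_scaleC[of 0 0] zero_closed by simp

lemma tendsto_st:
  assumes "\<And>n. f n \<in> S" "f \<longlonglongrightarrow> x"
  shows "(\<lambda>n. st (f n)) \<longlonglongrightarrow> st x"
proof -
  have x: "x \<in> S" using closed assms closed_sequentially by blast
  obtain C where C: "\<And>x. x \<in> S \<Longrightarrow> norm (st x) \<le> C * norm x" using st_bounded by blast
  have "(\<lambda>n. st (f n) - st x) \<longlonglongrightarrow> 0"
  proof (rule Lim_null_comparison)
    show "\<forall>\<^sub>F n in sequentially. norm (st (f n) - st x) \<le> C * norm (f n - x)"
      using C[OF diff_closed[OF assms(1) x]] by (simp add: st_diff assms x)
    show "(\<lambda>n. C * norm (f n - x)) \<longlonglongrightarrow> 0"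
      using assms(2) by (auto intro!: tendsto_eq_intros simp: LIM_zero)
  qed
  then show ?thesis by (rule LIM_zero_cancel)
qed

lemma tendsto_mul:
  assumes "\<And>n. f n \<in> S" "f \<longlonglongrightarrow> x" "y \<in> S"
  shows "(\<lambda>n. mul y (f n)) \<longlonglongrightarrow> mul y x" and "(\<lambda>n. mul (f n) y) \<longlonglongrightarrow> mul x y"
proof -
  have x: "x \<in> S" using closed assms closed_sequentially by blast
  have 0: "(\<lambda>n. norm y * norm (f n - x)) \<longlonglongrightarrow> 0"
    using assms(2) by (auto intro!: tendsto_eq_intros simp: LIM_zero)
  have "(\<lambda>n. mul y (f n) - mul y x) \<longlonglongrightarrow> 0"
    by (rule Lim_null_comparison[OF _ 0])
      (use norm_mul[OF assms(3) diff_closed[OF assms(1) x]] in \<open>simp add: mul_diff_right assms x\<close>)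
  then show "(\<lambda>n. mul y (f n)) \<longlonglongrightarrow> mul y x" by (rule LIM_zero_cancel)
  have "(\<lambda>n. mul (f n) y - mul x y) \<longlonglongrightarrow> 0"
    by (rule Lim_null_comparison[OF _ 0])
      (use norm_mul[OF diff_closed[OF assms(1) x] assms(3)] in
        \<open>simp add: mul_diff_left assms x mult.commute\<close>)
  then show "(\<lambda>n. mul (f n) y) \<longlonglongrightarrow> mul x y" by (rule LIM_zero_cancel)
qed

text \<open>
  Here \<open>1 + s\<close> is a square root of \<open>1 - K\<^sup>2\<close>, so that \<open>K + \<i> (1 + s)\<close> is unitary; the algebra need not
  have a unit.  The element \<open>- s\<close> is the fixed point of \<open>y \<mapsto> (K\<^sup>2 + y\<^sup>2) / 2\<close>.
\<close>

lemma quasi_sqrt_exists: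
  assumes K: "K \<in> S" "st K = K" "norm K < 1"
  shows "\<exists>s\<in>S. st s = s \<and> mul K s = mul s K \<and> s + s + mul s s + mul K K = 0"
proof -
  \<comment> \<open>The smaller root of \<open>t = ((norm K)\<^sup>2 + t\<^sup>2) / 2\<close>: the
    ball of radius \<open>c\<close> is mapped into itself, and \<open>c\<close> is also the
    contraction constant on it.\<close>
  define c where "c = 1 - sqrt (1 - (norm K)\<^sup>2)"
  have d: "(norm K)\<^sup>2 < 1" using K(3) by (simp add: power_less_one_iff)
  have c: "0 \<le> c" "c < 1" using d by (simp_all add: c_def)
  have c_eq: "((norm K)\<^sup>2 + c\<^sup>2) / 2 = c"
    using d by (simp add: c_def power2_diff real_sqrt_pow2)
  \<comment> \<open>Self-adjointness and commutation with \<open>K\<close> are closed conditions; as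
    part of \<open>Y\<close> they pass to the fixed point.\<close>
  define Y where "Y = {y\<in>S. norm y \<le> c \<and> st y = y \<and> mul K y = mul y K}"
  define g where "g y = (1/2) *\<^sub>C (mul K K + mul y y)" for y
  have "complete Y"
  proof -
    have "closed Y" unfolding closed_sequential_limits
    proof (intro allI impI, elim conjE)
      fix f l assume f: "\<forall>n. f n \<in> Y" and l: "f \<longlonglongrightarrow> l"
      have fS: "f n \<in> S" for n using f by (simp add: Y_def)
      have lS: "l \<in> S" using closed fS l closed_sequentially by blast
      have "norm l \<le> c"
        by (rule LIMSEQ_le_const2[OF tendsto_norm[OF l]]) (use f in \<open>auto simp: Y_def\<close>)
      moreover have "st l = l"
        using tendsto_st[OF fS l] l f by (simp add: Y_def LIMSEQ_unique)
      moreover have "mul K l = mul l K"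
        using tendsto_mul[OF fS l K(1)] f by (simp add: Y_def LIMSEQ_unique)
      ultimately show "l \<in> Y" using lS by (simp add: Y_def)
    qed
    then show ?thesis by (simp add: complete_eq_closed)
  qed
  moreover have "Y \<noteq> {}"
    using zero_closed c st_zero mul_scaleC_left[of 0 K 0] mul_scaleC_right[of K 0 0] K(1)
    by (auto simp: Y_def intro!: exI[of _ 0])
  moreover have "g ` Y \<subseteq> Y"
  proof
    fix x assume "x \<in> g ` Y"
    then obtain y where y: "y \<in> S" "norm y \<le> c" "st y = y" "mul K y = mul y K" "x = g y"
      by (auto simp: Y_def)
    have KK: "mul K K \<in> S" "mul y y \<in> S" "mul K K + mul y y \<in> S"
      using K y by (auto intro: mul_closed add_closed)
    have "norm x \<le> (norm K * norm K + norm y * norm y) / 2"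
      using norm_triangle_ineq[of "mul K K" "mul y y"] norm_mul[OF K(1) K(1)] norm_mul[OF y(1) y(1)]
      by (simp add: y g_def norm_scaleC)
    also have "\<dots> \<le> ((norm K)\<^sup>2 + c\<^sup>2) / 2"
      using mult_mono[OF y(2) y(2)] c by (simp add: power2_eq_square)
    finally have "norm x \<le> c" using c_eq by simp
    moreover have "st x = x"
      using KK y K by (simp add: g_def st_scaleC st_add st_mul)
    moreover have "mul K (mul y y) = mul (mul y y) K"
      using y K by (metis mul_assoc)
    then have "mul K x = mul x K"
      using KK K y by (simp add: g_def mul_scaleC_left mul_scaleC_right mul_add_left mul_add_right
          mul_assoc)
    moreover have "x \<in> S" using KK y by (simp add: g_def scaleC_closed)
    ultimately show "x \<in> Y" by (simp add: Y_def)
  qed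
  moreover have "\<forall>x\<in>Y. \<forall>y\<in>Y. dist (g x) (g y) \<le> c * dist x y"
  proof (intro ballI)
    fix x y assume "x \<in> Y" "y \<in> Y"
    then have xy: "x \<in> S" "y \<in> S" "norm x \<le> c" "norm y \<le> c" by (auto simp: Y_def)
    have "g x - g y = (1/2) *\<^sub>C (mul x x - mul y y)"
      by (simp add: g_def scaleC_add_right scaleC_diff_right)
    also have "mul x x - mul y y = mul x (x - y) + mul (x - y) y"
      using xy by (simp add: mul_diff_left mul_diff_right)
    finally have "norm (g x - g y) \<le> (norm x * norm (x - y) + norm (x - y) * norm y) / 2"
      using norm_triangle_ineq[of "mul x (x - y)" "mul (x - y) y"]
        norm_mul[OF xy(1) diff_closed[OF xy(1,2)]] norm_mul[OF diff_closed[OF xy(1,2)] xy(2)]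
      by (simp add: norm_scaleC)
    also have "\<dots> \<le> (c * norm (x - y) + norm (x - y) * c) / 2"
      using xy c by (intro divide_right_mono add_mono mult_mono) auto
    finally show "dist (g x) (g y) \<le> c * dist x y" by (simp add: dist_norm mult.commute)
  qed
  ultimately have "\<exists>!y. y \<in> Y \<and> g y = y" using c by (intro Banach_fix) auto
  then obtain y where y: "y \<in> S" "st y = y" "mul K y = mul y K" "g y = y" by (auto simp: Y_def)
  have "y + y = 2 *\<^sub>C g y" by (simp add: y(4)) (metis one_add_one scaleC_add_left scaleC_one)
  then have "y + y = mul K K + mul y y" by (simp add: g_def scaleC_scaleC)
  then show ?thesis
    using y K by (intro bexI[of _ "- y"])
      (auto simp: minus_closed st_minus mul_minus_left mul_minus_right algebra_simps)
qed

lemma selfadjoint_decomposition: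
  assumes x: "x \<in> S"
  obtains u v where "u \<in> S" "v \<in> S" "st u = u" "st v = v" "x = u + \<i> *\<^sub>C v"
    "norm u \<le> (norm x + norm (st x)) / 2" "norm v \<le> (norm x + norm (st x)) / 2"
proof
  define u v where "u = (1/2) *\<^sub>C (x + st x)" and "v = (- (\<i>/2)) *\<^sub>C (x - st x)"
  show "u \<in> S" "v \<in> S" unfolding u_def v_def
    by (intro scaleC_closed add_closed diff_closed st_closed x)+
  have "u + \<i> *\<^sub>C v = (1/2) *\<^sub>C (x + st x) + (1/2) *\<^sub>C (x - st x)"
    by (simp add: u_def v_def)
  also have "\<dots> = (1/2) *\<^sub>C x + (1/2) *\<^sub>C x"
    by (simp add: scaleC_add_right scaleC_diff_right)
  also have "\<dots> = x" using scaleC_add_left[of "1/2" "1/2" x] by simp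
  finally show "x = u + \<i> *\<^sub>C v" ..
  show "st u = u" using x
    by (simp add: u_def st_scaleC st_add st_closed add_closed st_st add.commute)
  have "st v = (\<i>/2) *\<^sub>C (st x - x)" using x
    unfolding v_def by (subst st_scaleC) (auto simp: st_diff st_closed diff_closed st_st)
  then show "st v = v" by (simp add: v_def scaleC_diff_right)
  show "norm u \<le> (norm x + norm (st x)) / 2"
    using norm_triangle_ineq[of x "st x"] by (simp add: u_def norm_scaleC norm_divide)
  show "norm v \<le> (norm x + norm (st x)) / 2"
    using norm_triangle_ineq4[of x "st x"] by (simp add: v_def norm_scaleC norm_divide)
qed

text \<open>A self-adjoint element of norm below 1 is sent to some \<open>k\<close> with a commuting
  self-adjoint \<open>s\<close> such that \<open>(1 + s)\<^sup>2 + k\<^sup>2 = 1\<close>. The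
  hypothesis \<open>unit\<close> bounds such elements of the target; it is checked separately for
  abstract algebras and for operators. Scaling makes \<open>h\<close> contractive on self-adjoint
  elements, and real and imaginary parts give the general case.\<close>

lemma star_hom_bounded:
  assumes h: "star_hom_on S mul st mul' st' h" "h ` S \<subseteq> S'"
    and unit: "\<And>k s. k \<in> S' \<Longrightarrow> s \<in> S' \<Longrightarrow> st' k = k \<Longrightarrow> st' s = s \<Longrightarrow> mul' k s = mul' s k \<Longrightarrow>
      s + s + mul' s s + mul' k k = 0 \<Longrightarrow> norm k \<le> 1"
  shows "\<exists>C. \<forall>x\<in>S. norm (h x :: 'y::complex_banach) \<le> C * norm x"
proof -
  have hadd: "h (x + y) = h x + h y" and hmul: "h (mul x y) = mul' (h x) (h y)"
    and hsc: "h (c *\<^sub>C x) = c *\<^sub>C h x" and hst: "h (st x) = st' (h x)"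
    if "x \<in> S" "y \<in> S" for x y c
    using h(1) that by (auto simp: star_hom_on_def)
  have h0: "h 0 = 0" using hsc[OF zero_closed zero_closed, of 0] by simp
  have small: "norm (h K) \<le> 1" if K: "K \<in> S" "st K = K" "norm K < 1" for K
  proof -
    obtain s where s: "s \<in> S" "st s = s" "mul K s = mul s K" "s + s + mul s s + mul K K = 0"
      using quasi_sqrt_exists[OF K] by blast
    have "h (s + s + mul s s + mul K K) = h s + h s + mul' (h s) (h s) + mul' (h K) (h K)"
      using s(1) K(1) by (simp add: hadd hmul add_closed mul_closed)
    then have "h s + h s + mul' (h s) (h s) + mul' (h K) (h K) = 0" using s h0 by simp
    then show ?thesis
      using s K h(2) hmul[of K s] hmul[of s K] hst[of K K] hst[of s s]
      by (intro unit[of "h K" "h s"]) auto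
  qed
  have sa: "norm (h K) \<le> norm K" if K: "K \<in> S" "st K = K" for K
  proof (rule field_le_epsilon)
    fix e :: real assume e: "e > 0"
    define r where "r = norm K + e"
    have r: "r > 0" "norm K < r" using e norm_ge_zero[of K] by (simp_all add: r_def add_nonneg_pos)
    have "norm (h (complex_of_real (1/r) *\<^sub>C K)) \<le> 1"
      by (rule small)
        (use K r e in \<open>auto simp: scaleC_closed st_scaleC norm_scaleC norm_divide\<close>)
    then have "norm (h K) / r \<le> 1" using K r by (simp add: hsc norm_scaleC norm_divide)
    then show "norm (h K) \<le> norm K + e" using r by (simp add: r_def field_simps)
  qed
  obtain C where C: "\<And>x. x \<in> S \<Longrightarrow> norm (st x) \<le> C * norm x" using st_bounded by blast
  show ?thesis
  proof (intro exI ballI)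
    fix x assume x: "x \<in> S"
    obtain u v where uv: "u \<in> S" "v \<in> S" "st u = u" "st v = v" "x = u + \<i> *\<^sub>C v"
      "norm u \<le> (norm x + norm (st x)) / 2" "norm v \<le> (norm x + norm (st x)) / 2"
      using selfadjoint_decomposition[OF x] .
    have "norm (h x) \<le> norm (h u) + norm (h v)"
      using norm_triangle_ineq[of "h u" "\<i> *\<^sub>C h v"] uv
      by (simp add: hadd hsc scaleC_closed norm_scaleC)
    also have "\<dots> \<le> norm u + norm v" using sa uv by (intro add_mono) auto
    also have "\<dots> \<le> norm x + norm (st x)" using uv by simp
    also have "\<dots> \<le> (1 + C) * norm x" using C[OF x] by (simp add: algebra_simps)
    finally show "norm (h x) \<le> (1 + C) * norm x" .
  qed
qed

section \<open>Closed subspaces cut out by bounded homomorphisms\<close>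

lemma star_hom_tendsto:
  assumes h: "star_hom_on S mul st mul' st' h"
    and bound: "\<exists>C. \<forall>x\<in>S. norm (h x :: 'y::complex_banach) \<le> C * norm x"
    and f: "\<And>n. f n \<in> S" "f \<longlonglongrightarrow> x"
  shows "(\<lambda>n. h (f n)) \<longlonglongrightarrow> h x"
proof -
  have x: "x \<in> S" using closed f closed_sequentially by blast
  obtain C where C: "\<And>x. x \<in> S \<Longrightarrow> norm (h x) \<le> C * norm x" using bound by blast
  have "h (f n - x) = h (f n) - h x" for n
  proof -
    have "h (f n + (-1) *\<^sub>C x) = h (f n) + h ((-1) *\<^sub>C x)" "h ((-1) *\<^sub>C x) = (-1) *\<^sub>C h x"
      using h f(1)[of n] x scaleC_closed[OF x, of "-1"] unfolding star_hom_on_def by blast+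
    then show ?thesis by simp
  qed
  then have "norm (h (f n) - h x) \<le> C * norm (f n - x)" for n
    using C[OF diff_closed[OF f(1) x]] by simp
  moreover have "(\<lambda>n. C * norm (f n - x)) \<longlonglongrightarrow> 0"
    using f(2) by (auto intro!: tendsto_eq_intros simp: LIM_zero)
  ultimately have "(\<lambda>n. h (f n) - h x) \<longlonglongrightarrow> 0"
    by (intro Lim_null_comparison[of "\<lambda>n. h (f n) - h x"]) auto
  then show ?thesis by (rule LIM_zero_cancel)
qed

lemma closed_star_hom_vimage:
  assumes "star_hom_on S mul st mul' st' h"
    and "\<exists>C. \<forall>x\<in>S. norm (h x :: 'y::complex_banach) \<le> C * norm x"
    and "closed V"
  shows "closed {x\<in>S. h x \<in> V}"
  unfolding closed_sequential_limits
proof (intro allI impI, elim conjE)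
  fix f l assume f: "\<forall>n. f n \<in> {x \<in> S. h x \<in> V}" "f \<longlonglongrightarrow> l"
  then have "(\<lambda>n. h (f n)) \<longlonglongrightarrow> h l" by (intro star_hom_tendsto[OF assms(1,2)]) auto
  then have "h l \<in> V" using closed_sequentially[OF assms(3), of "\<lambda>n. h (f n)"] f by simp
  moreover have "l \<in> S" using closed_sequentially[OF closed, of f l] f by simp
  ultimately show "l \<in> {x\<in>S. h x \<in> V}" by simp
qed

lemma csubspace_star_hom_vimage:
  assumes h: "star_hom_on S mul st mul' st' h" and V: "csubspace V"
  shows "csubspace {x\<in>S. h x \<in> (V :: 'y::complex_banach set)}"
proof (rule complex_vector.subspaceI)
  have "h (0 *\<^sub>C 0) = 0 *\<^sub>C h 0" using h zero_closed unfolding star_hom_on_def by blast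
  then show "0 \<in> {x\<in>S. h x \<in> V}"
    using zero_closed complex_vector.subspace_0[OF V] by simp
qed (use h complex_vector.subspace_add[OF V] complex_vector.subspace_scale[OF V] in
    \<open>auto simp: star_hom_on_def add_closed scaleC_closed\<close>)

lemma closed_star_hom_equalizer:
  assumes "star_hom_on S mul st mul' st' h"
    and "\<exists>C. \<forall>x\<in>S. norm (h x :: 'y::complex_banach) \<le> C * norm x"
    and "star_hom_on S mul st mul'' st'' g"
    and "\<exists>C. \<forall>x\<in>S. norm (g x) \<le> C * norm x"
  shows "closed {x\<in>S. h x = g x}"
  unfolding closed_sequential_limits
proof (intro allI impI, elim conjE)
  fix f l assume f: "\<forall>n. f n \<in> {x \<in> S. h x = g x}" "f \<longlonglongrightarrow> l"
  then have "(\<lambda>n. h (f n)) \<longlonglongrightarrow> h l" "(\<lambda>n. g (f n)) \<longlonglongrightarrow> g l"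
    using star_hom_tendsto[OF assms(1,2), of f l] star_hom_tendsto[OF assms(3,4), of f l] by simp_all
  then have "h l = g l" using f by (simp add: LIMSEQ_unique)
  moreover have "l \<in> S" using closed_sequentially[OF closed, of f l] f by simp
  ultimately show "l \<in> {x\<in>S. h x = g x}" by simp
qed

lemma csubspace_star_hom_equalizer:
  assumes h: "star_hom_on S mul st mul' st' (h :: 'x \<Rightarrow> 'y::complex_banach)"
    and g: "star_hom_on S mul st mul'' st'' g"
  shows "csubspace {x\<in>S. h x = g x}"
proof (rule complex_vector.subspaceI)
  have "h (0 *\<^sub>C 0) = 0 *\<^sub>C h 0" "g (0 *\<^sub>C 0) = 0 *\<^sub>C g 0"
    using h g zero_closed unfolding star_hom_on_def by blast+
  then show "0 \<in> {x\<in>S. h x = g x}"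
    using zero_closed by simp
next
  have *: "f (x + y) = f x + f y" "f (c *\<^sub>C x) = c *\<^sub>C f x"
    if "star_hom_on S mul st m s (f :: 'x \<Rightarrow> 'y)" "x \<in> S" "y \<in> S" for f m s x y c
    using that unfolding star_hom_on_def by blast+
  show "x + y \<in> {x\<in>S. h x = g x}" if "x \<in> {x\<in>S. h x = g x}" "y \<in> {x\<in>S. h x = g x}" for x y
    using that by (simp add: add_closed *(1)[OF h] *(1)[OF g])
  show "c *\<^sub>C x \<in> {x\<in>S. h x = g x}" if "x \<in> {x\<in>S. h x = g x}" for c x
    using that by (simp add: scaleC_closed *(2)[OF h, of x x] *(2)[OF g, of x x])
qed

lemma star_algebra_on_subset:
  assumes "S' \<subseteq> S" "csubspace S'" "closed S'" "\<And>x. x \<in> S' \<Longrightarrow> st x \<in> S'"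
    "\<And>x y. x \<in> S' \<Longrightarrow> y \<in> S' \<Longrightarrow> mul x y \<in> S'"
  shows "star_algebra_on S' mul st"
proof
  show "\<exists>C. \<forall>x\<in>S'. norm (st x) \<le> C * norm x" using st_bounded assms(1) by blast
qed (use assms mul_add_left mul_add_right mul_scaleC_left mul_scaleC_right mul_assoc norm_mul
  st_add st_scaleC st_mul st_st in \<open>auto simp: subset_iff\<close>)

end


section \<open>Linear maps given on generators\<close>

text \<open>The span of the pairs of \<open>g i\<close> and \<open>t i\<close>, as a relation:
  before a bound is known, a linear combination of the \<open>g i\<close> need not determine that of
  the \<open>t i\<close>. The bounds themselves are obtained by induction over the
  combinations.\<close>

inductive lin_graph ::
  "'i set \<Rightarrow> ('i \<Rightarrow> 'x::complex_vector) \<Rightarrow> ('i \<Rightarrow> 'y::complex_vector) \<Rightarrow> 'x \<Rightarrow> 'y \<Rightarrow> bool"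
  for I g t where
  zero: "lin_graph I g t 0 0"
| step: "lin_graph I g t x y \<Longrightarrow> i \<in> I \<Longrightarrow> lin_graph I g t (c *\<^sub>C g i + x) (c *\<^sub>C t i + y)"

lemma lin_graph_add:
  "lin_graph I g t x y \<Longrightarrow> lin_graph I g t x' y' \<Longrightarrow> lin_graph I g t (x + x') (y + y')"
  by (induction rule: lin_graph.induct) (auto simp: add.assoc intro: lin_graph.step)

lemma lin_graph_scaleC: "lin_graph I g t x y \<Longrightarrow> lin_graph I g t (c *\<^sub>C x) (c *\<^sub>C y)"
proof (induction rule: lin_graph.induct)
  case zero
  then show ?case using lin_graph.zero by (simp add: complex_vector.scale_zero_right)
next
  case (step x y i d)
  then show ?case
    using lin_graph.step[OF step.IH step.hyps(2), of "c * d"]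
    by (simp add: scaleC_add_right scaleC_scaleC)
qed

lemma lin_graph_gen: "i \<in> I \<Longrightarrow> lin_graph I g t (g i) (t i)"
  using lin_graph.step[OF lin_graph.zero, of i I g t 1] by (simp add: scaleC_one)

lemma lin_graph_total: "x \<in> cspan (g ` I) \<Longrightarrow> \<exists>y. lin_graph I g t x y"
proof (induction rule: complex_vector.span_induct_alt)
  case base
  show ?case using lin_graph.zero by blast
next
  case (step c x y)
  then show ?case using lin_graph.step[where t=t] by blast
qed

text \<open>The bound makes the closure of the graph single valued; density and completeness of the
  target make it total. Complex homogeneity is part of the conclusion because the operator type only
  records real linearity.\<close>

lemma bounded_extension:
  fixes g :: "'i \<Rightarrow> 'x::complex_banach" and t :: "'i \<Rightarrow> 'y::complex_banach"
  assumes bound: "\<And>x y. lin_graph I g t x y \<Longrightarrow> norm y \<le> C * norm x"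
    and dense: "closure (cspan (g ` I)) = UNIV"
  shows "\<exists>T :: 'x \<Rightarrow>\<^sub>L 'y. (\<forall>c x. T (c *\<^sub>C x) = c *\<^sub>C T x) \<and> (\<forall>i\<in>I. T (g i) = t i)"
proof -
  define \<Gamma> where "\<Gamma> x y \<longleftrightarrow> (\<exists>X Y. (\<forall>n. lin_graph I g t (X n) (Y n)) \<and> X \<longlonglongrightarrow> x \<and> Y \<longlonglongrightarrow> y)" for x y
  have \<Gamma>_add: "\<Gamma> (x + x') (y + y')" if "\<Gamma> x y" "\<Gamma> x' y'" for x x' y y'
  proof -
    from that obtain X Y X' Y' where "\<forall>n. lin_graph I g t (X n) (Y n)" "X \<longlonglongrightarrow> x" "Y \<longlonglongrightarrow> y"
      "\<forall>n. lin_graph I g t (X' n) (Y' n)" "X' \<longlonglongrightarrow> x'" "Y' \<longlonglongrightarrow> y'"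
      unfolding \<Gamma>_def by blast
    then show ?thesis unfolding \<Gamma>_def
      by (intro exI[of _ "\<lambda>n. X n + X' n"] exI[of _ "\<lambda>n. Y n + Y' n"])
        (auto intro: tendsto_add lin_graph_add)
  qed
  have \<Gamma>_scale: "\<Gamma> (c *\<^sub>C x) (c *\<^sub>C y)" if "\<Gamma> x y" for x y c
  proof -
    from that obtain X Y where "\<forall>n. lin_graph I g t (X n) (Y n)" "X \<longlonglongrightarrow> x" "Y \<longlonglongrightarrow> y"
      unfolding \<Gamma>_def by blast
    then show ?thesis unfolding \<Gamma>_def
      by (intro exI[of _ "\<lambda>n. c *\<^sub>C X n"] exI[of _ "\<lambda>n. c *\<^sub>C Y n"])
        (auto intro: tendsto_scaleC lin_graph_scaleC)
  qed
  have \<Gamma>_bound: "norm y \<le> C * norm x" if "\<Gamma> x y" for x y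
  proof -
    from that obtain X Y where XY: "\<forall>n. lin_graph I g t (X n) (Y n)" "X \<longlonglongrightarrow> x" "Y \<longlonglongrightarrow> y"
      unfolding \<Gamma>_def by blast
    show ?thesis
    proof (rule LIMSEQ_le[OF tendsto_norm[OF XY(3)]])
      show "(\<lambda>n. C * norm (X n)) \<longlonglongrightarrow> C * norm x"
        using XY(2) by (intro tendsto_intros)
      show "\<exists>N. \<forall>n\<ge>N. norm (Y n) \<le> C * norm (X n)" using bound XY(1) by blast
    qed
  qed
  have \<Gamma>_diff: "\<Gamma> (x - x') (y - y')" if "\<Gamma> x y" "\<Gamma> x' y'" for x x' y y'
    using \<Gamma>_add[OF that(1) \<Gamma>_scale[OF that(2), of "-1"]] by simp
  have \<Gamma>_unique: "y = y'" if "\<Gamma> x y" "\<Gamma> x y'" for x y y'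
    using \<Gamma>_bound[OF \<Gamma>_diff[OF that]] by simp
  have \<Gamma>_total: "\<exists>y. \<Gamma> x y" for x
  proof -
    have "x \<in> closure (cspan (g ` I))" using dense by simp
    then obtain X where X: "\<And>n. X n \<in> cspan (g ` I)" "X \<longlonglongrightarrow> x"
      unfolding closure_sequential by blast
    have "\<forall>n. \<exists>y. lin_graph I g t (X n) y" using lin_graph_total X(1) by blast
    then obtain Y where Y: "\<And>n. lin_graph I g t (X n) (Y n)" by metis
    \<comment> \<open>\<open>C\<close> may be zero or negative, hence the absolute value here and
      the divisor \<open>\<bar>C\<bar> + 1\<close> below.\<close>
    have YC: "dist (Y m) (Y n) \<le> \<bar>C\<bar> * dist (X m) (X n)" for m n
    proof -
      have "norm (Y m - Y n) \<le> C * norm (X m - X n)"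
        using bound[OF lin_graph_add[OF Y[of m] lin_graph_scaleC[OF Y[of n], of "-1"]]] by simp
      also have "\<dots> \<le> \<bar>C\<bar> * norm (X m - X n)" by (intro mult_right_mono) auto
      finally show ?thesis by (simp add: dist_norm)
    qed
    have "Cauchy Y"
    proof (rule metric_CauchyI)
      fix e :: real assume "e > 0"
      then have "e / (\<bar>C\<bar> + 1) > 0" by simp
      then obtain M where M: "\<forall>m\<ge>M. \<forall>n\<ge>M. dist (X m) (X n) < e / (\<bar>C\<bar> + 1)"
        using LIMSEQ_imp_Cauchy[OF X(2)] unfolding Cauchy_def by blast
      have "dist (Y m) (Y n) < e" if "m \<ge> M" "n \<ge> M" for m n
      proof -
        have "\<bar>C\<bar> * dist (X m) (X n) \<le> (\<bar>C\<bar> + 1) * dist (X m) (X n)"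
          by (intro mult_right_mono) auto
        also have "\<dots> < (\<bar>C\<bar> + 1) * (e / (\<bar>C\<bar> + 1))"
          using M that by (intro mult_strict_left_mono) auto
        also have "\<dots> = e" by (simp add: add_nonneg_eq_0_iff)
        finally show ?thesis using YC[of m n] by simp
      qed
      then show "\<exists>M. \<forall>m\<ge>M. \<forall>n\<ge>M. dist (Y m) (Y n) < e" by blast
    qed
    then obtain y where "Y \<longlonglongrightarrow> y" by (metis Cauchy_convergent_iff convergent_def)
    then show ?thesis unfolding \<Gamma>_def using X(2) Y by blast
  qed
  define T where "T x = (THE y. \<Gamma> x y)" for x
  have \<Gamma>T: "\<Gamma> x (T x)" for x
    unfolding T_def using \<Gamma>_total \<Gamma>_unique by (metis (mono_tags, lifting) theI)
  have TI: "T x = y" if "\<Gamma> x y" for x y using \<Gamma>T \<Gamma>_unique that by blast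
  have Tsc: "T (c *\<^sub>C x) = c *\<^sub>C T x" for c x by (intro TI \<Gamma>_scale \<Gamma>T)
  have "bounded_linear T"
  proof (rule bounded_linear_intro[where K = C])
    show "T (x + y) = T x + T y" for x y by (intro TI \<Gamma>_add \<Gamma>T)
    show "T (r *\<^sub>R x) = r *\<^sub>R T x" for r x by (simp add: scaleR_scaleC Tsc)
    show "norm (T x) \<le> norm x * C" for x using \<Gamma>_bound[OF \<Gamma>T] by (simp add: mult.commute)
  qed
  moreover have "T (g i) = t i" if "i \<in> I" for i
    by (rule TI) (auto simp: \<Gamma>_def intro!: exI[of _ "\<lambda>_. g i"] exI[of _ "\<lambda>_. t i"] lin_graph_gen that)
  ultimately show ?thesis using Tsc
    by (intro exI[of _ "Blinfun T"]) (auto simp: bounded_linear_Blinfun_apply)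
qed


section \<open>Unital \<open>C\<^sup>*\<close>-algebras\<close>

lemma star_zero [simp]: "star (0 :: 'a::unital_cstar_algebra) = 0"
  using star_scaleC[of 0 "0::'a"] by simp

lemma star_minus [simp]: "star (- x) = - star (x :: 'a::unital_cstar_algebra)"
  using star_scaleC[of "-1" x] by simp

lemma star_one [simp]: "star (1 :: 'a::unital_cstar_algebra) = 1"
  by (metis mult.right_neutral mult.left_neutral star_mult star_star)

lemma norm_star [simp]: "norm (star x) = norm (x :: 'a::unital_cstar_algebra)"
proof -
  have le: "norm y \<le> norm (star y)" for y :: 'a
    using norm_mult_ineq[of "star y" y] cstar_identity[of y]
    by (cases "norm y = 0") (auto simp: power2_eq_square mult_right_le_imp_le)
  show ?thesis using le[of x] le[of "star x"] by (simp add: star_star)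
qed

lemma norm_one_le: "norm (1 :: 'a::unital_cstar_algebra) \<le> 1"
  using cstar_identity[of "1::'a"] by (cases "norm (1::'a) = 0") (auto simp: power2_eq_square)

lemma star_algebra_on_UNIV:
  "star_algebra_on UNIV ((*) :: 'a::unital_cstar_algebra \<Rightarrow> _) star"
  by standard (auto simp: distrib_left distrib_right scaleC_mult_left scaleC_mult_right mult.assoc
      norm_mult_ineq star_add star_scaleC star_mult star_star intro!: exI[of _ 1])

text \<open>\<open>k\<close> is the real part of \<open>k + \<i> *\<^sub>C (1 + s)\<close>, and the
  relation between \<open>k\<close> and \<open>s\<close> says that this element \<open>u\<close>
  satisfies \<open>star u * u = 1\<close>, so the C*-identity bounds it.\<close>

lemma quasi_unitary_bound:
  fixes k s :: "'a::unital_cstar_algebra"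
  assumes "star k = k" "star s = s" "k * s = s * k" "s + s + s * s + k * k = 0"
  shows "norm k \<le> 1"
proof -
  define u where "u = k + \<i> *\<^sub>C (1 + s)"
  have su: "star u = k - \<i> *\<^sub>C (1 + s)"
    using assms by (simp add: u_def star_add star_scaleC)
  have "star u * u = (k - \<i> *\<^sub>C (1 + s)) * (k + \<i> *\<^sub>C (1 + s))"
    by (simp only: su) (simp only: u_def)
  also have "\<dots> = k * k + (1 + s) * (1 + s)"
    using assms(3) by (simp add: algebra_simps scaleC_mult_left scaleC_mult_right scaleC_add_right scaleC_scaleC)
  also have "\<dots> = 1 + (s + s + s * s + k * k)" by (simp add: algebra_simps)
  finally have "norm u \<le> 1"
    using cstar_identity[of u] norm_one_le[where 'a='a] assms(4) by (simp add: power_le_one_iff)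
  have "2 *\<^sub>C k = u + star u"
    using scaleC_add_left[of 1 1 k] by (simp add: su) (simp add: u_def)
  then have "2 * norm k \<le> norm u + norm (star u)"
    by (metis norm_triangle_ineq norm_scaleC norm_numeral)
  then show ?thesis using \<open>norm u \<le> 1\<close> by simp
qed

lemma star_hom_cstar_bounded:
  fixes h :: "'x::complex_banach \<Rightarrow> 'b::unital_cstar_algebra"
  assumes "star_algebra_on S mul st" "star_hom_on S mul st (*) star h"
  shows "\<exists>C. \<forall>x\<in>S. norm (h x) \<le> C * norm x"
  using star_algebra_on.star_hom_bounded[OF assms(1,2), of UNIV] quasi_unitary_bound by auto


section \<open>Hilbert modules and adjointable operators\<close>

context hilbert_module
begin

lemma ip_add_left: "ip (x + y) z = ip x z + ip y z"
  by (metis ip_add_right ip_star star_add)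

lemma ip_scaleC_left: "ip (c *\<^sub>C x) y = cnj c *\<^sub>C ip x y"
  by (metis ip_scaleC_right ip_star star_scaleC)

lemma ip_zero [simp]: "ip 0 x = 0" "ip x 0 = 0"
  using ip_scaleC_left[of 0 0 x] ip_scaleC_right[of x 0 0] by simp_all

lemma ip_minus_left [simp]: "ip (- x) y = - ip x y"
  using ip_scaleC_left[of "-1" x y] by simp

lemma ip_minus_right [simp]: "ip x (- y) = - ip x y"
  using ip_scaleC_right[of x "-1" y] by simp

lemma ip_diff_left: "ip (x - y) z = ip x z - ip y z"
  using ip_add_left[of x "-y" z] by simp

lemma ip_diff_right: "ip z (x - y) = ip z x - ip z y"
  using ip_add_right[of z x "-y"] by simp

lemma ip_act_left: "ip (act x a) y = star a * ip x y"
  by (metis ip_act_right ip_star star_mult)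

lemma norm_ip_self: "norm (ip x x) = (norm x)\<^sup>2"
  by (simp add: norm_eq_ip)

lemma ip_self_eq_0: "ip x x = 0 \<Longrightarrow> x = 0"
  using norm_ip_self[of x] by simp

lemma ip_eqI: "(\<And>z. ip z x = ip z y) \<Longrightarrow> x = y"
  using ip_self_eq_0[of "x - y"] by (simp add: ip_diff_right)

text \<open>The constant 4 is not optimal, but it only takes polarization to obtain it.\<close>

lemma norm_ip: "norm (ip x y) \<le> 4 * norm x * norm y"
proof -
  have two: "2 *\<^sub>C z = z + z" for z :: 'a using scaleC_add_left[of 1 1 z] by simp
  have pol: "4 *\<^sub>C ip x y = (ip (x + y) (x + y) - ip (x - y) (x - y)) +
      \<i> *\<^sub>C (ip (x + w) (x + w) - ip (x - w) (x - w))" if w: "w = - (\<i> *\<^sub>C y)" for x y w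
  proof -
    have diff: "ip (x + z) (x + z) - ip (x - z) (x - z) = 2 *\<^sub>C ip x z + 2 *\<^sub>C ip z x" for z
      by (simp add: ip_add_left ip_add_right ip_diff_left ip_diff_right two)
    have "ip x w = - (\<i> *\<^sub>C ip x y)" "ip w x = \<i> *\<^sub>C ip y x"
      by (simp_all add: w ip_scaleC_left ip_scaleC_right)
    then have "\<i> *\<^sub>C (2 *\<^sub>C ip x w + 2 *\<^sub>C ip w x) = 2 *\<^sub>C ip x y - 2 *\<^sub>C ip y x"
      by (simp add: scaleC_add_right scaleC_diff_right mult.left_commute[of \<i> 2])
    then show ?thesis unfolding diff using scaleC_add_left[of 2 2 "ip x y"] by simp
  qed
  have le: "norm (ip x y) \<le> (norm x + norm y)\<^sup>2" for x y
  proof -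
    have b: "norm (ip z z) \<le> (norm x + norm y)\<^sup>2" if "norm z \<le> norm x + norm y" for z
      using that by (simp add: norm_ip_self power_mono)
    define w where "w = - (\<i> *\<^sub>C y)"
    have n: "norm w = norm y" by (simp add: w_def norm_scaleC)
    have b': "norm (ip (x + y) (x + y)) \<le> (norm x + norm y)\<^sup>2"
      "norm (ip (x - y) (x - y)) \<le> (norm x + norm y)\<^sup>2"
      "norm (ip (x + w) (x + w)) \<le> (norm x + norm y)\<^sup>2"
      "norm (ip (x - w) (x - w)) \<le> (norm x + norm y)\<^sup>2"
      using norm_triangle_ineq[of x y] norm_triangle_ineq4[of x y] norm_triangle_ineq[of x w]
        norm_triangle_ineq4[of x w] n by (simp_all add: b)
    have "4 * norm (ip x y) = norm (4 *\<^sub>C ip x y)" by (simp add: norm_scaleC)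
    also have "\<dots> \<le> norm (ip (x + y) (x + y) - ip (x - y) (x - y)) +
        norm (ip (x + w) (x + w) - ip (x - w) (x - w))"
      unfolding pol[OF w_def] by (rule norm_triangle_le) (simp add: norm_scaleC)
    also have "\<dots> \<le> ((norm x + norm y)\<^sup>2 + (norm x + norm y)\<^sup>2) + ((norm x + norm y)\<^sup>2 + (norm x + norm y)\<^sup>2)"
      by (intro add_mono norm_triangle_le_diff b')
    finally show ?thesis by simp
  qed
  show ?thesis
  proof (cases "x = 0 \<or> y = 0")
    case False
    \<comment> \<open>For unit vectors the bound \<open>(norm x + norm y)\<^sup>2\<close> equals 4,
      which is the constant of the lemma.\<close>
    define x' y' where "x' = complex_of_real (1 / norm x) *\<^sub>C x"
      and "y' = complex_of_real (1 / norm y) *\<^sub>C y"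
    have "norm x' = 1" "norm y' = 1" using False
      by (simp_all add: x'_def y'_def norm_scaleC norm_divide)
    then have "norm (ip x' y') \<le> 4" using le[of x' y'] by simp
    then show ?thesis using False
      by (simp add: x'_def y'_def ip_scaleC_left ip_scaleC_right norm_scaleC norm_divide norm_mult
          divide_simps mult_ac)
  qed auto
qed

text \<open>Positivity of \<open>ip x x\<close> enters here: with \<open>ip x x = star b * b\<close>
  the squared norm of \<open>act x a\<close> is that of \<open>b * a\<close>.\<close>

lemma norm_act: "norm (act x a) \<le> norm x * norm a"
proof -
  obtain b where b: "ip x x = star b * b" using ip_positive by blast
  have "(norm (act x a))\<^sup>2 = norm (star (b * a) * (b * a))"
    by (simp add: ip_act_left ip_act_right b star_mult mult.assoc flip: norm_ip_self)
  also have "\<dots> \<le> (norm b * norm a)\<^sup>2"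
    by (simp add: cstar_identity norm_mult_ineq power_mono)
  also have "norm b = norm x"
    using cstar_identity[of b] norm_ip_self[of x] b by (metis norm_ge_zero power2_eq_imp_eq)
  finally show ?thesis by (rule power2_le_imp_le) simp
qed

lemma bounded_bilinear_ip: "bounded_bilinear ip"
proof
  show "\<exists>K. \<forall>a b. norm (ip a b) \<le> norm a * norm b * K"
    using norm_ip by (intro exI[of _ 4]) (simp add: mult_ac)
qed (simp_all add: ip_add_left ip_add_right scaleR_scaleC ip_scaleC_left ip_scaleC_right)

lemma bounded_bilinear_act: "bounded_bilinear act"
proof
  show "\<exists>K. \<forall>a b. norm (act a b) \<le> norm a * norm b * K"
    using norm_act by (intro exI[of _ 1]) simp
qed (simp_all add: act_add_left act_add_right scaleR_scaleC act_scaleC_left act_scaleC_right)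

lemmas tendsto_ip = bounded_bilinear.tendsto[OF bounded_bilinear_ip]
lemmas continuous_on_ip = bounded_bilinear.continuous_on[OF bounded_bilinear_ip]

section \<open>The algebra of adjointable operators\<close>

lemma adjointI: "(\<And>x y. ip (blinfun_apply S x) y = ip x (blinfun_apply T y)) \<Longrightarrow> adjointable ip T"
  unfolding adjointable_def by blast

lemma adj_eqI:
  assumes "\<And>x y. ip (blinfun_apply S x) y = ip x (blinfun_apply T y)"
  shows "adj ip T = S"
  unfolding adj_def
proof (rule the_equality)
  fix S' :: "'e \<Rightarrow>\<^sub>L 'e" assume S': "\<forall>x y. ip (S' x) y = ip x (T y)"
  show "S' = S"
  proof (rule blinfun_eqI, rule ip_eqI)
    fix x z show "ip z (S' x) = ip z (S x)"
      using S' assms by (metis ip_star)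
  qed
qed (use assms in blast)

lemma ip_adj_left: "adjointable ip T \<Longrightarrow> ip (adj ip T x) y = ip x (T y)"
  unfolding adjointable_def using adj_eqI by metis

lemma ip_adj_right: "adjointable ip T \<Longrightarrow> ip x (adj ip T y) = ip (T x) y"
  using ip_adj_left by (metis ip_star)

lemma adjointable_adj [simp]: "adjointable ip T \<Longrightarrow> adjointable ip (adj ip T)"
  by (rule adjointI[of T]) (simp add: ip_adj_right)

lemma adj_adj: "adjointable ip T \<Longrightarrow> adj ip (adj ip T) = T"
  by (rule adj_eqI) (simp add: ip_adj_right)

text \<open>Complex linearity is not built into the operator type. It follows, like
  \<open>A\<close>-linearity in the next lemma, by moving the operator to the other side of the
  inner product.\<close>

lemma adjointable_scaleC_apply: "adjointable ip T \<Longrightarrow> T (c *\<^sub>C x) = c *\<^sub>C T x"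
  by (rule ip_eqI) (simp add: ip_scaleC_right flip: ip_adj_left)

lemma adjointable_act_apply: "adjointable ip T \<Longrightarrow> T (act x a) = act (T x) a"
  by (rule ip_eqI) (simp add: ip_act_right flip: ip_adj_left)

lemma csubspace_adjointable: "csubspace (Collect (adjointable ip))"
proof (rule complex_vector.subspaceI)
  show "0 \<in> Collect (adjointable ip)" by (auto intro: adjointI[of 0])
  show "S + T \<in> Collect (adjointable ip)"
    if "S \<in> Collect (adjointable ip)" "T \<in> Collect (adjointable ip)" for S T
    using that by (auto simp: blinfun.add_left ip_add_left ip_add_right ip_adj_left
      intro!: adjointI[of "adj ip S + adj ip T"])
  show "c *\<^sub>C T \<in> Collect (adjointable ip)" if "T \<in> Collect (adjointable ip)" for c T
    using that by (auto simp: scaleC_blinfun.rep_eq ip_scaleC_left ip_scaleC_right ip_adj_left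
      intro!: adjointI[of "cnj c *\<^sub>C adj ip T"])
qed

lemma adj_add: "adjointable ip S \<Longrightarrow> adjointable ip T \<Longrightarrow> adj ip (S + T) = adj ip S + adj ip T"
  by (rule adj_eqI) (simp add: blinfun.add_left ip_add_left ip_add_right ip_adj_left)

lemma adj_scaleC: "adjointable ip T \<Longrightarrow> adj ip (c *\<^sub>C T) = cnj c *\<^sub>C adj ip T"
  by (rule adj_eqI) (simp add: scaleC_blinfun.rep_eq ip_scaleC_left ip_scaleC_right ip_adj_left)

lemma adjointable_comp [simp]:
  "adjointable ip S \<Longrightarrow> adjointable ip T \<Longrightarrow> adjointable ip (S o\<^sub>L T)"
  by (rule adjointI[of "adj ip T o\<^sub>L adj ip S"]) (simp add: ip_adj_left)

lemma adj_comp: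
  "adjointable ip S \<Longrightarrow> adjointable ip T \<Longrightarrow> adj ip (S o\<^sub>L T) = adj ip T o\<^sub>L adj ip S"
  by (rule adj_eqI) (simp add: ip_adj_left)

lemma adjointable_id [simp]: "adjointable ip id_blinfun"
  by (rule adjointI[of id_blinfun]) simp

lemma adj_id [simp]: "adj ip id_blinfun = id_blinfun"
  by (rule adj_eqI) simp

text \<open>Pair \<open>adj ip T x\<close> with itself and cancel one factor; the 4 is that of
  \<open>norm_ip\<close>.\<close>

lemma norm_adj:
  assumes "adjointable ip T"
  shows "norm (adj ip T) \<le> 4 * norm T"
proof (rule norm_blinfun_bound)
  fix x
  let ?y = "adj ip T x"
  have "(norm ?y)\<^sup>2 = norm (ip (T ?y) x)"
    by (simp only: norm_ip_self [symmetric] ip_adj_right[OF assms])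
  also have "\<dots> \<le> 4 * norm (T ?y) * norm x" by (rule norm_ip)
  also have "\<dots> \<le> 4 * (norm T * norm ?y) * norm x"
    by (intro mult_right_mono mult_left_mono norm_blinfun) auto
  finally have "norm ?y * norm ?y \<le> (4 * norm T * norm x) * norm ?y"
    by (simp add: power2_eq_square mult_ac)
  then show "norm ?y \<le> 4 * norm T * norm x"
    by (cases "?y = 0") (simp_all add: mult_le_cancel_right)
qed simp

text \<open>By the bound on adjoints, the adjoints of a convergent sequence form a Cauchy sequence,
  and their limit is an adjoint of the limit.\<close>

lemma closed_adjointable: "closed (Collect (adjointable ip))"
  unfolding closed_sequential_limits
proof (intro allI impI, elim conjE)
  fix X :: "nat \<Rightarrow> 'e \<Rightarrow>\<^sub>L 'e" and T
  assume X: "\<forall>n. X n \<in> Collect (adjointable ip)" and lim: "X \<longlonglongrightarrow> T"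
  have dist: "dist (adj ip (X m)) (adj ip (X n)) \<le> 4 * dist (X m) (X n)" for m n
  proof -
    have "adj ip (X m - X n) = adj ip (X m) - adj ip (X n)"
      using X by (intro adj_eqI) (simp add: blinfun.diff_left ip_diff_left ip_diff_right ip_adj_left)
    moreover have "adjointable ip (X m - X n)"
      using X complex_vector.subspace_diff[OF csubspace_adjointable] by blast
    ultimately show ?thesis using norm_adj[of "X m - X n"] by (simp add: dist_norm)
  qed
  have "Cauchy (\<lambda>n. adj ip (X n))"
  proof (rule metric_CauchyI)
    fix e :: real assume "e > 0"
    then obtain M where "\<forall>m\<ge>M. \<forall>n\<ge>M. dist (X m) (X n) < e / 4"
      using LIMSEQ_imp_Cauchy[OF lim] unfolding Cauchy_def by (metis divide_pos_pos zero_less_numeral)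
    then have "dist (adj ip (X m)) (adj ip (X n)) < e" if "m \<ge> M" "n \<ge> M" for m n
      using dist[of m n] that by fastforce
    then show "\<exists>M. \<forall>m\<ge>M. \<forall>n\<ge>M. dist (adj ip (X m)) (adj ip (X n)) < e" by blast
  qed
  then obtain S where S: "(\<lambda>n. adj ip (X n)) \<longlonglongrightarrow> S"
    by (metis Cauchy_convergent_iff convergent_def)
  have "ip (S x) y = ip x (T y)" for x y
  proof (rule LIMSEQ_unique)
    show "(\<lambda>n. ip (adj ip (X n) x) y) \<longlonglongrightarrow> ip (S x) y"
      by (intro tendsto_ip tendsto_const blinfun.tendsto S)
    show "(\<lambda>n. ip (adj ip (X n) x) y) \<longlonglongrightarrow> ip x (T y)"
      using X by (simp add: ip_adj_left) (intro tendsto_ip tendsto_const blinfun.tendsto lim)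
  qed
  then show "T \<in> Collect (adjointable ip)" using adjointI by blast
qed

lemma star_algebra_adjointable: "star_algebra_on (Collect (adjointable ip)) (o\<^sub>L) (adj ip)"
proof
  show "x o\<^sub>L c *\<^sub>C y = c *\<^sub>C (x o\<^sub>L y)" if "x \<in> Collect (adjointable ip)" for x y :: "'e \<Rightarrow>\<^sub>L 'e" and c
    using that by (intro blinfun_eqI) (simp add: scaleC_blinfun.rep_eq adjointable_scaleC_apply)
  show "c *\<^sub>C x o\<^sub>L y = c *\<^sub>C (x o\<^sub>L y)" for x y :: "'e \<Rightarrow>\<^sub>L 'e" and c
    by (rule blinfun_compose_scaleC_left)
  show "\<exists>C. \<forall>x\<in>Collect (adjointable ip). norm (adj ip x) \<le> C * norm x"
    using norm_adj by (intro exI[of _ 4]) auto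
qed (auto simp: csubspace_adjointable closed_adjointable adj_add adj_scaleC adj_comp adj_adj
    norm_blinfun_compose bounded_bilinear.add_left[OF bounded_bilinear_blinfun_compose]
    bounded_bilinear.add_right[OF bounded_bilinear_blinfun_compose] intro: blinfun_eqI)

section \<open>Adjointable operators as combinations of unitaries\<close>

lemma isometry_norm: "(\<And>x. ip (blinfun_apply U x) (blinfun_apply U x) = ip x x) \<Longrightarrow> norm (blinfun_apply U x) = norm x"
  by (metis norm_eq_ip)

text \<open>The construction of \<open>quasi_unitary_bound\<close> for operators. The unitary itself
  is kept, because it serves twice: for norm bounds and for spanning the adjointable
  operators.\<close>

lemma adjointable_quasi_unitary:
  assumes ks: "adjointable ip k" "adjointable ip s" "adj ip k = k" "adj ip s = s"
    "k o\<^sub>L s = s o\<^sub>L k" "s + s + (s o\<^sub>L s) + (k o\<^sub>L k) = 0"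
  shows "\<exists>u. adjointable ip u \<and> adj ip u o\<^sub>L u = id_blinfun \<and> u o\<^sub>L adj ip u = id_blinfun \<and>
    2 *\<^sub>C k = u + adj ip u"
proof -
  have comm: "k (s x) = s (k x)" for x using ks(5) by (metis blinfun_apply_blinfun_compose)
  have sq: "s x + s x + s (s x) + k (k x) = 0" for x
    using arg_cong[OF ks(6), of "\<lambda>T. blinfun_apply T x"] by (simp add: blinfun.add_left)
  define u where "u = k + \<i> *\<^sub>C (id_blinfun + s)"
  have ids: "adjointable ip (id_blinfun + s)" "adjointable ip (\<i> *\<^sub>C (id_blinfun + s))"
    using ks complex_vector.subspace_add[OF csubspace_adjointable]
      complex_vector.subspace_scale[OF csubspace_adjointable] by auto
  then have u: "adjointable ip u"
    unfolding u_def using ks complex_vector.subspace_add[OF csubspace_adjointable] by blast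
  have su: "adj ip u = k + (- \<i>) *\<^sub>C (id_blinfun + s)"
    unfolding u_def using ks ids by (simp add: adj_add adj_scaleC)
  have sc: "k (c *\<^sub>C x) = c *\<^sub>C k x" "s (c *\<^sub>C x) = c *\<^sub>C s x" for c x
    using ks by (simp_all add: adjointable_scaleC_apply)
  \<comment> \<open>The choices \<open>c = \<i>\<close> and \<open>c = - \<i>\<close> give the two
    orders of the product of \<open>u\<close> and its adjoint.\<close>
  have "(k + (- c) *\<^sub>C (id_blinfun + s)) o\<^sub>L (k + c *\<^sub>C (id_blinfun + s)) = id_blinfun"
    if "c * c = -1" for c
  proof (rule blinfun_eqI)
    fix x
    have "((k + (- c) *\<^sub>C (id_blinfun + s)) o\<^sub>L (k + c *\<^sub>C (id_blinfun + s))) x =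
        x + (s x + s x + s (s x) + k (k x))"
      using that by (simp add: blinfun.add_left blinfun.add_right blinfun.diff_left blinfun.diff_right
          scaleC_blinfun.rep_eq sc comm scaleC_add_right scaleC_diff_right blinfun.minus_left blinfun.minus_right)
    then show "((k + (- c) *\<^sub>C (id_blinfun + s)) o\<^sub>L (k + c *\<^sub>C (id_blinfun + s))) x = id_blinfun x"
      using sq by simp
  qed
  from this[of \<i>] this[of "-\<i>"] have "adj ip u o\<^sub>L u = id_blinfun" "u o\<^sub>L adj ip u = id_blinfun"
    unfolding su unfolding u_def by simp_all
  moreover have "2 *\<^sub>C k = u + adj ip u"
    using scaleC_add_left[of 1 1 k] unfolding su unfolding u_def by simp
  ultimately show ?thesis using u by blast
qed

lemma unitary_norm_le:
  assumes "adjointable ip u" "adj ip u o\<^sub>L u = id_blinfun"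
  shows "norm u \<le> 1"
proof (rule norm_blinfun_bound)
  fix x
  have "ip (u y) (u y) = ip y y" for y
    using assms by (metis blinfun_apply_blinfun_compose id_blinfun.rep_eq ip_adj_right)
  then have "norm (u x) = norm x" by (rule isometry_norm)
  then show "norm (u x) \<le> 1 * norm x" by simp
qed simp

lemma adjointable_quasi_unitary_bound:
  assumes "adjointable ip k" "adjointable ip s" "adj ip k = k" "adj ip s = s"
    "k o\<^sub>L s = s o\<^sub>L k" "s + s + (s o\<^sub>L s) + (k o\<^sub>L k) = 0"
  shows "norm k \<le> 1"
proof -
  obtain u where u: "adjointable ip u" "adj ip u o\<^sub>L u = id_blinfun" "u o\<^sub>L adj ip u = id_blinfun"
    "2 *\<^sub>C k = u + adj ip u"
    using adjointable_quasi_unitary[OF assms] by blast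
  have "norm u \<le> 1" "norm (adj ip u) \<le> 1"
    using u by (auto intro: unitary_norm_le simp: adj_adj)
  then have "norm (2 *\<^sub>C k) \<le> 2" using norm_triangle_ineq[of u "adj ip u"] u(4) by simp
  then show ?thesis by (simp add: norm_scaleC)
qed

lemma star_hom_adjointable_bounded:
  assumes "star_algebra_on S mul st" "star_hom_on S mul st (o\<^sub>L) (adj ip) h"
    "h ` S \<subseteq> Collect (adjointable ip)"
  shows "\<exists>C. \<forall>x\<in>S. norm (h x) \<le> C * norm x"
  by (rule star_algebra_on.star_hom_bounded[OF assms]) (auto intro: adjointable_quasi_unitary_bound)

text \<open>After scaling, the real and the imaginary part of \<open>T\<close> are real parts of
  unitaries, so \<open>T\<close> is a combination of four unitaries. This serves a construction that
  is evident for unitaries only.\<close>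

lemma adjointable_span_unitaries:
  assumes V: "csubspace V"
    and unitary: "\<And>u. adjointable ip u \<Longrightarrow> adj ip u o\<^sub>L u = id_blinfun \<Longrightarrow>
      u o\<^sub>L adj ip u = id_blinfun \<Longrightarrow> u \<in> V"
    and T: "adjointable ip T"
  shows "T \<in> V"
proof -
  interpret A: star_algebra_on "Collect (adjointable ip)" "(o\<^sub>L)" "adj ip"
    by (rule star_algebra_adjointable)
  have small: "K \<in> V" if K: "adjointable ip K" "adj ip K = K" "norm K < 1" for K
  proof -
    obtain s where s: "adjointable ip s" "adj ip s = s" "K o\<^sub>L s = s o\<^sub>L K"
      "s + s + (s o\<^sub>L s) + (K o\<^sub>L K) = 0"
      using A.quasi_sqrt_exists[of K] K by auto
    obtain u where u: "adjointable ip u" "adj ip u o\<^sub>L u = id_blinfun" "u o\<^sub>L adj ip u = id_blinfun"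
      "2 *\<^sub>C K = u + adj ip u"
      using adjointable_quasi_unitary[OF K(1) s(1) K(2) s(2,3,4)] by blast
    have "u \<in> V" "adj ip u \<in> V" using u by (auto intro!: unitary simp: adj_adj)
    then have "(1/2) *\<^sub>C (2 *\<^sub>C K) \<in> V"
      unfolding u(4) by (intro complex_vector.subspace_scale[OF V] complex_vector.subspace_add[OF V])
    then show ?thesis by simp
  qed
  have sa: "K \<in> V" if K: "adjointable ip K" "adj ip K = K" for K
  proof -
    define r where "r = norm K + 1"
    have r: "r > 0" "norm K < r" using norm_ge_zero[of K] by (simp_all add: r_def add_nonneg_pos)
    have "complex_of_real (1/r) *\<^sub>C K \<in> V"
      by (rule small) (use K r A.scaleC_closed in \<open>auto simp: adj_scaleC norm_scaleC norm_divide\<close>)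
    then have "complex_of_real r *\<^sub>C (complex_of_real (1/r) *\<^sub>C K) \<in> V"
      by (rule complex_vector.subspace_scale[OF V])
    then show ?thesis using r by simp
  qed
  obtain u v where "adjointable ip u" "adjointable ip v" "adj ip u = u" "adj ip v = v" "T = u + \<i> *\<^sub>C v"
    using A.selfadjoint_decomposition[of T] T unfolding mem_Collect_eq by metis
  then show ?thesis
    using sa complex_vector.subspace_add[OF V] complex_vector.subspace_scale[OF V] by simp
qed

lemma cstar_subalgebra_star_algebra: "cstar_subalgebra ip S \<Longrightarrow> star_algebra_on S (o\<^sub>L) (adj ip)"
  by (rule star_algebra_on.star_algebra_on_subset[OF star_algebra_adjointable])
    (auto simp: cstar_subalgebra_def)

lemma cstar_subalgebra_adjointable: "cstar_subalgebra ip (Collect (adjointable ip))"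
  by (auto simp: cstar_subalgebra_def csubspace_adjointable closed_adjointable)

lemma cstar_subalgebra_Inter:
  assumes "\<And>S. S \<in> \<A> \<Longrightarrow> cstar_subalgebra ip S" "\<A> \<noteq> {}"
  shows "cstar_subalgebra ip (\<Inter>\<A>)"
proof -
  obtain S where "S \<in> \<A>" using assms(2) by blast
  then have "\<Inter>\<A> \<subseteq> Collect (adjointable ip)"
    using assms(1)[of S] by (auto simp: cstar_subalgebra_def)
  then show ?thesis using assms(1) unfolding cstar_subalgebra_def
    by (intro conjI complex_vector.subspace_Inter closed_Inter) auto
qed


subsection \<open>Compact operators\<close>

lemma ketbra_apply [simp]: "blinfun_apply (ketbra act ip e f) x = act e (ip f x)"
proof -
  have "bounded_linear (\<lambda>x. act e (ip f x))"
    by (intro bounded_linear_compose[OF bounded_bilinear.bounded_linear_right[OF bounded_bilinear_act]]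
        bounded_bilinear.bounded_linear_right[OF bounded_bilinear_ip])
  then show ?thesis by (simp add: ketbra_def bounded_linear_Blinfun_apply)
qed

lemma adjointable_ketbra [simp]: "adjointable ip (ketbra act ip e f)"
  by (rule adjointI[of "ketbra act ip f e"]) (simp add: ip_act_left ip_act_right ip_star)

lemma adj_ketbra: "adj ip (ketbra act ip e f) = ketbra act ip f e"
  by (rule adj_eqI) (simp add: ip_act_left ip_act_right ip_star)

lemma comp_ketbra: "adjointable ip T \<Longrightarrow> T o\<^sub>L ketbra act ip e f = ketbra act ip (T e) f"
  by (rule blinfun_eqI) (simp add: adjointable_act_apply)

lemma ketbra_comp: "adjointable ip T \<Longrightarrow> ketbra act ip e f o\<^sub>L T = ketbra act ip e (adj ip T f)"
  by (rule blinfun_eqI) (simp add: ip_adj_left)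

lemma ketbra_compact: "ketbra act ip e f \<in> compact_ops act ip"
  unfolding compact_ops_def by (rule closure_cspan_base) blast

lemma compact_ops_induct [consumes 1, case_names base subspace closed]:
  assumes "K \<in> compact_ops act ip"
    "\<And>e f. ketbra act ip e f \<in> V" "csubspace V" "closed V"
  shows "K \<in> V"
  using closure_cspan_minimal[of "{ketbra act ip e f |e f. True}" V] assms
  unfolding compact_ops_def by auto

lemma compact_adjointable: "K \<in> compact_ops act ip \<Longrightarrow> adjointable ip K"
  using compact_ops_induct[of K "Collect (adjointable ip)"]
  by (simp add: csubspace_adjointable closed_adjointable)

lemma csubspace_compact: "csubspace (compact_ops act ip)"
  unfolding compact_ops_def by (rule csubspace_closure_cspan)

lemma closed_compact: "closed (compact_ops act ip)"
  unfolding compact_ops_def by simp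

lemma continuous_on_compose_left: "continuous_on UNIV (\<lambda>X. S o\<^sub>L X)"
  and continuous_on_compose_right: "continuous_on UNIV (\<lambda>X. X o\<^sub>L S)"
  for S :: "'e \<Rightarrow>\<^sub>L 'e"
  by (auto intro!: continuous_intros bounded_bilinear.continuous_on[OF bounded_bilinear_blinfun_compose])

lemma compact_comp:
  assumes K: "K \<in> compact_ops act ip" and T: "adjointable ip T"
  shows "T o\<^sub>L K \<in> compact_ops act ip" "K o\<^sub>L T \<in> compact_ops act ip"
proof -
  have "K \<in> {K. adjointable ip K \<and> T o\<^sub>L K \<in> compact_ops act ip}" using K
  proof (induction rule: compact_ops_induct)
    case base then show ?case using T by (simp add: comp_ketbra ketbra_compact)
  next
    case subspace
    interpret A: star_algebra_on "Collect (adjointable ip)" "(o\<^sub>L)" "adj ip"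
      by (rule star_algebra_adjointable)
    show ?case
      using A.zero_closed A.add_closed A.scaleC_closed A.mul_add_right[of T] A.mul_scaleC_right[of T] T
        A.mul_scaleC_right[of T 0 0]
        complex_vector.subspace_0[OF csubspace_compact] complex_vector.subspace_add[OF csubspace_compact]
        complex_vector.subspace_scale[OF csubspace_compact]
      by (intro complex_vector.subspaceI) (auto simp: bounded_bilinear.zero_right[OF bounded_bilinear_blinfun_compose])
  next
    case closed
    have "{K. adjointable ip K \<and> T o\<^sub>L K \<in> compact_ops act ip} =
        Collect (adjointable ip) \<inter> (\<lambda>K. T o\<^sub>L K) -` compact_ops act ip" by auto
    then show ?case
      by (auto intro!: closed_Int closed_adjointable closed_vimage closed_compact continuous_on_compose_left)
  qed
  then show "T o\<^sub>L K \<in> compact_ops act ip" by simp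
  have "K \<in> {K. K o\<^sub>L T \<in> compact_ops act ip}" using K
  proof (induction rule: compact_ops_induct)
    case base then show ?case using T by (simp add: ketbra_comp ketbra_compact)
  next
    case subspace
    show ?case
      using complex_vector.subspace_0[OF csubspace_compact] complex_vector.subspace_add[OF csubspace_compact]
        complex_vector.subspace_scale[OF csubspace_compact]
      by (intro complex_vector.subspaceI)
        (auto simp: bounded_bilinear.zero_left[OF bounded_bilinear_blinfun_compose]
          bounded_bilinear.add_left[OF bounded_bilinear_blinfun_compose]
          blinfun_compose_scaleC_left)
  next
    case closed
    have "{K. K o\<^sub>L T \<in> compact_ops act ip} = (\<lambda>K. K o\<^sub>L T) -` compact_ops act ip" by auto
    then show ?case
      by (auto intro!: closed_vimage closed_compact continuous_on_compose_right)
  qed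
  then show "K o\<^sub>L T \<in> compact_ops act ip" by simp
qed

lemma adj_compact:
  assumes K: "K \<in> compact_ops act ip"
  shows "adj ip K \<in> compact_ops act ip"
proof -
  interpret A: star_algebra_on "Collect (adjointable ip)" "(o\<^sub>L)" "adj ip"
    by (rule star_algebra_adjointable)
  have "K \<in> {K. adjointable ip K \<and> adj ip K \<in> compact_ops act ip}" using K
  proof (induction rule: compact_ops_induct)
    case base then show ?case by (simp add: adj_ketbra ketbra_compact)
  next
    case subspace
    show ?case
      using A.zero_closed A.add_closed A.scaleC_closed A.st_add A.st_scaleC A.st_zero
        complex_vector.subspace_0[OF csubspace_compact] complex_vector.subspace_add[OF csubspace_compact]
        complex_vector.subspace_scale[OF csubspace_compact]
      by (intro complex_vector.subspaceI) auto
  next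
    case closed
    show ?case unfolding closed_sequential_limits
    proof (intro allI impI, elim conjE)
      fix X :: "nat \<Rightarrow> 'e \<Rightarrow>\<^sub>L 'e" and l
      assume X: "\<forall>n. X n \<in> {K. adjointable ip K \<and> adj ip K \<in> compact_ops act ip}" "X \<longlonglongrightarrow> l"
      then have "(\<lambda>n. adj ip (X n)) \<longlonglongrightarrow> adj ip l" by (intro A.tendsto_st) auto
      then have "adj ip l \<in> compact_ops act ip" using X closed_sequentially[OF closed_compact, of "\<lambda>n. adj ip (X n)"] by auto
      moreover have "adjointable ip l" using X closed_sequentially[OF closed_adjointable, of X l] by simp
      ultimately show "l \<in> {K. adjointable ip K \<and> adj ip K \<in> compact_ops act ip}" by simp
    qed
  qed
  then show ?thesis by simp
qed

lemma star_algebra_compact: "star_algebra_on (compact_ops act ip) (o\<^sub>L) (adj ip)"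
  by (rule star_algebra_on.star_algebra_on_subset[OF star_algebra_adjointable])
    (auto simp: compact_adjointable csubspace_compact closed_compact adj_compact compact_comp)


subsection \<open>Operators given on generators\<close>

lemma ip_dense_eq:
  assumes S: "\<And>c x. blinfun_apply S (c *\<^sub>C x) = c *\<^sub>C S x" and T: "\<And>c x. blinfun_apply T (c *\<^sub>C x) = c *\<^sub>C T x"
    and gen: "\<And>x y. x \<in> B \<Longrightarrow> y \<in> B \<Longrightarrow> ip (S x) y = ip x (T y)"
    and dense: "closure (cspan B) = UNIV"
  shows "ip (S x) y = ip x (T y)"
proof -
  have 1: "ip (S x) y = ip x (T y)" if "y \<in> B" for x y
  proof -
    have "x \<in> closure (cspan B)" using dense by simp
    moreover have "closure (cspan B) \<subseteq> {x. ip (S x) y = ip x (T y)}"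
    proof (rule closure_cspan_minimal)
      show "csubspace {x. ip (S x) y = ip x (T y)}"
        by (rule complex_vector.subspaceI)
          (auto simp: blinfun.add_right ip_add_left S ip_scaleC_left)
      show "closed {x. ip (S x) y = ip x (T y)}"
        by (intro closed_Collect_eq continuous_on_ip continuous_intros)
    qed (use gen that in auto)
    ultimately show ?thesis by auto
  qed
  have "y \<in> closure (cspan B)" using dense by simp
  moreover have "closure (cspan B) \<subseteq> {y. ip (S x) y = ip x (T y)}"
  proof (rule closure_cspan_minimal)
    show "csubspace {y. ip (S x) y = ip x (T y)}"
      by (rule complex_vector.subspaceI)
        (auto simp: blinfun.add_right ip_add_right T ip_scaleC_right)
    show "closed {y. ip (S x) y = ip x (T y)}"
      by (intro closed_Collect_eq continuous_on_ip continuous_intros)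
  qed (use 1 in auto)
  ultimately show ?thesis by auto
qed

lemma dense_eqI:
  assumes gen: "\<And>z. z \<in> B \<Longrightarrow> ip z x = ip z y" and dense: "closure (cspan B) = UNIV"
  shows "x = y"
proof (rule ip_eqI)
  fix z
  have "z \<in> closure (cspan B)" using dense by simp
  moreover have "closure (cspan B) \<subseteq> {z. ip z x = ip z y}"
  proof (rule closure_cspan_minimal)
    show "csubspace {z. ip z x = ip z y}"
      by (rule complex_vector.subspaceI) (auto simp: ip_add_left ip_scaleC_left)
    show "closed {z. ip z x = ip z y}"
      by (intro closed_Collect_eq continuous_on_ip continuous_intros)
  qed (use gen in auto)
  ultimately show "ip z x = ip z y" by auto
qed

lemma blinfun_dense_eqI:
  assumes S: "\<And>c x. blinfun_apply S (c *\<^sub>C x) = c *\<^sub>C S x" and T: "\<And>c x. blinfun_apply T (c *\<^sub>C x) = c *\<^sub>C T x"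
    and gen: "\<And>x. x \<in> B \<Longrightarrow> S x = T x" and dense: "closure (cspan B) = UNIV"
  shows "S = (T :: 'e \<Rightarrow>\<^sub>L 'e)"
proof (rule blinfun_eqI)
  fix x
  have "x \<in> closure (cspan B)" using dense by simp
  moreover have "closure (cspan B) \<subseteq> {x. S x = T x}"
  proof (rule closure_cspan_minimal)
    show "csubspace {x. S x = T x}"
      by (rule complex_vector.subspaceI) (auto simp: blinfun.add_right S T)
    show "closed {x. S x = T x}"
      by (intro closed_Collect_eq continuous_intros)
  qed (use gen in auto)
  ultimately show "S x = T x" by auto
qed

text \<open>\<open>M\<close> stands for the adjoint of \<open>T\<close> times \<open>T\<close>. A
  combination \<open>y\<close> of the \<open>t i\<close> and the same combination \<open>x\<close>
  of the \<open>g i\<close> satisfy \<open>ip y y = ip x (M x)\<close>, which bounds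
  \<open>y\<close> by \<open>x\<close> and so makes the assignment well defined.\<close>

lemma extension_gram:
  fixes M :: "'e \<Rightarrow>\<^sub>L 'e"
  assumes dense: "closure (cspan (g ` I)) = UNIV"
    and M: "\<And>c x. M (c *\<^sub>C x) = c *\<^sub>C M x"
    and gram: "\<And>i j. i \<in> I \<Longrightarrow> j \<in> I \<Longrightarrow> ip (t i) (t j) = ip (g i) (M (g j))"
  shows "\<exists>T :: 'e \<Rightarrow>\<^sub>L 'e. (\<forall>c x. T (c *\<^sub>C x) = c *\<^sub>C T x) \<and> (\<forall>i\<in>I. T (g i) = t i)"
proof (rule bounded_extension[OF _ dense])
  fix x y assume xy: "lin_graph I g t x y"
  have 1: "ip y (t j) = ip x (M (g j))" if "j \<in> I" "lin_graph I g t x y" for j x y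
    using that(2) by induction (simp_all add: ip_add_left ip_scaleC_left gram that(1))
  have 2: "ip y y' = ip x (M x')" if "lin_graph I g t x' y'" for x' y'
    using that by induction
      (simp_all add: ip_add_right ip_scaleC_right blinfun.add_right M 1[OF _ xy])
  have "(norm y)\<^sup>2 = norm (ip x (M x))" using 2[OF xy] by (simp flip: norm_ip_self)
  also have "\<dots> \<le> 4 * norm x * norm (M x)" by (rule norm_ip)
  also have "\<dots> \<le> 4 * norm x * (norm M * norm x)"
    by (intro mult_left_mono norm_blinfun) auto
  also have "\<dots> = (sqrt (4 * norm M) * norm x)\<^sup>2" by (simp add: power_mult_distrib power2_eq_square)
  finally show "norm y \<le> sqrt (4 * norm M) * norm x" by (rule power2_le_imp_le) simp
qed

text \<open>The candidate \<open>s\<close> for the adjoint needs no bound of its own: a combination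
  \<open>y\<close> of its values satisfies \<open>ip y z = ip x (T z)\<close> for all
  \<open>z\<close>, and \<open>z = y\<close> bounds \<open>y\<close> by means of
  \<open>T\<close>.\<close>

lemma extension_adjoint:
  fixes T :: "'e \<Rightarrow>\<^sub>L 'e"
  assumes dense: "closure (cspan (g ` I)) = UNIV"
    and T: "\<And>c x. T (c *\<^sub>C x) = c *\<^sub>C T x"
    and gen: "\<And>i j. i \<in> I \<Longrightarrow> j \<in> I \<Longrightarrow> ip (s i) (g j) = ip (g i) (T (g j))"
  shows "adjointable ip T \<and> (\<forall>i\<in>I. adj ip T (g i) = s i)"
proof -
  have *: "ip (s i) y = ip (g i) (T y)" if "i \<in> I" for i y
  proof -
    have "y \<in> closure (cspan (g ` I))" using dense by simp
    moreover have "closure (cspan (g ` I)) \<subseteq> {y. ip (s i) y = ip (g i) (T y)}"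
    proof (rule closure_cspan_minimal)
      show "csubspace {y. ip (s i) y = ip (g i) (T y)}"
        by (rule complex_vector.subspaceI)
          (auto simp: blinfun.add_right ip_add_right T ip_scaleC_right)
      show "closed {y. ip (s i) y = ip (g i) (T y)}"
        by (intro closed_Collect_eq continuous_on_ip continuous_intros)
    qed (use gen that in auto)
    ultimately show ?thesis by auto
  qed
  have "\<exists>S :: 'e \<Rightarrow>\<^sub>L 'e. (\<forall>c x. S (c *\<^sub>C x) = c *\<^sub>C S x) \<and> (\<forall>i\<in>I. S (g i) = s i)"
  proof (rule bounded_extension[OF _ dense])
    fix x y assume xy: "lin_graph I g s x y"
    have **: "ip y z = ip x (T z)" for z
      using xy by induction (simp_all add: ip_add_left ip_scaleC_left *)
    have "(norm y)\<^sup>2 = norm (ip x (T y))" using **[of y] by (simp flip: norm_ip_self)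
    also have "\<dots> \<le> 4 * norm x * norm (T y)" by (rule norm_ip)
    also have "\<dots> \<le> 4 * norm x * (norm T * norm y)"
      by (intro mult_left_mono norm_blinfun) auto
    finally have "norm y * norm y \<le> (4 * norm T * norm x) * norm y"
      by (simp add: power2_eq_square mult_ac)
    then show "norm y \<le> 4 * norm T * norm x"
      by (cases "y = 0") (simp_all add: mult_le_cancel_right)
  qed
  then obtain S :: "'e \<Rightarrow>\<^sub>L 'e" where S: "\<And>c x. S (c *\<^sub>C x) = c *\<^sub>C S x" "\<And>i. i \<in> I \<Longrightarrow> S (g i) = s i"
    by blast
  have "ip (S x) y = ip x (T y)" for x y
    by (rule ip_dense_eq[OF S(1) T _ dense]) (use S(2) gen in auto)
  then show ?thesis using adj_eqI S(2) adjointI by metis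
qed

end


section \<open>Elementary tensors\<close>

context unital_correspondence
begin

lemma phi_add: "\<phi> (a + b) = \<phi> a + \<phi> b"
  and phi_mult: "\<phi> (a * b) = \<phi> a o\<^sub>L \<phi> b"
  and phi_scaleC: "\<phi> (c *\<^sub>C a) = c *\<^sub>C \<phi> a"
  and phi_star: "\<phi> (star a) = adj ip (\<phi> a)"
  using phi_star_hom unfolding star_hom_on_def by blast+

lemma ip_phi: "ip (\<phi> a x) y = ip x (\<phi> (star a) y)"
  using ip_adj_right[OF phi_adjointable] by (simp add: phi_star)

text \<open>
  \<open>tail_ip a es fs\<close> is \<open>\<langle>e\<^sub>1 \<otimes> \<dots> \<otimes> e\<^sub>n | \<phi>(a) f\<^sub>1 \<otimes> \<dots> \<otimes> f\<^sub>n\<rangle>\<close>; for \<open>n = 0\<close>, unlike \<open>tensor_ip\<close>, it is \<open>a\<close>.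
\<close>

fun tail_ip :: "'a \<Rightarrow> 'e list \<Rightarrow> 'e list \<Rightarrow> 'a" where
  "tail_ip a [] [] = a"
| "tail_ip a (e # es) (f # fs) = tail_ip (ip e (\<phi> a f)) es fs"
| "tail_ip _ _ _ = 0"

text \<open>\<open>tensor_ip\<close> pushes the coefficient into the next letter,
  \<open>tail_ip\<close> carries it along separately; the second form is the one that suits
  induction.\<close>

lemma tensor_ip_Cons: "tensor_ip (e # es) (f # fs) = tail_ip (ip e f) es fs"
proof (induction es arbitrary: e f fs)
  case Nil
  then show ?case by (cases fs) auto
next
  case (Cons e' es)
  then show ?case by (cases fs) auto
qed

lemma tail_ip_add: "tail_ip (a + b) es fs = tail_ip a es fs + tail_ip b es fs"
  by (induction a es fs arbitrary: b rule: tail_ip.induct)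
    (auto simp: phi_add blinfun.add_left ip_add_right)

lemma tail_ip_scaleC: "tail_ip (c *\<^sub>C a) es fs = c *\<^sub>C tail_ip a es fs"
  by (induction a es fs rule: tail_ip.induct)
    (auto simp: phi_scaleC scaleC_blinfun.rep_eq ip_scaleC_right)

lemma tail_ip_length: "length es \<noteq> length fs \<Longrightarrow> tail_ip a es fs = 0"
  by (induction a es fs rule: tail_ip.induct) auto

lemma tensor_ip_length: "length es \<noteq> length fs \<Longrightarrow> tensor_ip es fs = 0"
  by (cases es; cases fs) (auto simp: tensor_ip_Cons tail_ip_length)

text \<open>\<open>tail_ip\<close> consumes words from the left, while \<open>I_ideal\<close> grows
  by an outermost inner product. Splitting off the last letters matches the two recursions.\<close>

lemma tail_ip_snoc:
  "length es = length fs \<Longrightarrow> tail_ip a (es @ [e]) (fs @ [f]) = ip e (\<phi> (tail_ip a es fs) f)"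
  by (induction a es fs rule: tail_ip.induct) auto

lemma csubspace_I_ideal: "csubspace (I_ideal n)"
  by (cases n rule: I_ideal.cases)
    (simp_all add: csubspace_closure_cspan complex_vector.subspace_UNIV)

lemma closed_I_ideal: "closed (I_ideal n)"
  by (cases n rule: I_ideal.cases) simp_all

lemma ip_phi_I_ideal: "x \<in> I_ideal n \<Longrightarrow> ip e (\<phi> x f) \<in> I_ideal (Suc n)"
  by (cases n) (auto intro!: closure_cspan_base)

text \<open>Induction from the right end. At the empty word the coefficient \<open>a\<close> is
  arbitrary, as \<open>I_ideal 0\<close> is all of \<open>A\<close>.\<close>

lemma tail_ip_I_ideal: "length es = length fs \<Longrightarrow> tail_ip a es fs \<in> I_ideal (length es)"
proof (induction es arbitrary: fs rule: rev_induct)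
  case (snoc e es)
  then obtain f fs' where "fs = fs' @ [f]" by (cases fs rule: rev_cases) auto
  then show ?case using snoc ip_phi_I_ideal by (simp add: tail_ip_snoc)
qed simp

lemma tensor_ip_I_ideal: "tensor_ip es fs \<in> I_ideal (length es)"
proof (cases "length es = length fs")
  case True
  then show ?thesis
  proof (cases es; cases fs)
    fix e es' f fs' assume *: "es = e # es'" "fs = f # fs'"
    then have "tensor_ip es fs = tail_ip 1 es fs" by (simp add: tensor_ip_Cons phi_one)
    then show ?thesis using tail_ip_I_ideal[OF True] by metis
  qed auto
qed (simp add: tensor_ip_length complex_vector.subspace_0[OF csubspace_I_ideal])

lemma I_ideal_Suc_subset: "I_ideal (Suc n) \<subseteq> I_ideal n"
proof (induction n)
  case (Suc n)
  show ?case
  proof (cases n)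
    case 0
    show ?thesis unfolding 0 I_ideal.simps by (rule closure_cspan_mono) blast
  next
    case (Suc m)
    show ?thesis using \<open>I_ideal (Suc n) \<subseteq> I_ideal n\<close>
      unfolding Suc I_ideal.simps(3) by (intro closure_cspan_mono) blast
  qed
qed simp

text \<open>Besides \<open>k - 1\<close>, the degrees \<open>2 * k - 1\<close>,
  \<open>3 * k - 1\<close> and so on are congruent to -1; their inner products lie in
  \<open>I_ideal (k - 1)\<close> as well.\<close>

lemma I_ideal_antimono: "m \<le> n \<Longrightarrow> I_ideal n \<subseteq> I_ideal m"
  using lift_Suc_antimono_le[of I_ideal] I_ideal_Suc_subset by blast

lemma csubspace_mult_vimage: "csubspace V \<Longrightarrow> csubspace {x. x * (a::'a) \<in> V}"
  by (rule complex_vector.subspaceI)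
    (auto simp: complex_vector.subspace_0 complex_vector.subspace_add complex_vector.subspace_scale
      distrib_right scaleC_mult_left)

lemma closed_mult_vimage: "closed V \<Longrightarrow> closed {x. x * (a::'a) \<in> V}"
proof -
  assume "closed V"
  moreover have "continuous_on UNIV (\<lambda>x. x * a)" by (intro continuous_intros)
  ultimately have "closed ((\<lambda>x. x * a) -` V)" by (rule closed_vimage)
  then show ?thesis by (simp add: vimage_def)
qed

text \<open>The factor \<open>a\<close> is absorbed by the vector on the right. The right ideal
  property is what carries an approximation of 1 over to all of \<open>A\<close>.\<close>

lemma I_ideal_mult: "x \<in> I_ideal n \<Longrightarrow> x * a \<in> I_ideal n"
proof (cases n rule: I_ideal.cases)
  case 2
  have "I_ideal (Suc 0) \<subseteq> {x. x * a \<in> I_ideal (Suc 0)}"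
    unfolding I_ideal.simps(2)
    by (intro closure_cspan_minimal csubspace_mult_vimage closed_mult_vimage csubspace_closure_cspan)
      (simp_all, clarsimp simp flip: ip_act_right, rule closure_cspan_base, blast)
  then show "x \<in> I_ideal n \<Longrightarrow> ?thesis" using 2 by auto
next
  case (3 m)
  have "I_ideal (Suc (Suc m)) \<subseteq> {x. x * a \<in> I_ideal (Suc (Suc m))}"
    unfolding I_ideal.simps(3)
    by (intro closure_cspan_minimal csubspace_mult_vimage closed_mult_vimage csubspace_closure_cspan)
      (simp_all, clarsimp simp: phi_adjointable simp flip: ip_act_right adjointable_act_apply,
        rule closure_cspan_base, blast)
  then show "x \<in> I_ideal n \<Longrightarrow> ?thesis" using 3 by auto
qed simp

end


section \<open>Operators on the Fock space\<close>

context fock_module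
begin

text \<open>One index type for both kinds of generators, as the extension lemmas require. The index
  \<open>Inr []\<close> is left out throughout, because \<open>tens []\<close> is
  unspecified.\<close>

definition gen :: "'a + 'e list \<Rightarrow> 'f" where
  "gen i = (case i of Inl a \<Rightarrow> vac a | Inr es \<Rightarrow> tens es)"

lemma gen_image: "gen ` {i. i \<noteq> Inr []} = range vac \<union> tens ` {es. es \<noteq> []}"
proof -
  have *: "{i. i \<noteq> Inr []} = range Inl \<union> Inr ` {es :: 'e list. es \<noteq> []}"
    by (auto simp: image_iff) (metis sum.exhaust_sel)
  show ?thesis unfolding gen_def * by (simp add: image_Un image_image)
qed

lemma gen_dense: "closure (cspan (gen ` {i. i \<noteq> Inr []})) = UNIV"
  unfolding gen_image by (rule fock_dense)

lemma gen_cases [case_names vac tens]: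
  assumes "i \<noteq> Inr []"
    and "\<And>a. i = Inl a \<Longrightarrow> gen i = vac a \<Longrightarrow> thesis"
    and "\<And>e es. i = Inr (e # es) \<Longrightarrow> gen i = tens (e # es) \<Longrightarrow> thesis"
  shows thesis
proof (cases i)
  case (Inr es)
  then obtain e es' where "es = e # es'" using assms(1) by (cases es) auto
  then show ?thesis using Inr assms(3) by (simp add: gen_def)
qed (use assms(2) in \<open>simp add: gen_def\<close>)

lemma ip_tens_vac: "es \<noteq> [] \<Longrightarrow> ipF (tens es) (vac a) = 0"
  using ip_vac_tens[of es a] F.ip_star[of "vac a" "tens es"] by simp

lemma ip_tens_Cons: "ipF (tens (e # es)) (tens (f # fs)) = tail_ip (ip e f) es fs"
  by (simp add: ip_tens_tens tensor_ip_Cons)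

lemmas ip_gen = ip_vac_vac ip_vac_tens ip_tens_vac ip_tens_Cons

lemma fock_eqI:
  assumes "\<And>a. ipF (vac a) x = ipF (vac a) y"
    and "\<And>e es. ipF (tens (e # es)) x = ipF (tens (e # es)) y"
  shows "x = y"
proof (rule F.dense_eqI[OF _ fock_dense])
  fix z assume "z \<in> range vac \<union> tens ` {es. es \<noteq> []}"
  then show "ipF z x = ipF z y" using assms by (auto simp: neq_Nil_conv)
qed

lemma op_eqI:
  assumes "adjointable ipF S" "adjointable ipF T"
    and "\<And>a. S (vac a) = T (vac a)" "\<And>e es. S (tens (e # es)) = T (tens (e # es))"
  shows "S = T"
proof (rule F.blinfun_dense_eqI[OF _ _ _ fock_dense])
  fix z assume "z \<in> range vac \<union> tens ` {es. es \<noteq> []}"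
  then show "S z = T z" using assms by (auto simp: neq_Nil_conv)
qed (use assms in \<open>simp_all add: F.adjointable_scaleC_apply\<close>)

text \<open>The two extension lemmas for the Fock space: \<open>M\<close> is the intended adjoint of
  \<open>T\<close> times \<open>T\<close>, and \<open>s\<close> lists the intended values of the
  adjoint.\<close>

lemma op_exists:
  fixes M :: "'f \<Rightarrow>\<^sub>L 'f"
  assumes M: "adjointable ipF M"
    and gram: "\<And>i j. i \<noteq> Inr [] \<Longrightarrow> j \<noteq> Inr [] \<Longrightarrow> ipF (t i) (t j) = ipF (gen i) (M (gen j))"
    and adj: "\<And>i j. i \<noteq> Inr [] \<Longrightarrow> j \<noteq> Inr [] \<Longrightarrow> ipF (s i) (gen j) = ipF (gen i) (t j)"
  shows "\<exists>T. adjointable ipF T \<and> (\<forall>i. i \<noteq> Inr [] \<longrightarrow> blinfun_apply T (gen i) = t i \<and> adj ipF T (gen i) = s i)"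
proof -
  have "\<exists>T :: 'f \<Rightarrow>\<^sub>L 'f. (\<forall>c x. T (c *\<^sub>C x) = c *\<^sub>C T x) \<and> (\<forall>i\<in>{i. i \<noteq> Inr []}. T (gen i) = t i)"
    by (rule F.extension_gram[OF gen_dense, of M]) (use M gram in \<open>auto simp: F.adjointable_scaleC_apply\<close>)
  then obtain T :: "'f \<Rightarrow>\<^sub>L 'f" where T: "\<And>c x. T (c *\<^sub>C x) = c *\<^sub>C T x"
    "\<And>i. i \<noteq> Inr [] \<Longrightarrow> T (gen i) = t i" by blast
  have "adjointable ipF T \<and> (\<forall>i\<in>{i. i \<noteq> Inr []}. adj ipF T (gen i) = s i)"
    by (rule F.extension_adjoint[OF gen_dense]) (use T adj in auto)
  then show ?thesis using T(2) by auto
qed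

section \<open>Linearity and balancedness of the generators\<close>

lemma vac_add: "vac (a + b) = vac a + vac b"
  by (rule fock_eqI) (simp_all add: F.ip_add_right ip_gen distrib_left)

lemma vac_scaleC: "vac (c *\<^sub>C a) = c *\<^sub>C vac a"
  by (rule fock_eqI) (simp_all add: F.ip_scaleC_right ip_gen scaleC_mult_right)

lemma vac_zero [simp]: "vac 0 = 0"
  using vac_scaleC[of 0 0] by simp

lemma vac_act: "actF (vac a) b = vac (a * b)"
  by (rule fock_eqI) (simp_all add: F.ip_act_right ip_gen mult.assoc)

lemma norm_vac: "norm (vac a) = norm a"
  using F.norm_ip_self[of "vac a"] cstar_identity[of a] by (simp add: ip_vac_vac power2_eq_iff_nonneg)

lemma bounded_linear_vac: "bounded_linear vac"
  by (rule bounded_linear_intro[where K=1])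
    (simp_all add: vac_add vac_scaleC scaleR_scaleC norm_vac)

lemma ip_vac_left: "ipF (vac a) x = star a * ipF (vac 1) x"
  using F.ip_act_left[of "vac 1" a x] by (simp add: vac_act)

lemma tens_add: "tens ((e + f) # es) = tens (e # es) + tens (f # es)"
  by (rule fock_eqI) (simp_all add: F.ip_add_right ip_gen ip_add_right tail_ip_add)

lemma tens_scaleC: "tens ((c *\<^sub>C e) # es) = c *\<^sub>C tens (e # es)"
  by (rule fock_eqI) (simp_all add: F.ip_scaleC_right ip_gen ip_scaleC_right tail_ip_scaleC)

lemma tail_ip_balanced: "tail_ip (b * a) fs (e # es) = tail_ip b fs (\<phi> a e # es)"
  by (cases fs) (simp_all add: phi_mult)

lemma tens_balanced: "tens (e # \<phi> a f # es) = tens (act e a # f # es)"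
  by (rule fock_eqI) (simp_all add: ip_gen ip_act_right tail_ip_balanced)

text \<open>\<open>vac_op a\<close> is \<open>a\<close> acting on the summand \<open>A\<close> only, i.e. \<open>a - \<psi>\<^sub>1(\<phi>(a))\<close> when \<open>\<phi>(a)\<close> is compact.\<close>

definition vac_op :: "'a \<Rightarrow> 'f \<Rightarrow>\<^sub>L 'f" where
  "vac_op a = Blinfun (\<lambda>x. vac (a * ipF (vac 1) x))"

lemma vac_op_apply: "vac_op a x = vac (a * ipF (vac 1) x)"
proof -
  have "bounded_linear (\<lambda>x. vac (a * ipF (vac 1) x))"
    by (intro bounded_linear_compose[OF bounded_linear_vac] bounded_linear_const_mult
        bounded_bilinear.bounded_linear_right[OF F.bounded_bilinear_ip])
  then show ?thesis by (simp add: vac_op_def bounded_linear_Blinfun_apply)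
qed

lemma vac_op_vac [simp]: "vac_op a (vac b) = vac (a * b)"
  by (simp add: vac_op_apply ip_gen)

lemma vac_op_tens [simp]: "vac_op a (tens (e # es)) = 0"
  by (simp add: vac_op_apply ip_gen)

lemma ip_vac_op: "ipF (vac_op (star a) x) y = ipF x (vac_op a y)"
proof -
  have "ipF x (vac (a * ipF (vac 1) y)) = star (ipF (vac (a * ipF (vac 1) y)) x)"
    by (simp add: F.ip_star)
  then show ?thesis
    unfolding vac_op_apply ip_vac_left[of "star a * _"] ip_vac_left[of "a * ipF (vac 1) y"]
    by (simp add: star_mult star_star mult.assoc)
qed

lemma adjointable_vac_op [simp]: "adjointable ipF (vac_op a)"
  using ip_vac_op by (rule F.adjointI)

lemma adj_vac_op: "adj ipF (vac_op a) = vac_op (star a)"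
  by (rule F.adj_eqI) (rule ip_vac_op)

text \<open>Every coefficient of \<open>vac_op a\<close> has the form \<open>b * a * c\<close>, so
  it belongs to each two-sided ideal that contains \<open>a\<close>.\<close>

lemma ip_vac_op_eq: "ipF x (vac_op a y) = ipF x (vac 1) * a * ipF (vac 1) y"
  using ip_vac_op[of a x y] ip_vac_left[of "star a * ipF (vac 1) x" y]
  by (simp add: vac_op_apply star_mult star_star F.ip_star)

section \<open>Operators acting on the first tensor factor\<close>

definition is_amp :: "('e \<Rightarrow>\<^sub>L 'e) \<Rightarrow> ('f \<Rightarrow>\<^sub>L 'f) \<Rightarrow> bool" where
  "is_amp K X \<longleftrightarrow> adjointable ipF X \<and> (\<forall>a. X (vac a) = 0) \<and>
     (\<forall>e es. X (tens (e # es)) = tens (K e # es))"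

text \<open>This is \<open>K\<close> tensored with the identity in degrees at least 1. The value 0
  on the vacuum makes the amplification of a rank one operator exactly a creation operator times an
  annihilation operator.\<close>

definition amp :: "('e \<Rightarrow>\<^sub>L 'e) \<Rightarrow> ('f \<Rightarrow>\<^sub>L 'f)" where
  "amp K = (THE X. is_amp K X)"

lemma amp_eqI: "is_amp K X \<Longrightarrow> amp K = X"
  unfolding amp_def by (rule the_equality) (auto simp: is_amp_def intro!: op_eqI)

text \<open>Inner products of tensors depend on the first letters only through \<open>ip\<close>,
  which \<open>u\<close> preserves. The prescribed images therefore have the Gram matrix of the
  generators.\<close>

lemma amp_unitary_exists:
  assumes u: "adjointable ip u" "adj ip u o\<^sub>L u = id_blinfun"
  shows "\<exists>X. is_amp u X"
proof -
  have uu: "ip (u e) (u f) = ip e f" for e f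
    using u by (metis blinfun_apply_blinfun_compose id_blinfun.rep_eq ip_adj_right)
  define t where "t v i = (case i of Inl b \<Rightarrow> vac b | Inr (e # es) \<Rightarrow> tens (blinfun_apply v e # es))"
    for v and i :: "'a + 'e list"
  have "\<exists>U. adjointable ipF U \<and> (\<forall>i. i \<noteq> Inr [] \<longrightarrow> blinfun_apply U (gen i) = t u i \<and>
      adj ipF U (gen i) = t (adj ip u) i)"
  proof (rule op_exists[OF F.adjointable_id])
    fix i j :: "'a + 'e list" assume ij: "i \<noteq> Inr []" "j \<noteq> Inr []"
    show "ipF (t u i) (t u j) = ipF (gen i) (id_blinfun (gen j))"
      by (rule gen_cases[OF ij(1)]; rule gen_cases[OF ij(2)]) (auto simp: t_def ip_gen uu)
    show "ipF (t (adj ip u) i) (gen j) = ipF (gen i) (t u j)"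
      by (rule gen_cases[OF ij(1)]; rule gen_cases[OF ij(2)])
        (auto simp: t_def ip_gen ip_adj_left u)
  qed
  then obtain U where U: "adjointable ipF U" "\<And>i. i \<noteq> Inr [] \<Longrightarrow> blinfun_apply U (gen i) = t u i" by blast
  have Ug: "U (vac b) = vac b" "U (tens (e # es)) = tens (u e # es)" for b e es
    using U(2)[of "Inl b"] U(2)[of "Inr (e # es)"] by (auto simp: gen_def t_def)
  have "adjointable ipF (id_blinfun - vac_op 1)"
    using complex_vector.subspace_diff[OF F.csubspace_adjointable, of id_blinfun "vac_op 1"] by simp
  then have "is_amp u (U o\<^sub>L (id_blinfun - vac_op 1))"
    by (simp add: is_amp_def U(1) blinfun.diff_left Ug)
  then show ?thesis by blast
qed

lemma amp_exists: "adjointable ip K \<Longrightarrow> is_amp K (amp K)"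
proof -
  assume K: "adjointable ip K"
  have "K \<in> {K. \<exists>X. is_amp K X}"
  proof (rule adjointable_span_unitaries[OF _ _ K])
    show "csubspace {K. \<exists>X. is_amp K X}"
    proof (rule complex_vector.subspaceI)
      have "is_amp 0 0"
        using tens_scaleC[of 0 0] complex_vector.subspace_0[OF F.csubspace_adjointable]
        by (simp add: is_amp_def)
      then show "0 \<in> {K. \<exists>X. is_amp K X}" by blast
      fix K L assume "K \<in> {K. \<exists>X. is_amp K X}" "L \<in> {K. \<exists>X. is_amp K X}"
      then obtain X Y where "is_amp K X" "is_amp L Y" by blast
      then have "is_amp (K + L) (X + Y)"
        using complex_vector.subspace_add[OF F.csubspace_adjointable, of X Y]
        by (simp add: is_amp_def blinfun.add_left tens_add)
      then show "K + L \<in> {K. \<exists>X. is_amp K X}" by blast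
    next
      fix c K assume "K \<in> {K. \<exists>X. is_amp K X}"
      then obtain X where "is_amp K X" by blast
      then have "is_amp (c *\<^sub>C K) (c *\<^sub>C X)"
        using complex_vector.subspace_scale[OF F.csubspace_adjointable, of X]
        by (simp add: is_amp_def scaleC_blinfun.rep_eq tens_scaleC)
      then show "c *\<^sub>C K \<in> {K. \<exists>X. is_amp K X}" by blast
    qed
  qed (use amp_unitary_exists in blast)
  then show ?thesis using amp_eqI by blast
qed

lemma adjointable_amp: "adjointable ip K \<Longrightarrow> adjointable ipF (amp K)"
  and amp_vac: "adjointable ip K \<Longrightarrow> amp K (vac a) = 0"
  and amp_tens: "adjointable ip K \<Longrightarrow> amp K (tens (e # es)) = tens (K e # es)"
  using amp_exists by (auto simp: is_amp_def)

lemma amp_star_hom: "star_hom_on (Collect (adjointable ip)) (o\<^sub>L) (adj ip) (o\<^sub>L) (adj ipF) amp"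
proof -
  have "amp (K + L) = amp K + amp L" "amp (K o\<^sub>L L) = amp K o\<^sub>L amp L"
    if "adjointable ip K" "adjointable ip L" for K L
    using that complex_vector.subspace_add[OF F.csubspace_adjointable, of "amp K" "amp L"]
    by (auto intro!: amp_eqI simp: is_amp_def adjointable_amp amp_vac amp_tens blinfun.add_left tens_add)
  moreover have "amp (c *\<^sub>C K) = c *\<^sub>C amp K" if "adjointable ip K" for c K
    using that complex_vector.subspace_scale[OF F.csubspace_adjointable, of "amp K"]
    by (auto intro!: amp_eqI simp: is_amp_def adjointable_amp amp_vac amp_tens scaleC_blinfun.rep_eq tens_scaleC)
  moreover have "amp (adj ip K) = adj ipF (amp K)" if K: "adjointable ip K" for K
  proof (rule amp_eqI, unfold is_amp_def, intro conjI allI)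
    show "adjointable ipF (adj ipF (amp K))" using K by (simp add: adjointable_amp)
    show "adj ipF (amp K) (vac a) = 0" for a
      by (rule fock_eqI) (simp_all add: F.ip_adj_right adjointable_amp K amp_vac amp_tens ip_gen)
    show "adj ipF (amp K) (tens (e # es)) = tens (adj ip K e # es)" for e es
      by (rule fock_eqI)
        (simp_all add: F.ip_adj_right adjointable_amp K amp_vac amp_tens ip_gen ip_adj_right)
  qed
  ultimately show ?thesis by (simp add: star_hom_on_def)
qed

text \<open>The left action splits into degrees at least 1 and the vacuum. For \<open>a\<close> in
  \<open>J_ideal\<close> the first part is \<open>psi1 (\<phi> a)\<close>, so the covariance
  relation asks that the second part vanish.\<close>

lemma left_op_eq: "left_op a = amp (\<phi> a) + vac_op a"
  unfolding left_op_def
proof (rule the_equality)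
  have "adjointable ipF (amp (\<phi> a) + vac_op a)"
    using complex_vector.subspace_add[OF F.csubspace_adjointable, of "amp (\<phi> a)" "vac_op a"]
    by (simp add: adjointable_amp phi_adjointable)
  then show *: "adjointable ipF (amp (\<phi> a) + vac_op a) \<and>
    (\<forall>b. (amp (\<phi> a) + vac_op a) (vac b) = vac (a * b)) \<and>
    (\<forall>e es. (amp (\<phi> a) + vac_op a) (tens (e # es)) = tens (\<phi> a e # es))"
    by (simp add: blinfun.add_left amp_vac amp_tens phi_adjointable)
  fix L :: "'f \<Rightarrow>\<^sub>L 'f"
  assume "adjointable ipF L \<and> (\<forall>b. L (vac b) = vac (a * b)) \<and>
    (\<forall>e es. L (tens (e # es)) = tens (\<phi> a e # es))"
  with * show "L = amp (\<phi> a) + vac_op a" by (intro op_eqI) auto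
qed

lemma adjointable_left_op [simp]: "adjointable ipF (left_op a)"
  unfolding left_op_eq
  using complex_vector.subspace_add[OF F.csubspace_adjointable, of "amp (\<phi> a)" "vac_op a"]
  by (simp add: adjointable_amp phi_adjointable)

lemma left_op_vac [simp]: "left_op a (vac b) = vac (a * b)"
  and left_op_tens [simp]: "left_op a (tens (e # es)) = tens (\<phi> a e # es)"
  by (simp_all add: left_op_eq blinfun.add_left amp_vac amp_tens phi_adjointable)

lemma left_op_one: "left_op 1 = id_blinfun"
  by (rule op_eqI) (simp_all add: phi_one)

lemma left_op_star_hom: "star_hom_on UNIV (*) star (o\<^sub>L) (adj ipF) left_op"
proof -
  have "left_op (a + b) = left_op a + left_op b" for a b
    using complex_vector.subspace_add[OF F.csubspace_adjointable, of "left_op a" "left_op b"]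
    by (intro op_eqI) (simp_all add: blinfun.add_left phi_add tens_add vac_add distrib_right)
  moreover have "left_op (a * b) = left_op a o\<^sub>L left_op b" for a b
    by (intro op_eqI) (simp_all add: phi_mult mult.assoc)
  moreover have "left_op (c *\<^sub>C a) = c *\<^sub>C left_op a" for c a
    using complex_vector.subspace_scale[OF F.csubspace_adjointable, of "left_op a"]
    by (intro op_eqI) (simp_all add: scaleC_blinfun.rep_eq phi_scaleC tens_scaleC vac_scaleC scaleC_mult_left)
  moreover have "left_op (star a) = adj ipF (left_op a)" for a
    using amp_star_hom by (simp add: left_op_eq F.adj_add adjointable_amp phi_adjointable adj_vac_op
        phi_star star_hom_on_def)
  ultimately show ?thesis by (simp add: star_hom_on_def)
qed

section \<open>Creation and annihilation operators\<close>

fun annihilate :: "'e \<Rightarrow> 'a + 'e list \<Rightarrow> 'f" where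
  "annihilate e (Inr [f]) = vac (ip e f)"
| "annihilate e (Inr (f # f' # fs)) = tens (\<phi> (ip e f) f' # fs)"
| "annihilate e _ = 0"

lemma creation_exists:
  "\<exists>T. adjointable ipF T \<and> (\<forall>a. blinfun_apply T (vac a) = tens [act e a]) \<and>
    (\<forall>es. es \<noteq> [] \<longrightarrow> T (tens es) = tens (e # es)) \<and>
    (\<forall>i. i \<noteq> Inr [] \<longrightarrow> adj ipF T (gen i) = annihilate e i)"
proof -
  define t where "t i = (case i of Inl a \<Rightarrow> tens [act e a] | Inr es \<Rightarrow> tens (e # es))"
    for i :: "'a + 'e list"
  have "\<exists>T. adjointable ipF T \<and> (\<forall>i. i \<noteq> Inr [] \<longrightarrow> blinfun_apply T (gen i) = t i \<and>
      adj ipF T (gen i) = annihilate e i)"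
  proof (rule op_exists)
    \<comment> \<open>The adjoint of \<open>creation e\<close> times \<open>creation e\<close> is
      the left action of \<open>ip e e\<close>, which has already been constructed; it supplies the
      bound.\<close>
    show "adjointable ipF (left_op (ip e e))" by simp
    fix i j :: "'a + 'e list" assume ij: "i \<noteq> Inr []" "j \<noteq> Inr []"
    show "ipF (t i) (t j) = ipF (gen i) (left_op (ip e e) (gen j))"
      by (rule gen_cases[OF ij(1)]; rule gen_cases[OF ij(2)])
        (auto simp: t_def ip_gen ip_act_left ip_act_right mult.assoc)
    show "ipF (annihilate e i) (gen j) = ipF (gen i) (t j)"
    proof (rule gen_cases[OF ij(1)])
      fix a assume "i = Inl a" "gen i = vac a"
      then show ?thesis by (cases j) (auto simp: t_def ip_gen)
    next
      fix f fs assume i: "i = Inr (f # fs)" "gen i = tens (f # fs)"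
      show ?thesis
        by (cases fs; rule gen_cases[OF ij(2)])
          (auto simp: i t_def gen_def ip_gen ip_star ip_act_right ip_phi)
    qed
  qed
  then obtain T where T: "adjointable ipF T" "\<And>i. i \<noteq> Inr [] \<Longrightarrow> blinfun_apply T (gen i) = t i"
    "\<And>i. i \<noteq> Inr [] \<Longrightarrow> adj ipF T (gen i) = annihilate e i" by blast
  have "T (vac a) = tens [act e a]" for a
    using T(2)[of "Inl a"] by (simp add: gen_def t_def)
  moreover have "T (tens es) = tens (e # es)" if "es \<noteq> []" for es
    using T(2)[of "Inr es"] that by (simp add: gen_def t_def)
  ultimately show ?thesis using T(1,3) by blast
qed

lemma creation:
  shows adjointable_creation [simp]: "adjointable ipF (creation e)"
    and creation_vac [simp]: "creation e (vac a) = tens [act e a]"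
    and creation_tens [simp]: "creation e (tens (f # fs)) = tens (e # f # fs)"
    and adj_creation: "i \<noteq> Inr [] \<Longrightarrow> adj ipF (creation e) (gen i) = annihilate e i"
proof -
  obtain T where T: "adjointable ipF T" "\<And>a. blinfun_apply T (vac a) = tens [act e a]"
    "\<And>es. es \<noteq> [] \<Longrightarrow> T (tens es) = tens (e # es)"
    "\<And>i. i \<noteq> Inr [] \<Longrightarrow> adj ipF T (gen i) = annihilate e i"
    using creation_exists[of e] by blast
  have "creation e = T"
    unfolding creation_def by (rule the_equality) (use T in \<open>auto intro!: op_eqI\<close>)
  with T show "adjointable ipF (creation e)" "creation e (vac a) = tens [act e a]"
    "creation e (tens (f # fs)) = tens (e # f # fs)"
    "i \<noteq> Inr [] \<Longrightarrow> adj ipF (creation e) (gen i) = annihilate e i" by auto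
qed

lemma adj_creation_vac [simp]: "adj ipF (creation e) (vac a) = 0"
  and adj_creation_tens1 [simp]: "adj ipF (creation e) (tens [f]) = vac (ip e f)"
  and adj_creation_tens2 [simp]:
    "adj ipF (creation e) (tens (f # f' # fs)) = tens (\<phi> (ip e f) f' # fs)"
  using adj_creation[of "Inl a" e] adj_creation[of "Inr [f]" e] adj_creation[of "Inr (f # f' # fs)" e]
  by (simp_all add: gen_def)

lemma left_op_creation: "left_op a o\<^sub>L creation e = creation (\<phi> a e)"
  by (rule op_eqI) (simp_all add: adjointable_act_apply phi_adjointable)

lemma adj_creation_creation: "adj ipF (creation e) o\<^sub>L creation f = left_op (ip e f)"
proof (rule op_eqI)
  show "(adj ipF (creation e) o\<^sub>L creation f) (vac a) = left_op (ip e f) (vac a)" for a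
    by (simp add: ip_act_right)
qed simp_all

text \<open>This identifies \<open>amp\<close> with \<open>psi1\<close> on rank one operators. The
  coefficient that annihilation puts on the next letter is moved back to \<open>e\<close> by
  balancedness.\<close>

lemma amp_ketbra: "amp (ketbra act ip e f) = creation e o\<^sub>L adj ipF (creation f)"
proof (rule amp_eqI, unfold is_amp_def, intro conjI allI)
  show "(creation e o\<^sub>L adj ipF (creation f)) (tens (g # gs)) = tens (ketbra act ip e f g # gs)" for g gs
    by (cases gs) (simp_all add: tens_balanced)
qed simp_all


subsection \<open>The gauge unitaries\<close>

text \<open>Tensors of different length are orthogonal and those of equal length receive the same
  factor of modulus 1, so the Gram matrix is unchanged.\<close>

lemma gauge_op_exists:
  assumes z: "cmod z = 1"
  shows "\<exists>U. adjointable ipF U \<and> (\<forall>a. blinfun_apply U (vac a) = vac a) \<and>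
    (\<forall>e es. U (tens (e # es)) = z ^ length (e # es) *\<^sub>C tens (e # es)) \<and>
    (\<forall>a. adj ipF U (vac a) = vac a) \<and>
    (\<forall>e es. adj ipF U (tens (e # es)) = cnj z ^ length (e # es) *\<^sub>C tens (e # es))"
proof -
  define t where "t z i = (case i of Inl a \<Rightarrow> vac a | Inr es \<Rightarrow> z ^ length es *\<^sub>C tens es)"
    for z and i :: "'a + 'e list"
  have pw: "z ^ n * cnj z ^ n = 1" "cnj z ^ n * z ^ n = 1" for n
    using cnj_mult_self[OF z] by (simp_all flip: power_mult_distrib)
  have len: "ipF (tens (e # es)) (tens (f # fs)) = 0" if "length es \<noteq> length fs" for e es f fs
    using that by (simp add: ip_gen tail_ip_length)
  have "\<exists>U. adjointable ipF U \<and> (\<forall>i. i \<noteq> Inr [] \<longrightarrow> blinfun_apply U (gen i) = t z i \<and>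
      adj ipF U (gen i) = t (cnj z) i)"
  proof (rule op_exists[OF F.adjointable_id])
    fix i j :: "'a + 'e list" assume ij: "i \<noteq> Inr []" "j \<noteq> Inr []"
    show "ipF (t z i) (t z j) = ipF (gen i) (id_blinfun (gen j))"
    proof (rule gen_cases[OF ij(1)]; rule gen_cases[OF ij(2)])
      fix e es f fs assume "i = Inr (e # es)" "gen i = tens (e # es)" "j = Inr (f # fs)" "gen j = tens (f # fs)"
      then show ?thesis using len[of es fs e f] pw[of "Suc (length es)"]
        by (cases "length es = length fs") (auto simp: t_def F.ip_scaleC_left F.ip_scaleC_right simp del: power_Suc)
    qed (auto simp: t_def F.ip_scaleC_left F.ip_scaleC_right ip_gen)
    show "ipF (t (cnj z) i) (gen j) = ipF (gen i) (t z j)"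
    proof (rule gen_cases[OF ij(1)]; rule gen_cases[OF ij(2)])
      fix e es f fs assume "i = Inr (e # es)" "gen i = tens (e # es)" "j = Inr (f # fs)" "gen j = tens (f # fs)"
      then show ?thesis using len[of es fs e f]
        by (cases "length es = length fs") (auto simp: t_def F.ip_scaleC_left F.ip_scaleC_right)
    qed (auto simp: t_def F.ip_scaleC_left F.ip_scaleC_right ip_gen)
  qed
  then obtain U where U: "adjointable ipF U" "\<And>i. i \<noteq> Inr [] \<Longrightarrow> blinfun_apply U (gen i) = t z i"
    "\<And>i. i \<noteq> Inr [] \<Longrightarrow> adj ipF U (gen i) = t (cnj z) i" by blast
  show ?thesis
    using U(2)[of "Inl _"] U(2)[of "Inr (_ # _)"] U(3)[of "Inl _"] U(3)[of "Inr (_ # _)"]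
    by (intro exI[of _ U]) (auto simp: U(1) gen_def t_def)
qed

definition gauge_op :: "complex \<Rightarrow> 'f \<Rightarrow>\<^sub>L 'f" where
  "gauge_op z = (SOME U. adjointable ipF U \<and> (\<forall>a. blinfun_apply U (vac a) = vac a) \<and>
    (\<forall>e es. U (tens (e # es)) = z ^ length (e # es) *\<^sub>C tens (e # es)) \<and>
    (\<forall>a. adj ipF U (vac a) = vac a) \<and>
    (\<forall>e es. adj ipF U (tens (e # es)) = cnj z ^ length (e # es) *\<^sub>C tens (e # es)))"

lemma gauge_op:
  assumes "cmod z = 1"
  shows adjointable_gauge_op: "adjointable ipF (gauge_op z)"
    and gauge_op_vac: "gauge_op z (vac a) = vac a"
    and gauge_op_tens: "gauge_op z (tens (e # es)) = z ^ length (e # es) *\<^sub>C tens (e # es)"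
    and adj_gauge_op_vac: "adj ipF (gauge_op z) (vac a) = vac a"
    and adj_gauge_op_tens:
      "adj ipF (gauge_op z) (tens (e # es)) = cnj z ^ length (e # es) *\<^sub>C tens (e # es)"
  using someI_ex[OF gauge_op_exists[OF assms]] unfolding gauge_op_def[symmetric] by blast+

lemma adj_gauge_op: "cmod z = 1 \<Longrightarrow> adj ipF (gauge_op z) = gauge_op (cnj z)"
  by (rule op_eqI) (simp_all add: gauge_op)

lemma gauge_op_unitary:
  assumes z: "cmod z = 1"
  shows "gauge_op z o\<^sub>L adj ipF (gauge_op z) = id_blinfun"
    and "adj ipF (gauge_op z) o\<^sub>L gauge_op z = id_blinfun"
proof -
  have pw: "z ^ n * cnj z ^ n = 1" "cnj z ^ n * z ^ n = 1" for n
    using cnj_mult_self[OF z] by (simp_all flip: power_mult_distrib)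
  show "gauge_op z o\<^sub>L adj ipF (gauge_op z) = id_blinfun"
    and "adj ipF (gauge_op z) o\<^sub>L gauge_op z = id_blinfun"
    by (rule op_eqI; simp add: gauge_op z F.adjointable_scaleC_apply pw del: power_Suc list.size)+
qed

lemma gauge_op_left_op: "cmod z = 1 \<Longrightarrow> gauge_op z o\<^sub>L left_op a = left_op a o\<^sub>L gauge_op z"
  by (rule op_eqI) (simp_all add: gauge_op F.adjointable_scaleC_apply)

lemma gauge_op_vac_op: "cmod z = 1 \<Longrightarrow> gauge_op z o\<^sub>L vac_op a = vac_op a o\<^sub>L gauge_op z"
  by (rule op_eqI) (simp_all add: gauge_op F.adjointable_scaleC_apply)

lemma gauge_op_creation:
  "cmod z = 1 \<Longrightarrow> gauge_op z o\<^sub>L creation e = z *\<^sub>C (creation e o\<^sub>L gauge_op z)"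
  using complex_vector.subspace_scale[OF F.csubspace_adjointable, of "creation e o\<^sub>L gauge_op z" z]
  by (intro op_eqI) (simp_all add: gauge_op F.adjointable_scaleC_apply scaleC_blinfun.rep_eq)

end


section \<open>Toeplitz algebra and covariance ideal\<close>

lemma star_hom_on_subset: "star_hom_on S mul st mul' st' h \<Longrightarrow> S' \<subseteq> S \<Longrightarrow> star_hom_on S' mul st mul' st' h"
  unfolding star_hom_on_def by blast

lemma star_hom_onD:
  assumes "star_hom_on S mul st mul' st' h"
  shows "x \<in> S \<Longrightarrow> y \<in> S \<Longrightarrow> h (x + y) = h x + h y"
    and "x \<in> S \<Longrightarrow> y \<in> S \<Longrightarrow> h (mul x y) = mul' (h x) (h y)"
    and "x \<in> S \<Longrightarrow> h (c *\<^sub>C x) = c *\<^sub>C h x"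
    and "x \<in> S \<Longrightarrow> h (st x) = st' (h x)"
  using assms unfolding star_hom_on_def by blast+

lemma star_hom_on_compose:
  assumes h: "star_hom_on S mul st mul' st' h" and S': "h ` S \<subseteq> S'"
    and g: "star_hom_on S' mul' st' mul'' st'' g"
  shows "star_hom_on S mul st mul'' st'' (\<lambda>x. g (h x))"
proof -
  have "h x \<in> S'" if "x \<in> S" for x using S' that by blast
  then show ?thesis
    unfolding star_hom_on_def[of S] by (simp add: star_hom_onD[OF h] star_hom_onD[OF g])
qed

context fock_module
begin

lemma cstar_subalgebra_toeplitz: "cstar_subalgebra ipF toeplitz_algebra"
  unfolding toeplitz_algebra_def hull_def
proof (rule F.cstar_subalgebra_Inter)
  \<comment> \<open>The hull is an intersection, so some C*-subalgebra has to contain the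
    generators: the algebra of all adjointable operators does.\<close>
  have "range left_op \<union> range creation \<subseteq> Collect (adjointable ipF)" by auto
  then show "{t. cstar_subalgebra ipF t \<and> range left_op \<union> range creation \<subseteq> t} \<noteq> {}"
    using F.cstar_subalgebra_adjointable by blast
qed simp

lemma star_algebra_toeplitz: "star_algebra_on toeplitz_algebra (o\<^sub>L) (adj ipF)"
  by (rule F.cstar_subalgebra_star_algebra[OF cstar_subalgebra_toeplitz])

sublocale T: star_algebra_on toeplitz_algebra "(o\<^sub>L)" "adj ipF"
  by (rule star_algebra_toeplitz)

lemma left_op_toeplitz: "left_op a \<in> toeplitz_algebra"
  and creation_toeplitz: "creation e \<in> toeplitz_algebra"
  using hull_subset[of "range left_op \<union> range creation" "cstar_subalgebra ipF"]
  unfolding toeplitz_algebra_def by auto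

lemma toeplitz_adjointable: "X \<in> toeplitz_algebra \<Longrightarrow> adjointable ipF X"
  using cstar_subalgebra_toeplitz by (auto simp: cstar_subalgebra_def)

lemma toeplitz_induct:
  assumes "X \<in> toeplitz_algebra" "cstar_subalgebra ipF S"
    "\<And>a. left_op a \<in> S" "\<And>e. creation e \<in> S"
  shows "X \<in> S"
  using hull_minimal[of "range left_op \<union> range creation" S "cstar_subalgebra ipF"] assms
  unfolding toeplitz_algebra_def by blast

lemma id_toeplitz: "id_blinfun \<in> toeplitz_algebra"
  using left_op_toeplitz[of 1] by (simp add: left_op_one)

lemma amp_bounded: "\<exists>C. \<forall>K\<in>Collect (adjointable ip). norm (amp K) \<le> C * norm K"
  by (rule F.star_hom_adjointable_bounded[OF star_algebra_adjointable amp_star_hom])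
    (auto simp: adjointable_amp)

lemma amp_compact_bounded: "\<exists>C. \<forall>K\<in>compact_ops act ip. norm (amp K) \<le> C * norm K"
  using amp_bounded compact_adjointable by blast

lemma amp_compact_star_hom: "star_hom_on (compact_ops act ip) (o\<^sub>L) (adj ip) (o\<^sub>L) (adj ipF) amp"
  by (rule star_hom_on_subset[OF amp_star_hom]) (auto simp: compact_adjointable)

lemma amp_toeplitz:
  assumes K: "K \<in> compact_ops act ip"
  shows "amp K \<in> toeplitz_algebra"
proof -
  interpret C: star_algebra_on "compact_ops act ip" "(o\<^sub>L)" "adj ip" by (rule star_algebra_compact)
  have "K \<in> {K \<in> compact_ops act ip. amp K \<in> toeplitz_algebra}" using K
  proof (induction rule: compact_ops_induct)
    case (base e f)
    then show ?case
      by (simp add: ketbra_compact amp_ketbra T.mul_closed T.st_closed creation_toeplitz)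
  next
    case subspace
    show ?case by (rule C.csubspace_star_hom_vimage[OF amp_compact_star_hom T.subspace])
  next
    case closed
    show ?case by (rule C.closed_star_hom_vimage[OF amp_compact_star_hom amp_compact_bounded T.closed])
  qed
  then show ?thesis by simp
qed

text \<open>\<open>amp\<close> is a witness for the choice in \<open>psi1\<close>. Two such
  homomorphisms agree on the rank one operators and are automatically bounded, hence agree on the
  closed span.\<close>

lemma psi1_eq_amp:
  assumes K: "K \<in> compact_ops act ip"
  shows "psi1 K = amp K"
proof -
  interpret C: star_algebra_on "compact_ops act ip" "(o\<^sub>L)" "adj ip" by (rule star_algebra_compact)
  let ?P = "\<lambda>h. star_hom_on (compact_ops act ip) (o\<^sub>L) (adj ip) (o\<^sub>L) (adj ipF) h \<and>
     h ` compact_ops act ip \<subseteq> toeplitz_algebra \<and>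
     (\<forall>e f. h (ketbra act ip e f) = creation e o\<^sub>L adj ipF (creation f))"
  have "?P amp"
    by (intro conjI allI amp_compact_star_hom amp_ketbra) (use amp_toeplitz in blast)
  then have "?P psi1" unfolding psi1_def by (rule someI[of ?P])
  then have psi: "star_hom_on (compact_ops act ip) (o\<^sub>L) (adj ip) (o\<^sub>L) (adj ipF) psi1"
    and sub: "psi1 ` compact_ops act ip \<subseteq> toeplitz_algebra"
    and ketbra: "\<And>e f. psi1 (ketbra act ip e f) = creation e o\<^sub>L adj ipF (creation f)"
    by simp_all
  have bound: "\<exists>C. \<forall>K\<in>compact_ops act ip. norm (psi1 K) \<le> C * norm K"
    by (rule F.star_hom_adjointable_bounded[OF star_algebra_compact psi])
      (use sub toeplitz_adjointable in auto)
  have "K \<in> {K \<in> compact_ops act ip. psi1 K = amp K}" using K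
  proof (induction rule: compact_ops_induct)
    case (base e f)
    then show ?case by (simp add: ketbra_compact amp_ketbra ketbra)
  next
    case subspace
    show ?case by (rule C.csubspace_star_hom_equalizer[OF psi amp_compact_star_hom])
  next
    case closed
    show ?case
      by (rule C.closed_star_hom_equalizer[OF psi bound amp_compact_star_hom amp_compact_bounded])
  qed
  then show ?thesis by simp
qed

lemma covariance_generator: "a \<in> J_ideal \<Longrightarrow> left_op a - psi1 (\<phi> a) = vac_op a"
  by (simp add: J_ideal_def psi1_eq_amp left_op_eq)

lemma covariance_ideal_eq:
  "covariance_ideal = closed_two_sided_ideal toeplitz_algebra hull (vac_op ` J_ideal)"
proof -
  have "{left_op a - psi1 (\<phi> a) |a. a \<in> J_ideal} = (\<lambda>a. left_op a - psi1 (\<phi> a)) ` J_ideal" by blast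
  also have "\<dots> = vac_op ` J_ideal" by (rule image_cong[OF refl covariance_generator])
  finally have "{left_op a - psi1 (\<phi> a) |a. a \<in> J_ideal} = vac_op ` J_ideal" .
  then show ?thesis by (simp add: covariance_ideal_def)
qed

lemma vac_op_toeplitz:
  assumes a: "a \<in> J_ideal"
  shows "vac_op a \<in> toeplitz_algebra"
proof -
  have "\<phi> a \<in> compact_ops act ip" using a by (simp add: J_ideal_def)
  then have "left_op a - psi1 (\<phi> a) \<in> toeplitz_algebra"
    by (simp add: psi1_eq_amp T.diff_closed left_op_toeplitz amp_toeplitz)
  then show ?thesis by (simp only: covariance_generator[OF a])
qed

lemma closed_two_sided_ideal_covariance:
  "closed_two_sided_ideal toeplitz_algebra covariance_ideal"
proof -
  let ?\<I> = "{t. closed_two_sided_ideal toeplitz_algebra t \<and> vac_op ` J_ideal \<subseteq> t}"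
  have "toeplitz_algebra \<in> ?\<I>"
    using T.subspace T.closed T.mul_closed vac_op_toeplitz
    by (auto simp: closed_two_sided_ideal_def)
  then have "\<Inter>?\<I> \<subseteq> toeplitz_algebra" by blast
  then show ?thesis
    unfolding covariance_ideal_eq hull_def closed_two_sided_ideal_def
    by (intro conjI complex_vector.subspace_Inter closed_Inter)
      (auto simp: closed_two_sided_ideal_def)
qed

lemma vac_op_covariance: "a \<in> J_ideal \<Longrightarrow> vac_op a \<in> covariance_ideal"
  unfolding covariance_ideal_eq by (rule subsetD[OF hull_subset imageI])

lemma covariance_induct:
  assumes "X \<in> covariance_ideal" "closed_two_sided_ideal toeplitz_algebra I"
    "\<And>a. a \<in> J_ideal \<Longrightarrow> vac_op a \<in> I"
  shows "X \<in> I"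
  using hull_minimal[of "vac_op ` J_ideal" I "closed_two_sided_ideal toeplitz_algebra"] assms
  unfolding covariance_ideal_eq by blast

lemma covariance_toeplitz: "covariance_ideal \<subseteq> toeplitz_algebra"
  and csubspace_covariance: "csubspace covariance_ideal"
  and closed_covariance: "closed covariance_ideal"
  using closed_two_sided_ideal_covariance by (auto simp: closed_two_sided_ideal_def)

section \<open>The gauge action on the Toeplitz algebra\<close>

definition gauge_conj :: "complex \<Rightarrow> ('f \<Rightarrow>\<^sub>L 'f) \<Rightarrow> ('f \<Rightarrow>\<^sub>L 'f)" where
  "gauge_conj z X = gauge_op z o\<^sub>L X o\<^sub>L adj ipF (gauge_op z)"

lemma gauge_conj_apply: "gauge_conj z X x = gauge_op z (X (adj ipF (gauge_op z) x))"
  by (simp add: gauge_conj_def)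

lemma gauge_op_inverse:
  assumes "cmod z = 1"
  shows "gauge_op z (adj ipF (gauge_op z) x) = x" "adj ipF (gauge_op z) (gauge_op z x) = x"
  using gauge_op_unitary[OF assms] by (metis blinfun_apply_blinfun_compose id_blinfun.rep_eq)+

lemma gauge_conj_adjointable: "cmod z = 1 \<Longrightarrow> adjointable ipF X \<Longrightarrow> adjointable ipF (gauge_conj z X)"
  by (simp add: gauge_conj_def gauge_op)

lemma gauge_conj_eqI:
  "cmod z = 1 \<Longrightarrow> gauge_op z o\<^sub>L X = Y o\<^sub>L gauge_op z \<Longrightarrow> gauge_conj z X = Y"
  by (rule blinfun_eqI) (metis blinfun_apply_blinfun_compose gauge_conj_apply gauge_op_inverse(1))

lemma gauge_conj_left_op: "cmod z = 1 \<Longrightarrow> gauge_conj z (left_op a) = left_op a"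
  by (rule gauge_conj_eqI) (simp_all add: gauge_op_left_op)

lemma gauge_conj_vac_op: "cmod z = 1 \<Longrightarrow> gauge_conj z (vac_op a) = vac_op a"
  by (rule gauge_conj_eqI) (simp_all add: gauge_op_vac_op)

lemma gauge_conj_creation: "cmod z = 1 \<Longrightarrow> gauge_conj z (creation e) = z *\<^sub>C creation e"
  by (rule gauge_conj_eqI) (simp_all add: gauge_op_creation blinfun_compose_scaleC_left)

lemma gauge_conj_inverse:
  assumes "cmod z = 1"
  shows "gauge_conj (cnj z) (gauge_conj z X) = X"
proof -
  have "adj ipF (gauge_op (cnj z)) = gauge_op z"
    using adj_gauge_op[of "cnj z"] assms by simp
  then show ?thesis
    using gauge_op_inverse[OF assms] adj_gauge_op[OF assms]
    by (intro blinfun_eqI) (simp add: gauge_conj_apply)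
qed

lemma gauge_conj_star_hom:
  assumes z: "cmod z = 1"
  shows "star_hom_on (Collect (adjointable ipF)) (o\<^sub>L) (adj ipF) (o\<^sub>L) (adj ipF) (gauge_conj z)"
proof -
  have "gauge_conj z (X + Y) = gauge_conj z X + gauge_conj z Y" for X Y
    by (rule blinfun_eqI) (simp add: gauge_conj_apply blinfun.add_left blinfun.add_right)
  moreover have "gauge_conj z (X o\<^sub>L Y) = gauge_conj z X o\<^sub>L gauge_conj z Y" for X Y
    by (rule blinfun_eqI) (simp add: gauge_conj_apply gauge_op_inverse z)
  moreover have "gauge_conj z (c *\<^sub>C X) = c *\<^sub>C gauge_conj z X" for c X
    by (rule blinfun_eqI)
      (simp add: gauge_conj_apply scaleC_blinfun.rep_eq F.adjointable_scaleC_apply gauge_op z)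
  moreover have "gauge_conj z (adj ipF X) = adj ipF (gauge_conj z X)" if "adjointable ipF X" for X
    using that unfolding gauge_conj_def
    by (intro blinfun_eqI) (simp add: F.adj_comp F.adj_adj gauge_op z)
  ultimately show ?thesis by (simp add: star_hom_on_def)
qed

lemma gauge_conj_bounded:
  assumes "cmod z = 1"
  shows "\<exists>C. \<forall>X\<in>Collect (adjointable ipF). norm (gauge_conj z X) \<le> C * norm X"
  by (rule F.star_hom_adjointable_bounded[OF F.star_algebra_adjointable gauge_conj_star_hom[OF assms]])
    (auto simp: gauge_conj_adjointable assms)

lemma gauge_conj_toeplitz:
  assumes z: "cmod z = 1" and X: "X \<in> toeplitz_algebra"
  shows "gauge_conj z X \<in> toeplitz_algebra"
proof -
  interpret A: star_algebra_on "Collect (adjointable ipF)" "(o\<^sub>L)" "adj ipF"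
    by (rule F.star_algebra_adjointable)
  let ?S = "{X \<in> Collect (adjointable ipF). gauge_conj z X \<in> toeplitz_algebra}"
  note hom = star_hom_onD[OF gauge_conj_star_hom[OF z], symmetric]
  have "cstar_subalgebra ipF ?S"
    unfolding cstar_subalgebra_def
  proof (intro conjI ballI)
    show "csubspace ?S" by (rule A.csubspace_star_hom_vimage[OF gauge_conj_star_hom[OF z] T.subspace])
    show "closed ?S"
      by (rule A.closed_star_hom_vimage[OF gauge_conj_star_hom[OF z] gauge_conj_bounded[OF z] T.closed])
    show "adj ipF Y \<in> ?S" if "Y \<in> ?S" for Y
      using that hom(4)[of Y] T.st_closed[of "gauge_conj z Y"] by simp
    show "Y o\<^sub>L W \<in> ?S" if "Y \<in> ?S" "W \<in> ?S" for Y W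
      using that hom(2)[of Y W] T.mul_closed[of "gauge_conj z Y" "gauge_conj z W"] by simp
  qed auto
  then have "X \<in> ?S"
    by (rule toeplitz_induct[OF X])
      (simp_all add: gauge_conj_left_op gauge_conj_creation z left_op_toeplitz creation_toeplitz T.scaleC_closed)
  then show ?thesis by simp
qed

lemma gauge_conj_toeplitz_star_hom:
  "cmod z = 1 \<Longrightarrow> star_hom_on toeplitz_algebra (o\<^sub>L) (adj ipF) (o\<^sub>L) (adj ipF) (gauge_conj z)"
  by (rule star_hom_on_subset[OF gauge_conj_star_hom]) (auto simp: toeplitz_adjointable)

text \<open>The generators \<open>vac_op a\<close> preserve degrees and are fixed. The preimage of
  the ideal is again a closed ideal, since conjugation maps the Toeplitz algebra into
  itself.\<close>

lemma gauge_conj_covariance: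
  assumes z: "cmod z = 1" and X: "X \<in> covariance_ideal"
  shows "gauge_conj z X \<in> covariance_ideal"
proof -
  let ?I = "{X \<in> toeplitz_algebra. gauge_conj z X \<in> covariance_ideal}"
  have bound: "\<exists>C. \<forall>X\<in>toeplitz_algebra. norm (gauge_conj z X) \<le> C * norm X"
    using gauge_conj_bounded[OF z] toeplitz_adjointable by blast
  note hom = star_hom_onD(2)[OF gauge_conj_toeplitz_star_hom[OF z]]
  have "closed_two_sided_ideal toeplitz_algebra ?I"
    unfolding closed_two_sided_ideal_def
  proof (intro conjI ballI)
    show "csubspace ?I"
      by (rule T.csubspace_star_hom_vimage[OF gauge_conj_toeplitz_star_hom[OF z] csubspace_covariance])
    show "closed ?I"
      by (rule T.closed_star_hom_vimage[OF gauge_conj_toeplitz_star_hom[OF z] bound closed_covariance])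
    fix X Y assume XY: "X \<in> ?I" "Y \<in> toeplitz_algebra"
    then have "gauge_conj z Y \<in> toeplitz_algebra" by (simp add: gauge_conj_toeplitz z)
    then show "X o\<^sub>L Y \<in> ?I" "Y o\<^sub>L X \<in> ?I"
      using XY hom[of X Y] hom[of Y X] closed_two_sided_ideal_covariance
      by (auto simp: closed_two_sided_ideal_def T.mul_closed)
  qed auto
  then have "X \<in> ?I"
    by (rule covariance_induct[OF X])
      (simp add: vac_op_toeplitz gauge_conj_vac_op z vac_op_covariance)
  then show ?thesis by simp
qed

end


section \<open>The gauge action on the Cuntz-Pimsner algebra\<close>

context cuntz_pimsner_algebra
begin

lemma q_add: "X \<in> toeplitz_algebra \<Longrightarrow> Y \<in> toeplitz_algebra \<Longrightarrow> q (X + Y) = q X + q Y"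
  and q_mult: "X \<in> toeplitz_algebra \<Longrightarrow> Y \<in> toeplitz_algebra \<Longrightarrow> q (X o\<^sub>L Y) = q X * q Y"
  and q_scaleC: "X \<in> toeplitz_algebra \<Longrightarrow> q (c *\<^sub>C X) = c *\<^sub>C q X"
  and q_adj: "X \<in> toeplitz_algebra \<Longrightarrow> q (adj ipF X) = star (q X)"
  by (rule star_hom_onD[OF quotient_star_hom]; assumption)+

lemma q_zero: "q 0 = 0"
  using q_scaleC[OF T.zero_closed, of 0] by simp

lemma q_diff: "X \<in> toeplitz_algebra \<Longrightarrow> Y \<in> toeplitz_algebra \<Longrightarrow> q (X - Y) = q X - q Y"
  using q_add[of X "(-1) *\<^sub>C Y"] q_scaleC[of Y "-1"] T.scaleC_closed[of Y "-1"] by simp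

lemma q_sum: "(\<And>i. i \<in> I \<Longrightarrow> X i \<in> toeplitz_algebra) \<Longrightarrow> q (\<Sum>i\<in>I. X i) = (\<Sum>i\<in>I. q (X i))"
  and sum_toeplitz: "(\<And>i. i \<in> I \<Longrightarrow> X i \<in> toeplitz_algebra) \<Longrightarrow> (\<Sum>i\<in>I. X i) \<in> toeplitz_algebra"
proof -
  assume X: "\<And>i. i \<in> I \<Longrightarrow> X i \<in> toeplitz_algebra"
  have *: "J \<subseteq> I \<Longrightarrow> (\<Sum>i\<in>J. X i) \<in> toeplitz_algebra \<and> q (\<Sum>i\<in>J. X i) = (\<Sum>i\<in>J. q (X i))" for J
    by (induction J rule: infinite_finite_induct)
      (use X in \<open>auto simp: q_zero T.zero_closed q_add T.add_closed\<close>)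
  show "q (\<Sum>i\<in>I. X i) = (\<Sum>i\<in>I. q (X i))" "(\<Sum>i\<in>I. X i) \<in> toeplitz_algebra"
    using *[of I] by blast+
qed

lemma q_surj: obtains X where "X \<in> toeplitz_algebra" "q X = b"
  using quotient_surj by (metis UNIV_I imageE)

lemma q_covariance: "X \<in> covariance_ideal \<Longrightarrow> q X = 0"
  using quotient_norm[of X] covariance_toeplitz by auto

lemma q_eq_0D: "X \<in> toeplitz_algebra \<Longrightarrow> q X = 0 \<Longrightarrow> X \<in> covariance_ideal"
  using quotient_norm[of X] complex_vector.subspace_0[OF csubspace_covariance]
    in_closed_iff_infdist_zero[OF closed_covariance, of X] by auto

text \<open>Preservation of units is not part of \<open>star_hom_on\<close>. Surjectivity makes
  \<open>q id_blinfun\<close> a left unit, hence 1.\<close>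

lemma q_id: "q id_blinfun = 1"
proof -
  have "q id_blinfun * b = b" for b
  proof -
    obtain X where X: "X \<in> toeplitz_algebra" "q X = b" by (rule q_surj)
    have "id_blinfun o\<^sub>L X = X" by (rule blinfun_eqI) simp
    then show ?thesis using q_mult[OF id_toeplitz X(1)] X(2) by simp
  qed
  from this[of 1] show ?thesis by simp
qed

definition gauge_aut :: "complex \<Rightarrow> 'b \<Rightarrow> 'b" where
  "gauge_aut z b = q (gauge_conj z (SOME X. X \<in> toeplitz_algebra \<and> q X = b))"

text \<open>Two preimages differ by an element of the covariance ideal, which is gauge invariant; so
  any preimage may replace the chosen one.\<close>

lemma gauge_aut_q:
  assumes z: "cmod z = 1" and X: "X \<in> toeplitz_algebra"
  shows "gauge_aut z (q X) = q (gauge_conj z X)"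
proof -
  define Y where "Y = (SOME Y. Y \<in> toeplitz_algebra \<and> q Y = q X)"
  have Y: "Y \<in> toeplitz_algebra" "q Y = q X"
    using someI[of "\<lambda>Y. Y \<in> toeplitz_algebra \<and> q Y = q X" X] X by (auto simp: Y_def)
  have hom: "star_hom_on toeplitz_algebra (o\<^sub>L) (adj ipF) (*) star (\<lambda>X. q (gauge_conj z X))"
    by (rule star_hom_on_compose[OF gauge_conj_toeplitz_star_hom[OF z] _ quotient_star_hom])
      (use gauge_conj_toeplitz[OF z] in auto)
  have "Y - X \<in> covariance_ideal" using X Y by (intro q_eq_0D) (auto simp: q_diff T.diff_closed)
  then have "q (gauge_conj z (Y - X)) = 0" by (intro q_covariance gauge_conj_covariance z)
  moreover have "q (gauge_conj z (Y - X)) = q (gauge_conj z Y) - q (gauge_conj z X)"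
    using star_hom_onD(1)[OF hom Y(1) T.scaleC_closed[OF X, of "-1"]] star_hom_onD(3)[OF hom X, of "-1"]
    by simp
  ultimately show ?thesis by (simp add: gauge_aut_def Y_def)
qed

lemma gauge_aut_star_hom:
  assumes z: "cmod z = 1"
  shows "star_hom_on UNIV (*) star (*) star (gauge_aut z)"
proof -
  note G = gauge_conj_toeplitz[OF z] and H = star_hom_onD[OF gauge_conj_toeplitz_star_hom[OF z]]
  have "gauge_aut z (b + c) = gauge_aut z b + gauge_aut z c" "gauge_aut z (b * c) = gauge_aut z b * gauge_aut z c"
    "gauge_aut z (w *\<^sub>C b) = w *\<^sub>C gauge_aut z b" "gauge_aut z (star b) = star (gauge_aut z b)" for b c w
  proof -
    obtain X where X: "X \<in> toeplitz_algebra" "q X = b" by (rule q_surj)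
    obtain Y where Y: "Y \<in> toeplitz_algebra" "q Y = c" by (rule q_surj)
    have "gauge_aut z (q (X + Y)) = gauge_aut z (q X) + gauge_aut z (q Y)"
      "gauge_aut z (q (X o\<^sub>L Y)) = gauge_aut z (q X) * gauge_aut z (q Y)"
      "gauge_aut z (q (w *\<^sub>C X)) = w *\<^sub>C gauge_aut z (q X)"
      "gauge_aut z (q (adj ipF X)) = star (gauge_aut z (q X))"
      using X(1) Y(1)
      by (simp_all add: gauge_aut_q z H T.add_closed T.mul_closed T.scaleC_closed T.st_closed)
        (simp_all add: G q_add q_mult q_scaleC q_adj)
    then show "gauge_aut z (b + c) = gauge_aut z b + gauge_aut z c" "gauge_aut z (b * c) = gauge_aut z b * gauge_aut z c"
      "gauge_aut z (w *\<^sub>C b) = w *\<^sub>C gauge_aut z b" "gauge_aut z (star b) = star (gauge_aut z b)"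
      using X Y by (simp_all add: q_add q_mult q_scaleC q_adj)
  qed
  then show ?thesis by (simp add: star_hom_on_def)
qed

lemma gauge_aut_inverse: "cmod z = 1 \<Longrightarrow> gauge_aut (cnj z) (gauge_aut z b) = b"
  by (rule q_surj[of b]) (auto simp: gauge_aut_q gauge_conj_toeplitz gauge_conj_inverse)

text \<open>A competitor \<open>h\<close> in the description of \<open>gauge\<close> is not assumed
  continuous. Automatic continuity after composition with \<open>q\<close> makes the set of
  agreement closed, hence a C*-subalgebra of the Toeplitz algebra containing all generators.\<close>

lemma gauge_eq_aut:
  assumes z: "cmod z = 1"
  shows "gauge z = gauge_aut z"
  unfolding gauge_def
proof (rule the_equality)
  have "bij (gauge_aut z)"
    using gauge_aut_inverse[OF z] gauge_aut_inverse[of "cnj z"] z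
    by (intro o_bij[of "gauge_aut (cnj z)"]) (auto simp: fun_eq_iff)
  moreover have "gauge_aut z (q (left_op a)) = q (left_op a)" for a
    by (simp add: gauge_aut_q z left_op_toeplitz gauge_conj_left_op)
  moreover have "gauge_aut z (q (creation e)) = z *\<^sub>C q (creation e)" for e
    by (simp add: gauge_aut_q z creation_toeplitz gauge_conj_creation q_scaleC)
  ultimately show *: "star_hom_on UNIV (*) star (*) star (gauge_aut z) \<and> bij (gauge_aut z) \<and>
     (\<forall>a. gauge_aut z (q (left_op a)) = q (left_op a)) \<and>
     (\<forall>e. gauge_aut z (q (creation e)) = z *\<^sub>C q (creation e))"
    using gauge_aut_star_hom[OF z] by blast
  fix h assume h: "star_hom_on UNIV (*) star (*) star h \<and> bij h \<and>
     (\<forall>a. h (q (left_op a)) = q (left_op a)) \<and> (\<forall>e. h (q (creation e)) = z *\<^sub>C q (creation e))"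
  have comp: "star_hom_on toeplitz_algebra (o\<^sub>L) (adj ipF) (*) star (\<lambda>X. g (q X))"
    if "star_hom_on UNIV (*) star (*) star g" for g
    by (rule star_hom_on_compose[OF quotient_star_hom _ that]) simp
  note h1 = comp[OF conjunct1[OF h]] and h2 = comp[OF gauge_aut_star_hom[OF z]]
  let ?S = "{X \<in> toeplitz_algebra. h (q X) = gauge_aut z (q X)}"
  have "cstar_subalgebra ipF ?S"
    unfolding cstar_subalgebra_def
  proof (intro conjI ballI)
    show "?S \<subseteq> Collect (adjointable ipF)" using toeplitz_adjointable by auto
    show "csubspace ?S" by (rule T.csubspace_star_hom_equalizer[OF h1 h2])
    show "closed ?S"
      by (intro T.closed_star_hom_equalizer[OF h1 _ h2] star_hom_cstar_bounded[OF star_algebra_toeplitz] h1 h2)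
    show "adj ipF X \<in> ?S" if "X \<in> ?S" for X
      using that star_hom_onD(4)[OF h1, of X] star_hom_onD(4)[OF h2, of X] by (simp add: T.st_closed)
    show "X o\<^sub>L Y \<in> ?S" if "X \<in> ?S" "Y \<in> ?S" for X Y
      using that star_hom_onD(2)[OF h1, of X Y] star_hom_onD(2)[OF h2, of X Y] by (simp add: T.mul_closed)
  qed
  then have S: "X \<in> ?S" if "X \<in> toeplitz_algebra" for X
    by (rule toeplitz_induct[OF that]) (use h * in \<open>auto simp: left_op_toeplitz creation_toeplitz\<close>)
  show "h = gauge_aut z"
  proof
    fix b
    obtain X where "X \<in> toeplitz_algebra" "q X = b" by (rule q_surj)
    then show "h b = gauge_aut z b" using S by auto
  qed
qed

lemma gauge_q: "cmod z = 1 \<Longrightarrow> X \<in> toeplitz_algebra \<Longrightarrow> gauge z (q X) = q (gauge_conj z X)"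
  by (simp add: gauge_eq_aut gauge_aut_q)

lemma gauge_star_hom: "cmod z = 1 \<Longrightarrow> star_hom_on UNIV (*) star (*) star (gauge z)"
  by (simp add: gauge_eq_aut gauge_aut_star_hom)

end


section \<open>The ideals \<open>J\<^sub>E\<close> and \<open>I\<^sub>n\<close>\<close>

context unital_correspondence
begin

lemma phi_zero: "\<phi> 0 = 0"
  using phi_scaleC[of 0 0] by simp

lemma csubspace_J_ideal: "csubspace J_ideal"
  unfolding J_ideal_def
  by (rule complex_vector.subspaceI)
    (auto simp: phi_zero phi_add phi_scaleC distrib_left distrib_right scaleC_mult_left scaleC_mult_right
      complex_vector.subspace_0[OF csubspace_compact] complex_vector.subspace_add[OF csubspace_compact]
      complex_vector.subspace_scale[OF csubspace_compact])

lemma phi_mult_eq_0: "\<phi> b = 0 \<Longrightarrow> \<phi> (a * b) = 0 \<and> \<phi> (b * a) = 0"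
  by (simp add: phi_mult bounded_bilinear.zero_left[OF bounded_bilinear_blinfun_compose]
      bounded_bilinear.zero_right[OF bounded_bilinear_blinfun_compose])

lemma J_ideal_mult:
  assumes a: "a \<in> J_ideal"
  shows "a * b \<in> J_ideal" "b * a \<in> J_ideal"
proof -
  have K: "\<phi> a \<in> compact_ops act ip" and ann: "\<And>c. \<phi> c = 0 \<Longrightarrow> a * c = 0 \<and> c * a = 0"
    using a by (auto simp: J_ideal_def)
  have "\<phi> (a * b) \<in> compact_ops act ip" "\<phi> (b * a) \<in> compact_ops act ip"
    using compact_comp[OF K phi_adjointable] by (simp_all add: phi_mult)
  \<comment> \<open>\<open>b * c\<close> and \<open>c * b\<close> are again in the kernel of
    \<open>\<phi>\<close>, so \<open>a\<close> annihilates them.\<close>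
  moreover have "a * b * c = 0 \<and> c * (a * b) = 0" "b * a * c = 0 \<and> c * (b * a) = 0" if c: "\<phi> c = 0" for c
  proof -
    have "a * (b * c) = 0" "(c * b) * a = 0" "a * c = 0" "c * a = 0"
      using ann phi_mult_eq_0[OF c] c by blast+
    then show "a * b * c = 0 \<and> c * (a * b) = 0" "b * a * c = 0 \<and> c * (b * a) = 0"
      by (metis mult.assoc mult_zero_left mult_zero_right)+
  qed
  ultimately show "a * b \<in> J_ideal" "b * a \<in> J_ideal" unfolding J_ideal_def by blast+
qed

lemma csubspace_closure_J: "csubspace (closure J_ideal)"
  by (rule closure_csubspace[OF csubspace_J_ideal])

lemma closure_J_mult:
  assumes "a \<in> closure J_ideal"
  shows "b * a * c \<in> closure J_ideal"
proof -
  have "closure J_ideal \<subseteq> (\<lambda>a. b * a * c) -` closure J_ideal"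
  proof (rule closure_minimal)
    show "J_ideal \<subseteq> (\<lambda>a. b * a * c) -` closure J_ideal"
      using closure_subset[of J_ideal] by (auto intro: J_ideal_mult)
    show "closed ((\<lambda>a. b * a * c) -` closure J_ideal)"
      by (rule closed_vimage) (auto intro!: continuous_intros)
  qed
  then show ?thesis using assms by auto
qed

text \<open>The summand in \<open>closure J_ideal\<close> is replaced by one in
  \<open>J_ideal\<close> at the cost of \<open>e / 2\<close>. Once 1 is in the closure of the sum,
  right multiplication reaches every element.\<close>

lemma closure_sum_eq_UNIV:
  assumes "\<And>e. e > 0 \<Longrightarrow> \<exists>x\<in>closure J_ideal. \<exists>y\<in>I_ideal n. norm (1 - (x + y)) \<le> e"
  shows "closure {x + y |x y. x \<in> J_ideal \<and> y \<in> I_ideal n} = UNIV"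
proof -
  let ?Z = "{x + y |x y. x \<in> J_ideal \<and> y \<in> I_ideal n}"
  have one: "1 \<in> closure ?Z"
    unfolding closure_approachable
  proof (intro allI impI)
    fix e :: real assume "e > 0"
    then obtain x y where xy: "x \<in> closure J_ideal" "y \<in> I_ideal n" "norm (1 - (x + y)) \<le> e / 2"
      using assms[of "e / 2"] by auto
    obtain x' where x': "x' \<in> J_ideal" "dist x' x < e / 2"
      using xy(1) \<open>e > 0\<close> unfolding closure_approachable by (metis half_gt_zero)
    have "(x' + y) - 1 = (x' - x) - (1 - (x + y))" by simp
    then have "dist (x' + y) 1 \<le> norm (x' - x) + norm (1 - (x + y))"
      unfolding dist_norm by (metis norm_triangle_ineq4)
    also have "\<dots> < e" using xy x' by (simp add: dist_norm)
    finally show "\<exists>z\<in>?Z. dist z 1 < e" using xy(2) x'(1) by blast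
  qed
  have "a \<in> closure ?Z" for a
  proof -
    have "closure ?Z \<subseteq> (\<lambda>x. x * a) -` closure ?Z"
    proof (rule closure_minimal)
      have "z * a \<in> ?Z" if "z \<in> ?Z" for z
      proof -
        obtain x y where "z = x + y" "x \<in> J_ideal" "y \<in> I_ideal n" using \<open>z \<in> ?Z\<close> by blast
        then have "z * a = x * a + y * a" "x * a \<in> J_ideal" "y * a \<in> I_ideal n"
          by (simp_all add: distrib_right J_ideal_mult I_ideal_mult)
        then show ?thesis by blast
      qed
      then show "?Z \<subseteq> (\<lambda>x. x * a) -` closure ?Z" using closure_subset[of ?Z] by blast
      show "closed ((\<lambda>x. x * a) -` closure ?Z)"
        by (rule closed_vimage) (auto intro!: continuous_intros)
    qed
    then show ?thesis using one by auto
  qed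
  then show ?thesis by blast
qed

end


section \<open>Freeness implies density\<close>

context fock_module
begin

text \<open>
  The sum projects \<open>y\<close> to the part of the Fock space of degree \<open>-1\<close> modulo \<open>k\<close>, where the smallest
  degree is \<open>k - 1\<close>.
\<close>

lemma gauge_average_I_ideal:
  assumes k: "k \<ge> 2"
  shows "(\<Sum>z | z ^ k = 1. z *\<^sub>C ipF x (gauge_op z y)) \<in> I_ideal (k - 1)"
proof -
  define \<Phi> where "\<Phi> x y = (\<Sum>z | z ^ k = 1. z *\<^sub>C ipF x (gauge_op z y))" for x y
  let ?B = "range vac \<union> tens ` {es. es \<noteq> []}"
  have cm: "cmod z = 1" if "z ^ k = 1" for z :: complex using that k by (intro root_of_unity_cmod) auto
  note sub = complex_vector.subspace_0[OF csubspace_I_ideal] complex_vector.subspace_add[OF csubspace_I_ideal]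
    complex_vector.subspace_scale[OF csubspace_I_ideal]
  have gen: "\<Phi> x y \<in> I_ideal (k - 1)" if xB: "x \<in> ?B" and yB: "y \<in> ?B" for x y
  proof -
    consider b where "y = vac b" | f fs where "y = tens (f # fs)"
      using yB by (auto simp: neq_Nil_conv)
    then show ?thesis
    proof cases
      case 1
      have "\<Phi> x y = (\<Sum>z | z ^ k = 1. z *\<^sub>C ipF x (vac b))"
        unfolding \<Phi>_def 1 by (intro sum.cong refl) (simp add: gauge_op cm)
      also have "\<dots> = (\<Sum>z | z ^ k = 1. z ^ 1) *\<^sub>C ipF x (vac b)" by (simp add: scaleC_sum_left)
      \<comment> \<open>The vacuum has degree 0 and so weight \<open>z ^ 1\<close> in the average;
        it disappears because \<open>k \<ge> 2\<close>.\<close>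
      also have "(\<Sum>z | z ^ k = (1::complex). z ^ 1) = 0"
        by (rule sum_roots_unity_power) (use k in auto)
      finally show ?thesis by (simp add: sub)
    next
      case 2
      define n where "n = length (f # fs)"
      have "\<Phi> x y = (\<Sum>z | z ^ k = 1. z ^ Suc n *\<^sub>C ipF x y)"
        unfolding \<Phi>_def 2 n_def
        by (intro sum.cong refl) (simp add: gauge_op cm F.ip_scaleC_right)
      then have eq: "\<Phi> x y = (\<Sum>z | z ^ k = 1. z ^ Suc n) *\<^sub>C ipF x y" by (simp only: scaleC_sum_left)
      show ?thesis
      proof (cases "k dvd Suc n")
        case False
        then show ?thesis using eq sum_roots_unity_power[OF _ False] k sub(1) by simp
      next
        case True
        \<comment> \<open>A word of length \<open>n\<close> has weight \<open>z ^ Suc n\<close>; it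
          survives only if \<open>k\<close> divides \<open>n + 1\<close>, whence
          \<open>n \<ge> k - 1\<close>.\<close>
        then have n: "k - 1 \<le> n" using dvd_imp_le[of k "Suc n"] by simp
        have "ipF x y \<in> I_ideal (k - 1)"
        proof -
          consider b where "x = vac b" | e es where "x = tens (e # es)"
            using xB by (auto simp: neq_Nil_conv)
          then show ?thesis
          proof cases
            case 1
            then show ?thesis by (simp add: 2 ip_gen sub)
          next
            case x: 2
            show ?thesis
            proof (cases "length (e # es) = length (f # fs)")
              case True
              then have "ipF x y \<in> I_ideal n"
                unfolding x 2 n_def using tensor_ip_I_ideal[of "e # es" "f # fs"] by (simp add: ip_tens_tens)
              then show ?thesis using I_ideal_antimono[OF n] by blast
            next
              case False
              then show ?thesis by (simp add: x 2 ip_tens_tens tensor_ip_length sub)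
            qed
          qed
        qed
        then show ?thesis unfolding eq by (rule sub)
      qed
    qed
  qed
  have add: "\<Phi> (x + x') y = \<Phi> x y + \<Phi> x' y" "\<Phi> x (y + y') = \<Phi> x y + \<Phi> x y'" for x x' y y'
    by (simp_all add: \<Phi>_def F.ip_add_left F.ip_add_right blinfun.add_right scaleC_add_right sum.distrib)
  have sc: "\<Phi> (c *\<^sub>C x) y = cnj c *\<^sub>C \<Phi> x y" for c x y
    by (simp add: \<Phi>_def F.ip_scaleC_left scaleC_sum_right mult.commute)
  have sc': "\<Phi> x (c *\<^sub>C y) = c *\<^sub>C \<Phi> x y" for c x y
    unfolding \<Phi>_def scaleC_sum_right
    by (intro sum.cong refl)
      (simp add: F.adjointable_scaleC_apply gauge_op cm F.ip_scaleC_right mult.commute)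
  have zero: "\<Phi> 0 y = 0" "\<Phi> x 0 = 0" for x y by (simp_all add: \<Phi>_def)
  have 1: "\<Phi> x y \<in> I_ideal (k - 1)" if "y \<in> ?B" for x y
  proof -
    have "closure (cspan ?B) \<subseteq> {x. \<Phi> x y \<in> I_ideal (k - 1)}"
    proof (rule closure_cspan_minimal)
      show "csubspace {x. \<Phi> x y \<in> I_ideal (k - 1)}"
        by (rule complex_vector.subspaceI) (auto simp: add sc zero sub)
      have "continuous_on UNIV (\<lambda>x. \<Phi> x y)"
        unfolding \<Phi>_def by (intro continuous_intros F.continuous_on_ip)
      then show "closed {x. \<Phi> x y \<in> I_ideal (k - 1)}"
        using closed_vimage[OF closed_I_ideal] by (simp add: vimage_def)
    qed (use gen that in auto)
    then show ?thesis using fock_dense by auto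
  qed
  have "closure (cspan ?B) \<subseteq> {y. \<Phi> x y \<in> I_ideal (k - 1)}"
  proof (rule closure_cspan_minimal)
    show "csubspace {y. \<Phi> x y \<in> I_ideal (k - 1)}"
      by (rule complex_vector.subspaceI) (auto simp: add sc' zero sub)
    have "continuous_on UNIV (\<lambda>y. \<Phi> x y)"
      unfolding \<Phi>_def by (intro continuous_intros F.continuous_on_ip)
    then show "closed {y. \<Phi> x y \<in> I_ideal (k - 1)}"
      using closed_vimage[OF closed_I_ideal] by (simp add: vimage_def)
  qed (use 1 in auto)
  then show ?thesis using fock_dense by (auto simp: \<Phi>_def)
qed

text \<open>The Toeplitz operators with all coefficients in the closure of \<open>J_ideal\<close>
  form a closed ideal: a right factor only changes \<open>y\<close>, and a left factor passes to
  \<open>x\<close> by its adjoint.\<close>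

lemma covariance_coefficient:
  assumes X: "X \<in> covariance_ideal"
  shows "ipF x (X y) \<in> closure J_ideal"
proof -
  let ?D = "{X \<in> toeplitz_algebra. \<forall>x y. ipF x (X y) \<in> closure J_ideal}"
  have "closed_two_sided_ideal toeplitz_algebra ?D"
    unfolding closed_two_sided_ideal_def
  proof (intro conjI ballI)
    show "csubspace ?D"
      by (rule complex_vector.subspaceI)
        (auto simp: T.zero_closed T.add_closed T.scaleC_closed blinfun.add_left scaleC_blinfun.rep_eq
          F.ip_add_right F.ip_scaleC_right complex_vector.subspace_0[OF csubspace_closure_J]
          complex_vector.subspace_add[OF csubspace_closure_J]
          complex_vector.subspace_scale[OF csubspace_closure_J])
    have "closed {X. ipF x (blinfun_apply X y) \<in> closure J_ideal}" for x y
    proof -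
      have "continuous_on UNIV (\<lambda>X. ipF x (blinfun_apply X y))"
        by (intro continuous_intros F.continuous_on_ip)
      then show ?thesis using closed_vimage[OF closed_closure] by (simp add: vimage_def)
    qed
    moreover have "?D = toeplitz_algebra \<inter> (\<Inter>x. \<Inter>y. {X. ipF x (blinfun_apply X y) \<in> closure J_ideal})"
      by auto
    ultimately show "closed ?D" by (simp only:) (intro closed_Int T.closed closed_INT ballI)
    fix X Y assume XY: "X \<in> ?D" "Y \<in> toeplitz_algebra"
    then show "X o\<^sub>L Y \<in> ?D" by (simp add: T.mul_closed)
    have "ipF x (Y (X y)) = ipF (adj ipF Y x) (X y)" for x y
      using XY(2) by (simp add: F.ip_adj_left toeplitz_adjointable)
    then show "Y o\<^sub>L X \<in> ?D" using XY by (simp add: T.mul_closed)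
  qed auto
  then have "X \<in> ?D"
  proof (rule covariance_induct[OF X])
    fix a assume a: "a \<in> J_ideal"
    then have "a \<in> closure J_ideal" using closure_subset by blast
    then show "vac_op a \<in> ?D"
      using a by (simp add: vac_op_toeplitz ip_vac_op_eq closure_J_mult)
  qed
  then show ?thesis by simp
qed

lemma norm_vacuum_state: "norm (ipF (vac 1) (blinfun_apply X (vac 1))) \<le> 4 * norm X"
proof -
  have v: "norm (vac 1) \<le> 1" using norm_one_le[where 'a='a] by (simp add: norm_vac)
  have "norm (X (vac 1)) \<le> norm X * norm (vac 1)" by (rule norm_blinfun)
  also have "\<dots> \<le> norm X * 1" by (intro mult_left_mono v) simp
  finally have "norm (X (vac 1)) \<le> norm X" by simp
  then have "norm (vac 1) * norm (X (vac 1)) \<le> 1 * norm X" using v by (intro mult_mono) auto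
  then show ?thesis using F.norm_ip[of "vac 1" "X (vac 1)"] by simp
qed

end

context cuntz_pimsner_algebra
begin

lemma free_imp_approx:
  assumes k: "k \<ge> 2" and free: "free_action {z. z ^ k = 1} gauge" and e: "e > 0"
  shows "\<exists>x\<in>closure J_ideal. \<exists>y\<in>I_ideal (k - 1). norm (1 - (x + y)) \<le> 4 * e"
proof -
  let ?G = "{z::complex. z ^ k = 1}"
  have cm: "cmod z = 1" if "z \<in> ?G" for z using that k by (intro root_of_unity_cmod[of z k]) auto
  have "continuous_on ?G (\<lambda>z. cnj z *\<^sub>C (1::'b))"
    using k by (intro continuous_on_finite finite_roots_unity) auto
  then obtain ps :: "('b \<times> 'b) list" where
    ps: "\<And>z. z \<in> ?G \<Longrightarrow> norm (cnj z *\<^sub>C 1 - (\<Sum>(a, b)\<leftarrow>ps. a * gauge z b)) < e"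
    using free e unfolding free_action_def by blast
  define n where "n = length ps"
  have "\<forall>i. \<exists>X. X \<in> toeplitz_algebra \<and> q X = fst (ps ! i)" "\<forall>i. \<exists>X. X \<in> toeplitz_algebra \<and> q X = snd (ps ! i)"
    by (meson q_surj)+
  then obtain A B where A: "\<And>i. A i \<in> toeplitz_algebra" "\<And>i. q (A i) = fst (ps ! i)"
    and B: "\<And>i. B i \<in> toeplitz_algebra" "\<And>i. q (B i) = snd (ps ! i)" by metis
  \<comment> \<open>A lift of 1 minus \<open>z\<close> times the approximating sum. Its image in the
    quotient is small, so by the quotient norm \<open>D z\<close> is close to some
    \<open>C z\<close> in the covariance ideal.\<close>
  define D where "D z = id_blinfun - (\<Sum>i<n. z *\<^sub>C (A i o\<^sub>L gauge_conj z (B i)))" for z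
  define w where "w X = ipF (vac 1) (blinfun_apply X (vac 1))" for X
  have t: "z *\<^sub>C (A i o\<^sub>L gauge_conj z (B i)) \<in> toeplitz_algebra" if "z \<in> ?G" for z i
    by (intro T.scaleC_closed T.mul_closed gauge_conj_toeplitz A B cm that)
  have DT: "D z \<in> toeplitz_algebra" if "z \<in> ?G" for z
    unfolding D_def by (intro T.diff_closed id_toeplitz sum_toeplitz t that)
  have qD: "norm (q (D z)) < e" if z: "z \<in> ?G" for z
  proof -
    have "q (D z) = 1 - (\<Sum>i<n. z *\<^sub>C (fst (ps ! i) * gauge z (snd (ps ! i))))"
      unfolding D_def using z
      by (subst q_diff) (auto intro!: id_toeplitz sum_toeplitz t sum.cong simp: q_id q_sum t q_scaleC
          T.mul_closed gauge_conj_toeplitz A(1) B(1) cm q_mult simp flip: A(2) B(2) gauge_q)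
    also have "\<dots> = z *\<^sub>C (cnj z *\<^sub>C 1 - (\<Sum>i<n. fst (ps ! i) * gauge z (snd (ps ! i))))"
      using cnj_mult_self[OF cm[OF z]] by (simp add: scaleC_diff_right scaleC_sum_right)
    also have "(\<Sum>i<n. fst (ps ! i) * gauge z (snd (ps ! i))) = (\<Sum>(a, b)\<leftarrow>ps. a * gauge z b)"
      by (simp add: sum_list_sum_nth n_def atLeast0LessThan split_beta)
    finally show ?thesis using ps[OF z] cm[OF z] by (simp add: norm_scaleC)
  qed
  have "\<exists>C\<in>covariance_ideal. norm (D z - C) < e" if z: "z \<in> ?G" for z
  proof (rule ccontr)
    assume "\<not> ?thesis"
    then have "\<And>C. C \<in> covariance_ideal \<Longrightarrow> e \<le> dist (D z) C" by (auto simp: dist_norm not_less)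
    moreover have "covariance_ideal \<noteq> {}" using complex_vector.subspace_0[OF csubspace_covariance] by blast
    ultimately have "e \<le> infdist (D z) covariance_ideal"
      by (simp add: infdist_notempty cINF_greatest)
    then show False using qD[OF z] quotient_norm[OF DT[OF z]] by simp
  qed
  then obtain C where C: "\<And>z. z \<in> ?G \<Longrightarrow> C z \<in> covariance_ideal" "\<And>z. z \<in> ?G \<Longrightarrow> norm (D z - C z) < e"
    by metis
  define \<kappa> where "\<kappa> = (1 / of_nat k :: complex)"
  have \<kappa>: "\<kappa> * of_nat k = 1" "cmod \<kappa> * real k = 1" using k by (simp_all add: \<kappa>_def norm_divide)
  have card: "card ?G = k" using k by (intro card_roots_unity_eq) auto
  define x where "x = \<kappa> *\<^sub>C (\<Sum>z\<in>?G. w (C z))"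
  \<comment> \<open>With \<open>A i\<close> moved to the left vector and the vacuum fixed by the
    gauge unitaries, \<open>w (D z)\<close> averages to \<open>1 - y\<close>, while
    \<open>w (C z)\<close> averages to \<open>x\<close>. So \<open>1 - (x + y)\<close> is the
    average of the small errors \<open>w (D z - C z)\<close>.\<close>
  define y where "y = \<kappa> *\<^sub>C (\<Sum>i<n. \<Sum>z\<in>?G. z *\<^sub>C ipF (adj ipF (A i) (vac 1)) (gauge_op z (B i (vac 1))))"
  have wD: "w (D z) = 1 - (\<Sum>i<n. z *\<^sub>C ipF (adj ipF (A i) (vac 1)) (gauge_op z (B i (vac 1))))"
    if z: "z \<in> ?G" for z
    using cm[OF z]
    by (simp add: w_def D_def blinfun.diff_left blinfun.sum_left F.ip_diff_right
        bounded_bilinear.sum_right[OF F.bounded_bilinear_ip] scaleC_blinfun.rep_eq F.ip_scaleC_right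
        ip_vac_vac F.ip_adj_left toeplitz_adjointable[OF A(1)] gauge_conj_apply gauge_op)
  have "\<kappa> *\<^sub>C (\<Sum>z\<in>?G. w (D z)) = \<kappa> *\<^sub>C (\<Sum>z\<in>?G. 1 *\<^sub>C 1) - y"
    by (simp add: wD sum_subtractf scaleC_diff_right y_def sum.swap[of _ _ ?G])
  also have "(\<Sum>z\<in>?G. 1 *\<^sub>C (1::'a)) = of_nat k *\<^sub>C 1"
    unfolding scaleC_sum_left[symmetric] using card by simp
  finally have "1 - y = \<kappa> *\<^sub>C (\<Sum>z\<in>?G. w (D z))" using \<kappa>(1) by simp
  then have "1 - (x + y) = \<kappa> *\<^sub>C (\<Sum>z\<in>?G. w (D z - C z))"
    by (simp add: x_def w_def blinfun.diff_left F.ip_diff_right sum_subtractf scaleC_diff_right algebra_simps)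
  then have "norm (1 - (x + y)) = cmod \<kappa> * norm (\<Sum>z\<in>?G. w (D z - C z))" by (simp add: norm_scaleC)
  also have "norm (\<Sum>z\<in>?G. w (D z - C z)) \<le> of_nat (card ?G) * (4 * e)"
  proof (rule sum_norm_bound)
    fix z assume "z \<in> ?G"
    then have "4 * norm (D z - C z) \<le> 4 * e" using C(2) by (simp add: less_imp_le)
    then show "norm (w (D z - C z)) \<le> 4 * e"
      unfolding w_def using norm_vacuum_state[of "D z - C z"] by simp
  qed
  finally have "norm (1 - (x + y)) \<le> (cmod \<kappa> * real k) * (4 * e)"
    using card by (simp add: mult_left_mono mult.assoc)
  moreover have "x \<in> closure J_ideal"
    unfolding x_def w_def
    by (intro complex_vector.subspace_scale[OF csubspace_closure_J]
        complex_vector.subspace_sum[OF csubspace_closure_J] covariance_coefficient C)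
  moreover have "y \<in> I_ideal (k - 1)"
    unfolding y_def
    by (intro complex_vector.subspace_scale[OF csubspace_I_ideal]
        complex_vector.subspace_sum[OF csubspace_I_ideal] gauge_average_I_ideal k)
  ultimately show ?thesis using \<kappa>(2) by auto
qed


section \<open>Density implies freeness\<close>

text \<open>The closed span that occurs in freeness. Its members are functions on all complex
  numbers, but only their values at the roots of unity count.\<close>

definition gauge_span :: "nat \<Rightarrow> (complex \<Rightarrow> 'b) set" where
  "gauge_span k = {f. \<forall>\<epsilon>>0. \<exists>ps :: ('b \<times> 'b) list. \<forall>z\<in>{z. z ^ k = 1}.
     norm (f z - (\<Sum>(a, b)\<leftarrow>ps. a * gauge z b)) < \<epsilon>}"

lemma gauge_span_limit:
  assumes "\<And>\<epsilon>. \<epsilon> > 0 \<Longrightarrow> \<exists>g\<in>gauge_span k. \<forall>z\<in>{z. z ^ k = 1}. norm (f z - g z) < \<epsilon>"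
  shows "f \<in> gauge_span k"
  unfolding gauge_span_def
proof (intro CollectI allI impI)
  fix \<epsilon> :: real assume "\<epsilon> > 0"
  then obtain g where g: "g \<in> gauge_span k" "\<And>z. z ^ k = 1 \<Longrightarrow> norm (f z - g z) < \<epsilon> / 2"
    using assms[of "\<epsilon> / 2"] by auto
  obtain ps :: "('b \<times> 'b) list" where
    ps: "\<And>z. z ^ k = 1 \<Longrightarrow> norm (g z - (\<Sum>(a, b)\<leftarrow>ps. a * gauge z b)) < \<epsilon> / 2"
    using g(1) half_gt_zero[OF \<open>\<epsilon> > 0\<close>] unfolding gauge_span_def by blast
  have "norm (f z - (\<Sum>(a, b)\<leftarrow>ps. a * gauge z b)) < \<epsilon>" if "z ^ k = 1" for z
    using norm_diff_triangle_less[OF g(2)[OF that] ps[OF that]] by simp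
  then show "\<exists>ps :: ('b \<times> 'b) list. \<forall>z\<in>{z. z ^ k = 1}. norm (f z - (\<Sum>(a, b)\<leftarrow>ps. a * gauge z b)) < \<epsilon>"
    by blast
qed

lemma gauge_span_cong: "f \<in> gauge_span k \<Longrightarrow> (\<And>z. z ^ k = 1 \<Longrightarrow> f z = g z) \<Longrightarrow> g \<in> gauge_span k"
  unfolding gauge_span_def by auto

lemma gauge_span_base: "(\<lambda>z. a * gauge z b) \<in> gauge_span k"
  unfolding gauge_span_def by (auto intro!: exI[of _ "[(a, b)]"])

lemma gauge_span_zero: "(\<lambda>z. 0) \<in> gauge_span k"
  unfolding gauge_span_def by (auto intro!: exI[of _ "[]"])

lemma gauge_span_add:
  assumes "f \<in> gauge_span k" "g \<in> gauge_span k"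
  shows "(\<lambda>z. f z + g z) \<in> gauge_span k"
  unfolding gauge_span_def
proof (intro CollectI allI impI)
  fix \<epsilon> :: real assume "\<epsilon> > 0"
  then have e: "\<epsilon> / 2 > 0" by simp
  obtain ps :: "('b \<times> 'b) list" where
    ps: "\<And>z. z ^ k = 1 \<Longrightarrow> norm (f z - (\<Sum>(a, b)\<leftarrow>ps. a * gauge z b)) < \<epsilon> / 2"
    using assms(1) e unfolding gauge_span_def by blast
  obtain qs :: "('b \<times> 'b) list" where
    qs: "\<And>z. z ^ k = 1 \<Longrightarrow> norm (g z - (\<Sum>(a, b)\<leftarrow>qs. a * gauge z b)) < \<epsilon> / 2"
    using assms(2) e unfolding gauge_span_def by blast
  have "norm (f z + g z - (\<Sum>(a, b)\<leftarrow>ps @ qs. a * gauge z b)) < \<epsilon>" if "z ^ k = 1" for z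
    using norm_add_less[OF ps[OF that] qs[OF that]] by (simp add: algebra_simps)
  then show "\<exists>ps :: ('b \<times> 'b) list. \<forall>z\<in>{z. z ^ k = 1}. norm (f z + g z - (\<Sum>(a, b)\<leftarrow>ps. a * gauge z b)) < \<epsilon>"
    by blast
qed

lemma gauge_one: "cmod z = 1 \<Longrightarrow> gauge z 1 = 1"
  using gauge_q[OF _ id_toeplitz, of z] gauge_conj_left_op[of z 1] by (simp add: q_id left_op_one)

text \<open>\<open>gauge z\<close> is multiplicative, so each term becomes
  \<open>(c * a) * gauge z (b * d)\<close>. On the right this provides multiplication by orbits, not
  by constants.\<close>

lemma gauge_span_mult:
  assumes k: "k \<ge> 1" and f: "f \<in> gauge_span k"
  shows "(\<lambda>z. c * f z * gauge z d) \<in> gauge_span k"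
proof -
  have hom: "gauge z (x * y) = gauge z x * gauge z y" if "z ^ k = 1" for z x y
    using star_hom_onD(2)[OF gauge_star_hom[OF root_of_unity_cmod[OF that k]]] by auto
  \<comment> \<open>A common bound for both factors over the finite group; adding 1 makes it
    positive and strict.\<close>
  define M where "M = (\<Sum>z | z ^ k = 1. norm c * norm (gauge z d)) + 1"
  have fin: "finite {z::complex. z ^ k = 1}" using k by (intro finite_roots_unity) auto
  have M: "norm c * norm (gauge z d) < M" if "z ^ k = 1" for z
    using member_le_sum[of z "{z. z ^ k = 1}" "\<lambda>z. norm c * norm (gauge z d)"] fin that
    by (simp add: M_def)
  have M0: "M > 0" using M[of 1] by (smt (verit) norm_ge_zero mult_nonneg_nonneg power_one)
  show ?thesis
    unfolding gauge_span_def
  proof (intro CollectI allI impI)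
    fix \<epsilon> :: real assume "\<epsilon> > 0"
    then have e: "\<epsilon> / M > 0" using M0 by simp
    obtain ps :: "('b \<times> 'b) list" where
      ps: "\<And>z. z ^ k = 1 \<Longrightarrow> norm (f z - (\<Sum>(a, b)\<leftarrow>ps. a * gauge z b)) < \<epsilon> / M"
      using f e unfolding gauge_span_def by blast
    define qs where "qs = map (\<lambda>(a, b). (c * a, b * d)) ps"
    have "norm (c * f z * gauge z d - (\<Sum>(a, b)\<leftarrow>qs. a * gauge z b)) < \<epsilon>" if z: "z ^ k = 1" for z
    proof -
      have "(\<Sum>(a, b)\<leftarrow>qs. a * gauge z b) = c * (\<Sum>(a, b)\<leftarrow>ps. a * gauge z b) * gauge z d"
        unfolding qs_def
        by (induction ps) (auto simp: hom[OF z] distrib_left distrib_right mult.assoc)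
      then have "c * f z * gauge z d - (\<Sum>(a, b)\<leftarrow>qs. a * gauge z b) =
          c * (f z - (\<Sum>(a, b)\<leftarrow>ps. a * gauge z b)) * gauge z d"
        by (simp add: left_diff_distrib right_diff_distrib)
      also have "norm \<dots> \<le> norm c * norm (f z - (\<Sum>(a, b)\<leftarrow>ps. a * gauge z b)) * norm (gauge z d)"
        by (intro order_trans[OF norm_mult_ineq] mult_right_mono norm_mult_ineq norm_ge_zero)
      also have "\<dots> = norm c * norm (gauge z d) * norm (f z - (\<Sum>(a, b)\<leftarrow>ps. a * gauge z b))"
        by simp
      also have "\<dots> \<le> M * norm (f z - (\<Sum>(a, b)\<leftarrow>ps. a * gauge z b))"
        using M[OF z] by (intro mult_right_mono) auto
      also have "\<dots> < M * (\<epsilon> / M)" using ps[OF z] M0 by (intro mult_strict_left_mono) auto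
      also have "\<dots> = \<epsilon>" using M0 by simp
      finally show ?thesis .
    qed
    then show "\<exists>ps :: ('b \<times> 'b) list. \<forall>z\<in>{z. z ^ k = 1}. norm (c * f z * gauge z d - (\<Sum>(a, b)\<leftarrow>ps. a * gauge z b)) < \<epsilon>"
      by blast
  qed
qed

lemma gauge_span_mult_left: "k \<ge> 1 \<Longrightarrow> f \<in> gauge_span k \<Longrightarrow> (\<lambda>z. c * f z) \<in> gauge_span k"
  by (rule gauge_span_cong[OF gauge_span_mult[of k f c 1]]) (auto simp: gauge_one root_of_unity_cmod)

lemma gauge_span_sum:
  "(\<And>i. i \<in> I \<Longrightarrow> f i \<in> gauge_span k) \<Longrightarrow> (\<lambda>z. \<Sum>i\<in>I. f i z) \<in> gauge_span k"
  by (induction I rule: infinite_finite_induct) (auto simp: gauge_span_zero gauge_span_add)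

text \<open>\<open>cnj z\<close> is z^-1 at the roots of unity. The aim is to show that 1 belongs to
  this set.\<close>

definition cnj_span :: "nat \<Rightarrow> 'b set" where
  "cnj_span k = {b. (\<lambda>z. cnj z *\<^sub>C b) \<in> gauge_span k}"

lemma csubspace_cnj_span:
  assumes k: "k \<ge> 1"
  shows "csubspace (cnj_span k)"
proof (rule complex_vector.subspaceI)
  show "0 \<in> cnj_span k" by (simp add: cnj_span_def gauge_span_zero)
  show "x + y \<in> cnj_span k" if "x \<in> cnj_span k" "y \<in> cnj_span k" for x y
    using that gauge_span_add unfolding cnj_span_def by (fastforce simp: scaleC_add_right)
  show "c *\<^sub>C x \<in> cnj_span k" if "x \<in> cnj_span k" for c x
    using that gauge_span_mult_left[OF k, of "\<lambda>z. cnj z *\<^sub>C x" "c *\<^sub>C 1"]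
    by (simp add: cnj_span_def scaleC_mult_left mult.commute)
qed

lemma closed_cnj_span:
  assumes k: "k \<ge> 1"
  shows "closed (cnj_span k)"
proof -
  have "closure (cnj_span k) \<subseteq> cnj_span k"
  proof
    fix b assume b: "b \<in> closure (cnj_span k)"
    have "(\<lambda>z. cnj z *\<^sub>C b) \<in> gauge_span k"
    proof (rule gauge_span_limit)
      fix \<epsilon> :: real assume "\<epsilon> > 0"
      then obtain c where c: "c \<in> cnj_span k" "dist c b < \<epsilon>"
        using b unfolding closure_approachable by blast
      have "norm (cnj z *\<^sub>C b - cnj z *\<^sub>C c) < \<epsilon>" if "z ^ k = 1" for z
        using c(2) root_of_unity_cmod[OF that k]
        by (simp add: norm_scaleC dist_norm norm_minus_commute flip: scaleC_diff_right)
      then show "\<exists>g\<in>gauge_span k. \<forall>z\<in>{z. z ^ k = 1}. norm (cnj z *\<^sub>C b - g z) < \<epsilon>"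
        using c(1) by (intro bexI[of _ "\<lambda>z. cnj z *\<^sub>C c"]) (auto simp: cnj_span_def)
    qed
    then show "b \<in> cnj_span k" by (simp add: cnj_span_def)
  qed
  then show ?thesis by (simp add: closure_subset_eq)
qed

section \<open>Elements of \<open>A\<close> in the coefficient space of z^-1\<close>

lemma pi_star_hom: "star_hom_on UNIV (*) star (*) star (\<lambda>a. q (left_op a))"
  by (rule star_hom_on_compose[OF left_op_star_hom _ quotient_star_hom])
    (auto simp: left_op_toeplitz)

lemma pi_bounded: "\<exists>C. \<forall>a\<in>UNIV. norm (q (left_op a)) \<le> C * norm a"
  by (rule star_hom_cstar_bounded[OF star_algebra_on_UNIV pi_star_hom])

lemma
  assumes V: "csubspace V" "closed V"
  shows csubspace_pi_vimage: "csubspace {a. q (left_op a) \<in> V}"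
    and closed_pi_vimage: "closed {a. q (left_op a) \<in> V}"
  using star_algebra_on.csubspace_star_hom_vimage[OF star_algebra_on_UNIV pi_star_hom V(1)]
    star_algebra_on.closed_star_hom_vimage[OF star_algebra_on_UNIV pi_star_hom pi_bounded V(2)]
  by simp_all

lemma gauge_creation: "cmod z = 1 \<Longrightarrow> gauge z (q (creation e)) = z *\<^sub>C q (creation e)"
  by (simp add: gauge_q creation_toeplitz gauge_conj_creation q_scaleC)

text \<open>The adjoint of \<open>creation f\<close> has weight z^-1, so for a rank one operator a
  single product of a creation operator with an orbit suffices. Automatic continuity extends this to
  limits.\<close>

lemma compact_cnj_span:
  assumes k: "k \<ge> 1" and K: "K \<in> compact_ops act ip"
  shows "q (amp K) \<in> cnj_span k"
proof -
  interpret C: star_algebra_on "compact_ops act ip" "(o\<^sub>L)" "adj ip" by (rule star_algebra_compact)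
  have hom: "star_hom_on (compact_ops act ip) (o\<^sub>L) (adj ip) (*) star (\<lambda>K. q (amp K))"
    by (rule star_hom_on_compose[OF amp_compact_star_hom _ quotient_star_hom]) (auto simp: amp_toeplitz)
  have "K \<in> {K \<in> compact_ops act ip. q (amp K) \<in> cnj_span k}" using K
  proof (induction rule: compact_ops_induct)
    case (base e f)
    have eq: "q (amp (ketbra act ip e f)) = q (creation e) * star (q (creation f))"
      by (simp add: amp_ketbra q_mult q_adj creation_toeplitz T.st_closed)
    have "q (creation e) * gauge z (star (q (creation f))) = cnj z *\<^sub>C (q (creation e) * star (q (creation f)))"
      if "z ^ k = 1" for z
    proof -
      have cm: "cmod z = 1" by (rule root_of_unity_cmod[OF that k])
      have "gauge z (star (q (creation f))) = star (gauge z (q (creation f)))"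
        by (rule star_hom_onD(4)[OF gauge_star_hom[OF cm]]) simp
      then show ?thesis by (simp add: gauge_creation cm star_scaleC scaleC_mult_right)
    qed
    then have "(\<lambda>z. cnj z *\<^sub>C q (amp (ketbra act ip e f))) \<in> gauge_span k"
      unfolding eq by (rule gauge_span_cong[OF gauge_span_base])
    then show ?case by (simp add: ketbra_compact cnj_span_def)
  next
    case subspace
    show ?case by (rule C.csubspace_star_hom_vimage[OF hom csubspace_cnj_span[OF k]])
  next
    case closed
    show ?case
      by (intro C.closed_star_hom_vimage[OF hom _ closed_cnj_span[OF k]]
          star_hom_cstar_bounded[OF star_algebra_compact hom])
  qed
  then show ?thesis by simp
qed

text \<open>The vacuum part of \<open>left_op a\<close> vanishes in the quotient and leaves the
  amplification of a compact operator.\<close>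

lemma J_ideal_cnj_span:
  assumes k: "k \<ge> 1" and a: "a \<in> J_ideal"
  shows "q (left_op a) \<in> cnj_span k"
proof -
  have K: "\<phi> a \<in> compact_ops act ip" using a by (simp add: J_ideal_def)
  have "q (left_op a) = q (amp (\<phi> a)) + q (vac_op a)"
    by (simp add: left_op_eq q_add amp_toeplitz K vac_op_toeplitz a)
  also have "q (vac_op a) = 0" by (intro q_covariance vac_op_covariance a)
  finally show ?thesis using compact_cnj_span[OF k K] by simp
qed

text \<open>The spectral subspace of the character \<open>z ^ n\<close>; only the residue of
  \<open>n\<close> modulo \<open>k\<close> matters.\<close>

definition degree_space :: "nat \<Rightarrow> nat \<Rightarrow> 'b set" where
  "degree_space k n = {b. \<forall>z. z ^ k = 1 \<longrightarrow> gauge z b = z ^ n *\<^sub>C b}"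

lemma creation_degree_space: "k \<ge> 1 \<Longrightarrow> q (creation e) \<in> degree_space k 1"
  by (simp add: degree_space_def gauge_creation root_of_unity_cmod)

lemma mult_degree_space:
  assumes k: "k \<ge> 1" and u: "u \<in> degree_space k m" and v: "v \<in> degree_space k n"
  shows "u * v \<in> degree_space k (m + n)"
  using u v star_hom_onD(2)[OF gauge_star_hom[OF root_of_unity_cmod[OF _ k]]]
  by (simp add: degree_space_def scaleC_mult_left scaleC_mult_right power_add mult.commute)

text \<open>In the quotient \<open>ip e (\<phi> x f)\<close> is \<open>x\<close> between the adjoint
  of \<open>creation e\<close> and \<open>creation f\<close>. This turns \<open>star u * v\<close>
  into \<open>star (u * q (creation e)) * (v * q (creation f))\<close>, with both degrees raised by
  1.\<close>

lemma I_ideal_degree_space: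
  assumes k: "k \<ge> 1" and n: "n \<ge> 1" and x: "x \<in> I_ideal n"
  shows "q (left_op x) \<in> closure (cspan {star u * v |u v. u \<in> degree_space k n \<and> v \<in> degree_space k n})"
proof -
  define R where "R n = {star u * v |u v. u \<in> degree_space k n \<and> v \<in> degree_space k n}" for n
  note pi = csubspace_pi_vimage[OF csubspace_closure_cspan closed_closure]
    closed_pi_vimage[OF csubspace_closure_cspan closed_closure]
  have t: "q (left_op (ip e f)) = star (q (creation e)) * q (creation f)" for e f
    by (simp add: q_mult q_adj creation_toeplitz T.st_closed flip: adj_creation_creation)
  have step: "q (left_op (ip e (\<phi> x f))) = star (q (creation e)) * q (left_op x) * q (creation f)" for e f x
    by (simp add: t mult.assoc q_mult creation_toeplitz left_op_toeplitz flip: left_op_creation)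
  have "I_ideal (Suc m) \<subseteq> {x. q (left_op x) \<in> closure (cspan (R (Suc m)))}" for m
  proof (induction m)
    case 0
    show ?case unfolding I_ideal.simps
    proof (rule closure_cspan_minimal[OF _ pi])
      have "star (q (creation e)) * q (creation f) \<in> R (Suc 0)" for e f
        using creation_degree_space[OF k] unfolding R_def by auto
      then show "{ip e f |e f. True} \<subseteq> {x. q (left_op x) \<in> closure (cspan (R (Suc 0)))}"
        by (auto simp: t intro: closure_cspan_base)
    qed
  next
    case (Suc m)
    have conj: "star (q (creation e)) * y * q (creation f) \<in> closure (cspan (R (Suc (Suc m))))"
      if "y \<in> closure (cspan (R (Suc m)))" for e f y
    proof -
      let ?g = "\<lambda>y. star (q (creation e)) * y * q (creation f)"
      have "closure (cspan (R (Suc m))) \<subseteq> {y. ?g y \<in> closure (cspan (R (Suc (Suc m))))}"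
      proof (rule closure_cspan_minimal)
        show "R (Suc m) \<subseteq> {y. ?g y \<in> closure (cspan (R (Suc (Suc m))))}"
        proof
          fix y assume "y \<in> R (Suc m)"
          then obtain u v where uv: "y = star u * v" "u \<in> degree_space k (Suc m)" "v \<in> degree_space k (Suc m)"
            unfolding R_def by blast
          have "?g y = star (u * q (creation e)) * (v * q (creation f))"
            by (simp add: uv star_mult mult.assoc)
          moreover have "w * q (creation e) \<in> degree_space k (Suc (Suc m))"
            if "w \<in> degree_space k (Suc m)" for w e
            using mult_degree_space[OF k that creation_degree_space[OF k]] by simp
          ultimately have "?g y \<in> R (Suc (Suc m))" unfolding R_def using uv(2,3) by blast
          then show "y \<in> {y. ?g y \<in> closure (cspan (R (Suc (Suc m))))}" by (simp add: closure_cspan_base)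
        qed
        show "csubspace {y. ?g y \<in> closure (cspan (R (Suc (Suc m))))}"
          by (rule complex_vector.subspaceI)
            (auto simp: distrib_left distrib_right scaleC_mult_left scaleC_mult_right
              complex_vector.subspace_0[OF csubspace_closure_cspan]
              complex_vector.subspace_add[OF csubspace_closure_cspan]
              complex_vector.subspace_scale[OF csubspace_closure_cspan])
        have "closed (?g -` closure (cspan (R (Suc (Suc m)))))"
          by (rule closed_vimage) (auto intro!: continuous_intros)
        then show "closed {y. ?g y \<in> closure (cspan (R (Suc (Suc m))))}" by (simp add: vimage_def)
      qed
      then show ?thesis using that by auto
    qed
    show ?case unfolding I_ideal.simps(3)
    proof (rule closure_cspan_minimal[OF _ pi])
      show "{ip e (\<phi> x f) |e f x. x \<in> I_ideal (Suc m)} \<subseteq> {x. q (left_op x) \<in> closure (cspan (R (Suc (Suc m))))}"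
        using Suc conj step by fastforce
    qed
  qed
  from this[of "n - 1"] show ?thesis using n x by (auto simp: R_def)
qed

text \<open>\<open>v\<close> has weight \<open>z ^ (k - 1)\<close>, that is z^-1, so the single term
  \<open>star u * gauge z v\<close> is already the required function.\<close>

lemma I_ideal_cnj_span:
  assumes k: "k \<ge> 2" and x: "x \<in> I_ideal (k - 1)"
  shows "q (left_op x) \<in> cnj_span k"
proof -
  have k1: "k \<ge> 1" using k by simp
  have "closure (cspan {star u * v |u v. u \<in> degree_space k (k - 1) \<and> v \<in> degree_space k (k - 1)}) \<subseteq> cnj_span k"
  proof (rule closure_cspan_minimal[OF _ csubspace_cnj_span[OF k1] closed_cnj_span[OF k1]])
    have "star u * v \<in> cnj_span k" if "v \<in> degree_space k (k - 1)" for u v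
    proof -
      have "star u * gauge z v = cnj z *\<^sub>C (star u * v)" if z: "z ^ k = 1" for z
        using \<open>v \<in> degree_space k (k - 1)\<close> z root_of_unity_power_pred[OF z k1]
        by (simp add: degree_space_def scaleC_mult_right)
      then show ?thesis unfolding cnj_span_def
        by (intro CollectI gauge_span_cong[OF gauge_span_base]) auto
    qed
    then show "{star u * v |u v. u \<in> degree_space k (k - 1) \<and> v \<in> degree_space k (k - 1)} \<subseteq> cnj_span k"
      by blast
  qed
  then show ?thesis using I_ideal_degree_space[OF k1 _ x] k by auto
qed

lemma dense_imp_one_cnj_span:
  assumes k: "k \<ge> 2" and dense: "closure {x + y |x y. x \<in> J_ideal \<and> y \<in> I_ideal (k - 1)} = UNIV"
  shows "1 \<in> cnj_span k"
proof -
  have k1: "k \<ge> 1" using k by simp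
  let ?V = "{a. q (left_op a) \<in> cnj_span k}"
  note sp = csubspace_pi_vimage[OF csubspace_cnj_span[OF k1] closed_cnj_span[OF k1]]
  have "closure {x + y |x y. x \<in> J_ideal \<and> y \<in> I_ideal (k - 1)} \<subseteq> ?V"
  proof (rule closure_minimal)
    show "closed ?V" by (rule closed_pi_vimage[OF csubspace_cnj_span[OF k1] closed_cnj_span[OF k1]])
    have "x \<in> ?V" "y \<in> ?V" if "x \<in> J_ideal" "y \<in> I_ideal (k - 1)" for x y
      using that J_ideal_cnj_span[OF k1] I_ideal_cnj_span[OF k] by auto
    then show "{x + y |x y. x \<in> J_ideal \<and> y \<in> I_ideal (k - 1)} \<subseteq> ?V"
      using complex_vector.subspace_add[OF sp] by blast
  qed
  then have "1 \<in> ?V" unfolding dense by blast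
  then show ?thesis by (simp add: left_op_one q_id)
qed

lemma cnj_power_gauge_span:
  assumes k: "k \<ge> 1" and one: "1 \<in> cnj_span k"
  shows "(\<lambda>z. cnj z ^ m *\<^sub>C 1) \<in> gauge_span k"
proof (induction m)
  case 0
  show ?case
    by (rule gauge_span_cong[OF gauge_span_base[of 1 1]]) (use k in \<open>auto simp: gauge_one root_of_unity_cmod\<close>)
next
  case (Suc m)
  show ?case
  proof (rule gauge_span_limit)
    fix \<epsilon> :: real assume "\<epsilon> > 0"
    then obtain ps :: "('b \<times> 'b) list" where
      ps: "\<And>z. z ^ k = 1 \<Longrightarrow> norm (cnj z *\<^sub>C 1 - (\<Sum>(a, b)\<leftarrow>ps. a * gauge z b)) < \<epsilon>"
      using one unfolding cnj_span_def gauge_span_def by blast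
    \<comment> \<open>The approximation of z^-1 is put around z^-m, with \<open>a\<close> on the
      left and the orbit of \<open>b\<close> on the right. As z^-m is a scalar, the sum is z^-m
      times that approximation.\<close>
    have "(\<lambda>z. \<Sum>(a, b)\<leftarrow>rs. a * (cnj z ^ m *\<^sub>C 1) * gauge z b) \<in> gauge_span k" for rs
      by (induction rs) (auto intro!: gauge_span_add gauge_span_mult[OF k Suc] simp: gauge_span_zero)
    moreover have "norm (cnj z ^ Suc m *\<^sub>C 1 - (\<Sum>(a, b)\<leftarrow>ps. a * (cnj z ^ m *\<^sub>C 1) * gauge z b)) < \<epsilon>"
      if z: "z ^ k = 1" for z
    proof -
      have "(\<Sum>(a, b)\<leftarrow>rs. a * (cnj z ^ m *\<^sub>C 1) * gauge z b) = cnj z ^ m *\<^sub>C (\<Sum>(a, b)\<leftarrow>rs. a * gauge z b)" for rs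
        by (induction rs) (auto simp: scaleC_mult_right scaleC_mult_left scaleC_add_right)
      then have "cnj z ^ Suc m *\<^sub>C 1 - (\<Sum>(a, b)\<leftarrow>ps. a * (cnj z ^ m *\<^sub>C 1) * gauge z b) =
          cnj z ^ m *\<^sub>C (cnj z *\<^sub>C 1 - (\<Sum>(a, b)\<leftarrow>ps. a * gauge z b))"
        by (simp add: scaleC_diff_right mult.commute)
      then show ?thesis
        using ps[OF z] root_of_unity_cmod[OF z k] by (simp add: norm_scaleC norm_power)
    qed
    ultimately show "\<exists>g\<in>gauge_span k. \<forall>z\<in>{z. z ^ k = 1}. norm (cnj z ^ Suc m *\<^sub>C 1 - g z) < \<epsilon>"
      by (intro bexI[of _ "\<lambda>z. \<Sum>(a, b)\<leftarrow>ps. a * (cnj z ^ m *\<^sub>C 1) * gauge z b"] ballI) auto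
  qed
qed

lemma gauge_span_UNIV:
  assumes k: "k \<ge> 1" and one: "1 \<in> cnj_span k"
  shows "f \<in> gauge_span k"
proof -
  let ?G = "{z::complex. z ^ k = 1}"
  \<comment> \<open>The Fourier coefficient of \<open>f\<close> at z^-m; inversion is the
    orthogonality relation \<open>sum_powers_root_unity\<close>.\<close>
  define c where "c m = (1 / of_nat k) *\<^sub>C (\<Sum>w\<in>?G. w ^ m *\<^sub>C f w)" for m
  have "(\<lambda>z. \<Sum>m<k. c m * (cnj z ^ m *\<^sub>C 1)) \<in> gauge_span k"
    by (intro gauge_span_sum gauge_span_mult_left k cnj_power_gauge_span one)
  moreover have "(\<Sum>m<k. c m * (cnj z ^ m *\<^sub>C 1)) = f z" if z: "z ^ k = 1" for z
  proof -
    have zw: "(\<Sum>m<k. (cnj z * w) ^ m) = (if w = z then of_nat k else 0)" if "w \<in> ?G" for w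
    proof -
      have "cnj z * w = 1 \<longleftrightarrow> w = z"
        using cnj_mult_self[OF root_of_unity_cmod[OF z k]] by (metis mult.assoc mult.commute mult_1)
      moreover have "(cnj z * w) ^ k = 1"
        using that z by (simp add: power_mult_distrib flip: complex_cnj_power)
      ultimately show ?thesis using sum_powers_root_unity[of "cnj z * w" k] by simp
    qed
    have "(\<Sum>m<k. c m * (cnj z ^ m *\<^sub>C 1)) =
        (1 / of_nat k) *\<^sub>C (\<Sum>m<k. \<Sum>w\<in>?G. (cnj z * w) ^ m *\<^sub>C f w)"
      by (simp add: c_def scaleC_mult_right scaleC_sum_right power_mult_distrib mult_ac)
    also have "(\<Sum>m<k. \<Sum>w\<in>?G. (cnj z * w) ^ m *\<^sub>C f w) = (\<Sum>w\<in>?G. (\<Sum>m<k. (cnj z * w) ^ m) *\<^sub>C f w)"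
      by (subst sum.swap) (simp add: scaleC_sum_left)
    also have "\<dots> = (\<Sum>w\<in>?G. if w = z then of_nat k *\<^sub>C f z else 0)"
      by (intro sum.cong refl) (simp add: zw)
    also have "\<dots> = of_nat k *\<^sub>C f z"
      using z finite_roots_unity[OF k, where 'a=complex] by (subst sum.delta) auto
    finally show ?thesis using k by simp
  qed
  ultimately show ?thesis by (rule gauge_span_cong)
qed

lemma gauge_free_iff:
  assumes k: "k \<ge> 2"
  shows "free_action {z. z ^ k = 1} gauge \<longleftrightarrow>
    closure {x + y |x y. x \<in> J_ideal \<and> y \<in> I_ideal (k - 1)} = UNIV"
proof
  assume free: "free_action {z. z ^ k = 1} gauge"
  show "closure {x + y |x y. x \<in> J_ideal \<and> y \<in> I_ideal (k - 1)} = UNIV"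
  proof (rule closure_sum_eq_UNIV)
    fix e :: real assume "e > 0"
    then show "\<exists>x\<in>closure J_ideal. \<exists>y\<in>I_ideal (k - 1). norm (1 - (x + y)) \<le> e"
      using free_imp_approx[OF k free, of "e / 4"] by simp
  qed
next
  assume "closure {x + y |x y. x \<in> J_ideal \<and> y \<in> I_ideal (k - 1)} = UNIV"
  then have "f \<in> gauge_span k" for f
    using dense_imp_one_cnj_span[OF k] k by (intro gauge_span_UNIV) auto
  then show "free_action {z. z ^ k = 1} gauge"
    unfolding free_action_def gauge_span_def by blast
qed

end


theorem theorem2p8:
  fixes k :: nat
    and act :: "'e::complex_banach \<Rightarrow> 'a::unital_cstar_algebra \<Rightarrow> 'e"
    and ip :: "'e \<Rightarrow> 'e \<Rightarrow> 'a"
    and \<phi> :: "'a \<Rightarrow> ('e \<Rightarrow>\<^sub>L 'e)"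
    and actF :: "'f::complex_banach \<Rightarrow> 'a \<Rightarrow> 'f"
    and ipF :: "'f \<Rightarrow> 'f \<Rightarrow> 'a"
    and vac :: "'a \<Rightarrow> 'f"
    and tens :: "'e list \<Rightarrow> 'f"
    and q :: "('f \<Rightarrow>\<^sub>L 'f) \<Rightarrow> 'b::unital_cstar_algebra"
  assumes "k \<ge> 2"
    and "unital_correspondence act ip \<phi>"
    and "fock_module act ip \<phi> actF ipF vac tens"
    and "cuntz_pimsner_algebra act ip \<phi> actF ipF vac tens q"
  shows "free_action {z. z ^ k = 1} (cuntz_pimsner_algebra.gauge act \<phi> ipF vac tens q) \<longleftrightarrow>
    closure {x + y |x y. x \<in> unital_correspondence.J_ideal act ip \<phi> \<and>
                         y \<in> unital_correspondence.I_ideal ip \<phi> (k - 1)} = UNIV"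
proof -
  interpret cuntz_pimsner_algebra act ip \<phi> actF ipF vac tens q
    by (rule assms(4))
  show ?thesis
    by (rule gauge_free_iff[OF assms(1)])
qed

end
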